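(* Let $\Gamma$ be a finite simplicial graph and $\mathcal{G}=\{G_u \mid u\in V(\Gamma)\}$ a collection of finitely generated groups indexed by $V(\Gamma)$. If the conjugacy length function of every vertex-group $G_u$ is linear, then the conjugacy length function of the graph product $\Gamma\mathcal{G}$ is linear as well.
   Context: The graph product $\Gamma\mathcal{G}$ is the quotient of the free product $\ast_{u\in V(\Gamma)}G_u$ by the normal subgroup generated by all commutators $[g,h]$ with $g\in G_u$, $h\in G_v$, $\{u,v\}\in E(\Gamma)$. The $G_u$ are called vertex-groups and are always assumed non-trivial. For a group $G$ with finite generating set $S$ and associated word length $\|\cdot\|_S$, the conjugacy length function is $$\mathrm{CLF}_G:n\mapsto\max_{a,b}\ \min_{c\in G,\ cac^{-1}=b}\|c\|_S,$$ where the maximum is over pairs of conjugate elements $a,b\in G$ with $\|a\|_S+\|b\|_S\leq n$. It is called linear if there is a constant $K$ such that $\mathrm{CLF}_G(n)\leq K n$ for every $n\geq 1$; this does not depend on the finite generating set. *)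

theory Defs
  imports "HOL-Algebra.Generated_Groups" "Graph_Theory.Pair_Digraph"
begin

section \<open>Free products\<close>

text \<open>
  The free product of the groups \<open>G u\<close>, \<open>u \<in> I\<close>, is realised as the words over the disjoint union
  of the factors, modulo the equivalence relation generated by deleting an identity element and by
  multiplying two adjacent letters of the same factor.
\<close>

definition fp_words :: "'v set \<Rightarrow> ('v \<Rightarrow> ('g, 'm) monoid_scheme) \<Rightarrow> ('v \<times> 'g) list set" where
  "fp_words I G = lists (SIGMA u:I. carrier (G u))"

inductive_set fp_rel ::
  "'v set \<Rightarrow> ('v \<Rightarrow> ('g, 'm) monoid_scheme) \<Rightarrow> (('v \<times> 'g) list \<times> ('v \<times> 'g) list) set"
  for I G where
  refl: "w \<in> fp_words I G \<Longrightarrow> (w, w) \<in> fp_rel I G"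
| sym: "(v, w) \<in> fp_rel I G \<Longrightarrow> (w, v) \<in> fp_rel I G"
| trans: "(u, v) \<in> fp_rel I G \<Longrightarrow> (v, w) \<in> fp_rel I G \<Longrightarrow> (u, w) \<in> fp_rel I G"
| delete_one: "\<lbrakk>x \<in> fp_words I G; y \<in> fp_words I G; u \<in> I\<rbrakk>
    \<Longrightarrow> (x @ [(u, \<one>\<^bsub>G u\<^esub>)] @ y, x @ y) \<in> fp_rel I G"
| merge: "\<lbrakk>x \<in> fp_words I G; y \<in> fp_words I G; u \<in> I; g \<in> carrier (G u); h \<in> carrier (G u)\<rbrakk>
    \<Longrightarrow> (x @ [(u, g), (u, h)] @ y, x @ [(u, g \<otimes>\<^bsub>G u\<^esub> h)] @ y) \<in> fp_rel I G"

definition free_product ::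
  "'v set \<Rightarrow> ('v \<Rightarrow> ('g, 'm) monoid_scheme) \<Rightarrow> ('v \<times> 'g) list set monoid" where
  "free_product I G =
    \<lparr>carrier = fp_words I G // fp_rel I G,
     monoid.mult = (\<lambda>A B. \<Union>a\<in>A. \<Union>b\<in>B. fp_rel I G `` {a @ b}),
     one = fp_rel I G `` {[]}\<rparr>"

definition fp_incl :: "'v set \<Rightarrow> ('v \<Rightarrow> ('g, 'm) monoid_scheme) \<Rightarrow> 'v \<Rightarrow> 'g \<Rightarrow> ('v \<times> 'g) list set"
  where "fp_incl I G u g = fp_rel I G `` {[(u, g)]}"


section \<open>Graph products\<close>

definition normal_closure :: "('a, 'b) monoid_scheme \<Rightarrow> 'a set \<Rightarrow> 'a set" where
  "normal_closure G R = \<Inter>{N. N \<lhd> G \<and> R \<subseteq> N}"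

definition commutator :: "('a, 'b) monoid_scheme \<Rightarrow> 'a \<Rightarrow> 'a \<Rightarrow> 'a" where
  "commutator G a b = a \<otimes>\<^bsub>G\<^esub> b \<otimes>\<^bsub>G\<^esub> inv\<^bsub>G\<^esub> a \<otimes>\<^bsub>G\<^esub> inv\<^bsub>G\<^esub> b"

definition graph_product_relators ::
  "'v pair_pre_digraph \<Rightarrow> ('v \<Rightarrow> ('g, 'm) monoid_scheme) \<Rightarrow> ('v \<times> 'g) list set set" where
  "graph_product_relators \<Gamma> G =
    {commutator (free_product (pverts \<Gamma>) G)
       (fp_incl (pverts \<Gamma>) G u g) (fp_incl (pverts \<Gamma>) G v h) | u v g h.
       (u, v) \<in> parcs \<Gamma> \<and> g \<in> carrier (G u) \<and> h \<in> carrier (G v)}"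

definition graph_product ::
  "'v pair_pre_digraph \<Rightarrow> ('v \<Rightarrow> ('g, 'm) monoid_scheme) \<Rightarrow> ('v \<times> 'g) list set set monoid" where
  "graph_product \<Gamma> G =
    free_product (pverts \<Gamma>) G Mod
      normal_closure (free_product (pverts \<Gamma>) G) (graph_product_relators \<Gamma> G)"


section \<open>Word length and conjugacy length\<close>

definition finite_generating_set :: "('a, 'b) monoid_scheme \<Rightarrow> 'a set \<Rightarrow> bool" where
  "finite_generating_set G S \<longleftrightarrow> finite S \<and> S \<subseteq> carrier G \<and> generate G S = carrier G"

definition word_length :: "('a, 'b) monoid_scheme \<Rightarrow> 'a set \<Rightarrow> 'a \<Rightarrow> nat" where
  "word_length G S g =
    (LEAST n. \<exists>w. length w = n \<and> set w \<subseteq> S \<union> (m_inv G) ` S \<and> foldr (monoid.mult G) w \<one>\<^bsub>G\<^esub> = g)"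

definition conjugators :: "('a, 'b) monoid_scheme \<Rightarrow> 'a \<Rightarrow> 'a \<Rightarrow> 'a set" where
  "conjugators G a b = {c \<in> carrier G. c \<otimes>\<^bsub>G\<^esub> a \<otimes>\<^bsub>G\<^esub> inv\<^bsub>G\<^esub> c = b}"

definition conj_length :: "('a, 'b) monoid_scheme \<Rightarrow> 'a set \<Rightarrow> 'a \<Rightarrow> 'a \<Rightarrow> nat" where
  "conj_length G S a b = (LEAST k. \<exists>c \<in> conjugators G a b. word_length G S c = k)"

text \<open>
  For a finite generating set \<open>S\<close> the set below is finite, because balls are, and it contains the
  conjugacy length of the pair \<open>(\<one>, \<one>)\<close>; so \<^const>\<open>Max\<close> is meaningful.
\<close>

definition CLF :: "('a, 'b) monoid_scheme \<Rightarrow> 'a set \<Rightarrow> nat \<Rightarrow> nat" where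
  "CLF G S n = Max {conj_length G S a b | a b.
     a \<in> carrier G \<and> b \<in> carrier G \<and> conjugators G a b \<noteq> {} \<and>
     word_length G S a + word_length G S b \<le> n}"

definition linear_CLF :: "('a, 'b) monoid_scheme \<Rightarrow> 'a set \<Rightarrow> bool" where
  "linear_CLF G S \<longleftrightarrow> (\<exists>K::real. \<forall>n\<ge>1. real (CLF G S n) \<le> K * real n)"


section \<open>The constructions above yield groups\<close>

lemma fp_words_simps [simp]:
  "[] \<in> fp_words I G"
  "p # w \<in> fp_words I G \<longleftrightarrow> fst p \<in> I \<and> snd p \<in> carrier (G (fst p)) \<and> w \<in> fp_words I G"
  "v @ w \<in> fp_words I G \<longleftrightarrow> v \<in> fp_words I G \<and> w \<in> fp_words I G"
  by (cases p; auto simp: fp_words_def)+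

locale group_family =
  fixes I :: "'v set" and G :: "'v \<Rightarrow> ('g, 'm) monoid_scheme"
  assumes group_factor: "u \<in> I \<Longrightarrow> group (G u)"
begin

lemma factor_closed:
  assumes "u \<in> I"
  shows "\<one>\<^bsub>G u\<^esub> \<in> carrier (G u)"
    and "g \<in> carrier (G u) \<Longrightarrow> h \<in> carrier (G u) \<Longrightarrow> g \<otimes>\<^bsub>G u\<^esub> h \<in> carrier (G u)"
    and "g \<in> carrier (G u) \<Longrightarrow> inv\<^bsub>G u\<^esub> g \<in> carrier (G u)"
  using group_factor[OF assms]
  by (auto simp: group.is_monoid monoid.m_closed monoid.one_closed group.inv_closed)

lemma fp_rel_in_words: "(v, w) \<in> fp_rel I G \<Longrightarrow> v \<in> fp_words I G \<and> w \<in> fp_words I G"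
  by (induction rule: fp_rel.induct) (auto simp: factor_closed)

lemma fp_rel_context:
  assumes "(v, w) \<in> fp_rel I G" "x \<in> fp_words I G" "y \<in> fp_words I G"
  shows "(x @ v @ y, x @ w @ y) \<in> fp_rel I G"
  using assms
proof (induction rule: fp_rel.induct)
  case (delete_one p q u)
  then show ?case using fp_rel.delete_one[of "x @ p" I G "q @ y" u] by simp
next
  case (merge p q u g h)
  then show ?case using fp_rel.merge[of "x @ p" I G "q @ y" u g h] by simp
next
  case (refl w)
  then show ?case by (simp add: fp_rel.refl)
next
  case (sym v w)
  then show ?case by (simp add: fp_rel.sym)
next
  case (trans u v w)
  then show ?case using fp_rel.trans by blast
qed

lemma fp_rel_append:
  assumes "(v, v') \<in> fp_rel I G" "(w, w') \<in> fp_rel I G"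
  shows "(v @ w, v' @ w') \<in> fp_rel I G"
proof (rule fp_rel.trans)
  show "(v @ w, v' @ w) \<in> fp_rel I G"
    using fp_rel_context[OF assms(1), of "[]" w] fp_rel_in_words[OF assms(2)] by simp
  show "(v' @ w, v' @ w') \<in> fp_rel I G"
    using fp_rel_context[OF assms(2), of v' "[]"] fp_rel_in_words[OF assms(1)] by simp
qed

lemma equiv_fp_rel: "equiv (fp_words I G) (fp_rel I G)"
proof (rule equivI)
  show "fp_rel I G \<subseteq> fp_words I G \<times> fp_words I G" using fp_rel_in_words by auto
  show "refl_on (fp_words I G) (fp_rel I G)" by (simp add: refl_on_def fp_rel.refl)
  show "sym_on UNIV (fp_rel I G)" using fp_rel.sym by (rule symI)
  show "trans_on UNIV (fp_rel I G)" using fp_rel.trans by (rule transI)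
qed

lemma free_product_mult_class:
  assumes "v \<in> fp_words I G" "w \<in> fp_words I G"
  shows "fp_rel I G `` {v} \<otimes>\<^bsub>free_product I G\<^esub> fp_rel I G `` {w} = fp_rel I G `` {v @ w}"
proof -
  have *: "fp_rel I G `` {a @ b} = fp_rel I G `` {v @ w}"
    if "(v, a) \<in> fp_rel I G" "(w, b) \<in> fp_rel I G" for a b
    using equiv_class_eq[OF equiv_fp_rel fp_rel_append[OF that]] by simp
  have "fp_rel I G `` {v} \<otimes>\<^bsub>free_product I G\<^esub> fp_rel I G `` {w}
      = (\<Union>a \<in> fp_rel I G `` {v}. \<Union>b \<in> fp_rel I G `` {w}. fp_rel I G `` {a @ b})"
    by (simp add: free_product_def)
  also have "\<dots> = (\<Union>a \<in> fp_rel I G `` {v}. \<Union>b \<in> fp_rel I G `` {w}. fp_rel I G `` {v @ w})"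
    using * by (intro SUP_cong HOL.refl) (simp only: Image_singleton_iff)
  also have "\<dots> = fp_rel I G `` {v @ w}"
  proof -
    have "v \<in> fp_rel I G `` {v}" "w \<in> fp_rel I G `` {w}" using assms by (simp_all add: fp_rel.refl)
    then show ?thesis by blast
  qed
  finally show ?thesis .
qed

lemma ex_inverse_word:
  "w \<in> fp_words I G \<Longrightarrow> \<exists>w' \<in> fp_words I G. (w' @ w, []) \<in> fp_rel I G"
proof (induction w)
  case Nil
  then show ?case by (intro bexI[of _ "[]"]) (simp_all add: fp_rel.refl)
next
  case (Cons p w)
  obtain u g where p: "p = (u, g)" by (cases p)
  with Cons obtain w' where w': "w' \<in> fp_words I G" "(w' @ w, []) \<in> fp_rel I G"
    and ug: "u \<in> I" "g \<in> carrier (G u)" and w: "w \<in> fp_words I G" by auto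
  interpret group "G u" using group_factor ug by simp
  have "(w' @ [(u, inv\<^bsub>G u\<^esub> g), (u, g)] @ w, w' @ [(u, \<one>\<^bsub>G u\<^esub>)] @ w) \<in> fp_rel I G"
    using fp_rel.merge[of w' I G w u "inv\<^bsub>G u\<^esub> g" g] w' w ug by simp
  moreover have "(w' @ [(u, \<one>\<^bsub>G u\<^esub>)] @ w, w' @ w) \<in> fp_rel I G"
    by (rule fp_rel.delete_one[OF w'(1) w ug(1)])
  ultimately have "(w' @ [(u, inv\<^bsub>G u\<^esub> g), (u, g)] @ w, []) \<in> fp_rel I G"
    by (rule fp_rel.trans[OF fp_rel.trans[OF _ _] w'(2)])
  then have "((w' @ [(u, inv\<^bsub>G u\<^esub> g)]) @ p # w, []) \<in> fp_rel I G"
    by (simp add: p)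
  then show ?case using w' ug by (intro bexI[of _ "w' @ [(u, inv\<^bsub>G u\<^esub> g)]"]) auto
qed

lemma group_free_product: "group (free_product I G)"
proof (rule groupI)
  let ?F = "free_product I G" and ?c = "\<lambda>w. fp_rel I G `` {w}"
  have in_carrier: "?c w \<in> carrier ?F" if "w \<in> fp_words I G" for w
    using that by (auto simp: free_product_def quotient_def)
  have one: "\<one>\<^bsub>?F\<^esub> = ?c []" by (simp add: free_product_def)
  have rep: "\<exists>w \<in> fp_words I G. A = ?c w" if "A \<in> carrier ?F" for A
    using that by (auto simp: free_product_def quotient_def)
  show "\<one>\<^bsub>?F\<^esub> \<in> carrier ?F" by (simp add: one in_carrier)
  show "A \<otimes>\<^bsub>?F\<^esub> B \<in> carrier ?F" if "A \<in> carrier ?F" "B \<in> carrier ?F" for A B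
    using rep[OF that(1)] rep[OF that(2)] in_carrier by (auto simp: free_product_mult_class)
  show "A \<otimes>\<^bsub>?F\<^esub> B \<otimes>\<^bsub>?F\<^esub> C = A \<otimes>\<^bsub>?F\<^esub> (B \<otimes>\<^bsub>?F\<^esub> C)"
    if "A \<in> carrier ?F" "B \<in> carrier ?F" "C \<in> carrier ?F" for A B C
    using rep[OF that(1)] rep[OF that(2)] rep[OF that(3)] by (auto simp: free_product_mult_class)
  show "\<one>\<^bsub>?F\<^esub> \<otimes>\<^bsub>?F\<^esub> A = A" if "A \<in> carrier ?F" for A
    using rep[OF that] by (auto simp: one free_product_mult_class)
  show "\<exists>B \<in> carrier ?F. B \<otimes>\<^bsub>?F\<^esub> A = \<one>\<^bsub>?F\<^esub>" if A: "A \<in> carrier ?F" for A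
  proof -
    obtain w where w: "w \<in> fp_words I G" "A = ?c w" using rep[OF A] by blast
    obtain w' where w': "w' \<in> fp_words I G" "(w' @ w, []) \<in> fp_rel I G"
      using ex_inverse_word[OF w(1)] by blast
    have "?c w' \<otimes>\<^bsub>?F\<^esub> A = \<one>\<^bsub>?F\<^esub>"
      using w w' equiv_class_eq[OF equiv_fp_rel w'(2)] by (simp add: one free_product_mult_class)
    then show ?thesis using in_carrier[OF w'(1)] by blast
  qed
qed

lemma fp_incl_hom: "u \<in> I \<Longrightarrow> fp_incl I G u \<in> hom (G u) (free_product I G)"
proof (rule homI)
  fix g h assume u: "u \<in> I" and gh: "g \<in> carrier (G u)" "h \<in> carrier (G u)"
  then show "fp_incl I G u g \<in> carrier (free_product I G)"
    by (auto simp: fp_incl_def free_product_def quotient_def)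
  have "([(u, g), (u, h)], [(u, g \<otimes>\<^bsub>G u\<^esub> h)]) \<in> fp_rel I G"
    using fp_rel.merge[of "[]" I G "[]" u g h] u gh by simp
  then show "fp_incl I G u (g \<otimes>\<^bsub>G u\<^esub> h)
      = fp_incl I G u g \<otimes>\<^bsub>free_product I G\<^esub> fp_incl I G u h"
    using u gh equiv_class_eq[OF equiv_fp_rel] by (simp add: fp_incl_def free_product_mult_class)
qed

end

lemma (in group) normal_closure_normal:
  assumes "R \<subseteq> carrier G"
  shows "normal_closure G R \<lhd> G"
proof -
  have "carrier G \<lhd> G"
    by (simp add: normal_inv_iff subgroup_self)
  then have "{N. N \<lhd> G \<and> R \<subseteq> N} \<noteq> {}" using assms by blast
  then have "subgroup (normal_closure G R) G"
    unfolding normal_closure_def by (intro subgroups_Inter) (auto dest: normal_imp_subgroup)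
  then show ?thesis
    by (auto simp: normal_inv_iff normal_closure_def)
qed

lemma group_graph_product:
  assumes "pair_wf_digraph \<Gamma>" "\<And>u. u \<in> pverts \<Gamma> \<Longrightarrow> group (G u)"
  shows "group (graph_product \<Gamma> G)"
proof -
  interpret pair_wf_digraph \<Gamma> by fact
  interpret group_family "pverts \<Gamma>" G using assms(2) by (rule group_family.intro)
  interpret F: group "free_product (pverts \<Gamma>) G" by (rule group_free_product)
  have "graph_product_relators \<Gamma> G \<subseteq> carrier (free_product (pverts \<Gamma>) G)"
    by (auto simp: graph_product_relators_def commutator_def
        intro!: F.m_closed F.inv_closed hom_in_carrier[OF fp_incl_hom] dest: in_arcsD1 in_arcsD2)
  then show ?thesis
    unfolding graph_product_def by (intro normal.factorgroup_is_group F.normal_closure_normal)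
qed

end

theory Submission
  imports Defs "HOL-Library.Multiset" "HOL-Library.Sublist"
begin

text \<open>
  Elements of the graph product are written as words of syllables \<open>(v, g)\<close> with \<open>g\<close> in the vertex-group
  of \<open>v\<close>, weighted by the sum of the word lengths of the \<open>g\<close>; up to a constant this weight is the word
  length of the best word for an element. The problem is to conjugate two conjugate words by a word
  of linearly bounded weight.

  The normal form theorem for graph products (\<open>reduced_unique\<close>) says that two reduced words for the
  same element differ only by exchanging adjacent syllables of adjacent vertices, so that reduced
  words behave like elements of a trace monoid. This monoid is cancellative and a trace is determined
  by its restrictions to pairs of non-adjacent vertices, where it is an ordinary word.

  Given two conjugate elements, both are first conjugated, at linear cost, to cyclically reduced words
  \<open>x\<close> and \<open>y\<close> (\<open>cyclic_reduction\<close>). A syllable of \<open>x\<close> whose vertex is adjacent to every other vertex of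
  \<open>x\<close> floats. Starting with any conjugator \<open>c\<close>, so that \<open>x c = c y\<close>, the syllables at the end of \<open>x\<close>
  which interact with the beginning of \<open>c\<close> are moved out of the way: a floating one is conjugated by
  the first syllable of \<open>c\<close>, any other one is rotated to the front of \<open>x\<close> (\<open>absorb_overlap\<close>). When nothing is left
  to move, both sides of \<open>x c = c y\<close> are reduced and the equation holds between traces. Hence \<open>x\<close> and
  \<open>y\<close> are conjugate in the trace monoid, up to conjugating the floating syllables inside their
  vertex-groups (\<open>cyc_reduced_conjugate_twisted_conj\<close>).

  Both kinds of conjugation are cheap. For the floating syllables this is the hypothesis on the
  vertex-groups. In the trace monoid a shortest \<open>c\<close> with \<open>x c = c y\<close> uses each vertex at most \<open>n + 1\<close> times as
  often as \<open>x\<close> does, where \<open>n\<close> is the number of vertices (\<open>minimal_conjugator_count\<close>): otherwise some union of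
  connected components of the non-adjacency graph on the support of \<open>x\<close> would occur in \<open>c\<close> with one full
  period, and that period commutes with \<open>x\<close> and could be cancelled from \<open>c\<close>.
\<close>

section \<open>Traces\<close>

definition proj :: "'v \<Rightarrow> 'v \<Rightarrow> ('v \<times> 'g) list \<Rightarrow> ('v \<times> 'g) list" where
  "proj s t = filter (\<lambda>p. fst p = s \<or> fst p = t)"

lemma proj_simps [simp]:
  "proj s t [] = []"
  "proj s t (p # w) = (if fst p = s \<or> fst p = t then p # proj s t w else proj s t w)"
  "proj s t (a @ b) = proj s t a @ proj s t b"
  by (simp_all add: proj_def)

lemma proj_commute: "proj s t = proj t s"
  by (auto simp: proj_def fun_eq_iff disj_commute)

definition occ :: "'v \<Rightarrow> ('v \<times> 'g) list \<Rightarrow> nat" where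
  "occ v w = length (filter (\<lambda>p. fst p = v) w)"

lemma occ_simps [simp]:
  "occ v [] = 0"
  "occ v (p # w) = (if fst p = v then Suc (occ v w) else occ v w)"
  "occ v (a @ b) = occ v a + occ v b"
  "occ v (rev a) = occ v a"
  by (simp_all add: occ_def rev_filter[symmetric])

lemma occ_eq_0_iff: "occ v w = 0 \<longleftrightarrow> v \<notin> fst ` set w"
  by (auto simp: occ_def filter_empty_conv)

lemma occ_proj: "v = s \<or> v = t \<Longrightarrow> occ v (proj s t w) = occ v w"
  by (induction w) auto

fun remove_syl :: "'v \<Rightarrow> ('v \<times> 'g) list \<Rightarrow> ('v \<times> 'g) list" where
  "remove_syl v [] = []"
| "remove_syl v ((u, g) # w) = (if u = v then w else (u, g) # remove_syl v w)"

locale commutation =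
  fixes adj :: "'v \<Rightarrow> 'v \<Rightarrow> bool"
  assumes adj_sym: "adj u v \<Longrightarrow> adj v u" and adj_irrefl [simp]: "\<not> adj v v"
begin

text \<open>
  Shuffle equivalence is encoded by its well-known invariants, the restrictions to pairs of
  non-adjacent vertices, instead of being generated by swaps. The pairs with \<open>s = t\<close> are included because
  syllables of one vertex never commute. Congruence and both cancellation laws become immediate.
\<close>
definition teq :: "('v \<times> 'g) list \<Rightarrow> ('v \<times> 'g) list \<Rightarrow> bool" (infix "\<simeq>" 50) where
  "a \<simeq> b \<longleftrightarrow> (\<forall>s t. \<not> adj s t \<longrightarrow> proj s t a = proj s t b)"

lemma teqD: "a \<simeq> b \<Longrightarrow> \<not> adj s t \<Longrightarrow> proj s t a = proj s t b"
  by (simp add: teq_def)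

lemma teq_refl [simp]: "a \<simeq> a" by (simp add: teq_def)

lemma teq_sym: "a \<simeq> b \<Longrightarrow> b \<simeq> a" by (simp add: teq_def)

lemma teq_trans [trans]: "a \<simeq> b \<Longrightarrow> b \<simeq> c \<Longrightarrow> a \<simeq> c" by (simp add: teq_def)

lemma teq_append: "a \<simeq> a' \<Longrightarrow> b \<simeq> b' \<Longrightarrow> a @ b \<simeq> a' @ b'"
  by (simp add: teq_def)

lemma teq_append_cancel [simp]: "c @ a \<simeq> c @ b \<longleftrightarrow> a \<simeq> b" "a @ c \<simeq> b @ c \<longleftrightarrow> a \<simeq> b"
  by (simp_all add: teq_def)

lemma teq_Cons_cancel [simp]: "p # a \<simeq> p # b \<longleftrightarrow> a \<simeq> b"
  using teq_append_cancel(1)[of "[p]" a b] by simp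

lemma teq_rev: "a \<simeq> b \<Longrightarrow> rev a \<simeq> rev b"
  by (simp add: teq_def proj_def rev_filter[symmetric])

lemma teq_filter:
  fixes a b :: "('v \<times> 'g) list"
  assumes "a \<simeq> b" shows "filter (\<lambda>p. fst p \<in> W) a \<simeq> filter (\<lambda>p. fst p \<in> W) b"
proof -
  have "proj s t (filter (\<lambda>p. fst p \<in> W) w) = filter (\<lambda>p. fst p \<in> W) (proj s t w)" for s t and w :: "('v \<times> 'g) list"
    by (simp add: proj_def conj_commute)
  then show ?thesis using assms by (simp add: teq_def)
qed

lemma teq_map:
  fixes a b :: "('v \<times> 'g) list"
  assumes "a \<simeq> b"
  shows "map (\<lambda>(v, g). (v, f v g)) a \<simeq> map (\<lambda>(v, g). (v, f v g)) b"
proof -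
  have "proj s t (map (\<lambda>(v, g). (v, f v g)) w) = map (\<lambda>(v, g). (v, f v g)) (proj s t w)" for s t and w :: "('v \<times> 'g) list"
    by (induction w) auto
  then show ?thesis using assms by (simp add: teq_def)
qed

lemma teq_swap:
  assumes "adj u v" shows "(u, g) # (v, h) # w \<simeq> (v, h) # (u, g) # w"
  using assms adj_sym unfolding teq_def by auto

text \<open>
  Letters of one vertex can be counted in the restriction to that vertex.
\<close>
lemma teq_mset:
  fixes a b :: "('v \<times> 'g) list"
  assumes "a \<simeq> b" shows "mset a = mset b"
proof (rule multiset_eqI)
  fix p :: "'v \<times> 'g"
  have "count (mset w) p = count (mset (proj (fst p) (fst p) w)) p" for w
    by (induction w) auto
  from this[of a] this[of b] show "count (mset a) p = count (mset b) p"
    using teqD[OF assms, of "fst p" "fst p"] by simp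
qed

lemma teq_set: "a \<simeq> b \<Longrightarrow> set a = set b" using teq_mset mset_eq_setD by blast

lemma teq_length: "a \<simeq> b \<Longrightarrow> length a = length b" using teq_mset mset_eq_length by blast

lemma teq_occ: "a \<simeq> b \<Longrightarrow> occ v a = occ v b"
  using teqD[of a b v v] occ_proj[of v v v] by (metis adj_irrefl)

lemma teq_Nil_iff [simp]: "[] \<simeq> a \<longleftrightarrow> a = []" "a \<simeq> [] \<longleftrightarrow> a = []"
  using teq_length[of "[]" a] teq_length[of a "[]"] by auto

lemma teq_append_commute:
  assumes "\<And>p q. p \<in> set a \<Longrightarrow> q \<in> set b \<Longrightarrow> adj (fst p) (fst q)"
  shows "a @ b \<simeq> b @ a"
  unfolding teq_def
proof (intro allI impI)
  fix s t assume st: "\<not> adj s t"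
  then have ts: "\<not> adj t s" using adj_sym by blast
  have "proj s t a = [] \<or> proj s t b = []"
  proof (rule ccontr)
    assume "\<not> ?thesis"
    then obtain p q where "p \<in> set (proj s t a)" "q \<in> set (proj s t b)"
      by (metis last_in_set)
    then have "p \<in> set a" "q \<in> set b" "fst p \<in> {s, t}" "fst q \<in> {s, t}"
      by (auto simp: proj_def)
    then have "adj (fst p) (fst q)" "fst p \<in> {s, t}" "fst q \<in> {s, t}" using assms by auto
    then show False using st ts by (auto)
  qed
  then show "proj s t (a @ b) = proj s t (b @ a)" by auto
qed

text \<open>
  The \<open>v\<close>-syllable that can be shuffled to the front, if there is one.
\<close>
fun fsyl :: "'v \<Rightarrow> ('v \<times> 'g) list \<Rightarrow> 'g option" where
  "fsyl v [] = None"
| "fsyl v ((u, g) # w) = (if u = v then Some g else if adj u v then fsyl v w else None)"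

abbreviation lsyl :: "'v \<Rightarrow> ('v \<times> 'g) list \<Rightarrow> 'g option" where
  "lsyl v w \<equiv> fsyl v (rev w)"

definition links :: "'v \<Rightarrow> ('v \<times> 'g) list \<Rightarrow> bool" where
  "links v w \<longleftrightarrow> (\<forall>p\<in>set w. adj (fst p) v)"

lemma links_simps [simp]:
  "links v []" "links v (p # w) \<longleftrightarrow> adj (fst p) v \<and> links v w"
  "links v (a @ b) \<longleftrightarrow> links v a \<and> links v b"
  "links v (rev a) \<longleftrightarrow> links v a"
  by (auto simp: links_def)

lemma fsyl_append:
  "fsyl v (a @ b) = (case fsyl v a of Some g \<Rightarrow> Some g | None \<Rightarrow> if links v a then fsyl v b else None)"
  by (induction a) auto

lemma links_fsyl: "links v a \<Longrightarrow> fsyl v a = None"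
  by (induction a) auto

lemma links_occ: "links v a \<Longrightarrow> occ v a = 0"
  by (auto simp: links_def occ_eq_0_iff)

lemma fsyl_in_set: "fsyl v w = Some g \<Longrightarrow> (v, g) \<in> set w"
  by (induction w) (auto split: if_splits)

lemma fsyl_occ: "fsyl v w = Some g \<Longrightarrow> occ v w > 0"
  using fsyl_in_set occ_eq_0_iff by (metis fst_conv gr0I image_eqI)

lemma fsyl_None_if_absent: "occ v w = 0 \<Longrightarrow> fsyl v w = None"
  using fsyl_occ by (metis less_irrefl option.exhaust)

text \<open>
  A syllable can be shuffled to the front as soon as it comes first in all restrictions
  containing its vertex; this makes \<^const>\<open>fsyl\<close> an invariant of traces.
\<close>
lemma fsyl_iff_proj: "fsyl v w = Some g \<longleftrightarrow> (\<forall>t. \<not> adj v t \<longrightarrow> (\<exists>r. proj v t w = (v, g) # r))"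
proof (induction w)
  case Nil
  have "\<exists>t. \<not> adj v t" using adj_irrefl by blast
  then show ?case by auto
next
  case (Cons p w)
  obtain u h where p: "p = (u, h)" by (cases p)
  consider "u = v" | "u \<noteq> v" "adj u v" | "u \<noteq> v" "\<not> adj u v" by blast
  then show ?case
  proof cases
    case 1
    moreover have "\<exists>t. \<not> adj v t" using adj_irrefl by blast
    ultimately show ?thesis using p by auto
  next
    case 2
    then have "\<not> adj v t \<Longrightarrow> t \<noteq> u" for t using adj_sym by blast
    then show ?thesis using 2 Cons.IH p by auto
  next
    case 3
    then have "\<not> adj v u" using adj_sym by blast
    then show ?thesis using 3 p by auto
  qed
qed

lemma teq_fsyl: "a \<simeq> b \<Longrightarrow> fsyl v a = fsyl v b"
proof -
  assume "a \<simeq> b"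
  then have "fsyl v a = Some g \<longleftrightarrow> fsyl v b = Some g" for g
    by (simp add: fsyl_iff_proj teq_def)
  then show ?thesis by (metis not_Some_eq)
qed

lemma teq_lsyl: "a \<simeq> b \<Longrightarrow> lsyl v a = lsyl v b"
  by (rule teq_fsyl[OF teq_rev])

lemma teq_remove_syl: "fsyl v w = Some g \<Longrightarrow> w \<simeq> (v, g) # remove_syl v w"
proof (induction w)
  case (Cons p w)
  obtain u h where p: "p = (u, h)" by (cases p)
  show ?case
  proof (cases "u = v")
    case False
    with Cons.prems p have a: "adj u v" and "fsyl v w = Some g" by (auto split: if_splits)
    then have "w \<simeq> (v, g) # remove_syl v w" using Cons.IH by simp
    then have "(u, h) # w \<simeq> (u, h) # (v, g) # remove_syl v w" by simp
    also have "\<dots> \<simeq> (v, g) # (u, h) # remove_syl v w" using a by (rule teq_swap)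
    finally show ?thesis using False p by simp
  qed (use Cons p in auto)
qed simp

lemma fsyl_split: "fsyl v w = Some g \<Longrightarrow> \<exists>w'. w \<simeq> (v, g) # w'"
  using teq_remove_syl by metis

lemma lsyl_split: assumes "lsyl v w = Some g" shows "\<exists>w'. w \<simeq> w' @ [(v, g)]"
proof -
  obtain w' where "rev w \<simeq> (v, g) # w'" using fsyl_split[OF assms] by blast
  then have "w \<simeq> rev w' @ [(v, g)]" using teq_rev by fastforce
  then show ?thesis by blast
qed

text \<open>
  Left divisibility of traces, like equality, can be tested on restrictions.
\<close>
lemma prefix_teq:
  "(\<And>s t. \<not> adj s t \<Longrightarrow> prefix (proj s t z) (proj s t c)) \<Longrightarrow> \<exists>c'. c \<simeq> z @ c'"
proof (induction z arbitrary: c)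
  case Nil
  have "c \<simeq> [] @ c" by simp
  then show ?case by blast
next
  case (Cons p z)
  obtain v g where p: "p = (v, g)" by (cases p)
  have "fsyl v c = Some g"
    unfolding fsyl_iff_proj using Cons.prems p by (force simp: prefix_def)
  then have c: "c \<simeq> (v, g) # remove_syl v c" by (rule teq_remove_syl)
  have "prefix (proj s t z) (proj s t (remove_syl v c))" if "\<not> adj s t" for s t
    using Cons.prems[OF that] teqD[OF c that] p by (auto split: if_splits)
  from Cons.IH[OF this] obtain c' where "remove_syl v c \<simeq> z @ c'" by blast
  then have "c \<simeq> (p # z) @ c'" using teq_trans[OF c] p by simp
  then show ?case by blast
qed

end

section \<open>Reduced words and their uniqueness\<close>

locale syllable_words = commutation adj + group_family V G
  for adj :: "'v \<Rightarrow> 'v \<Rightarrow> bool" and V :: "'v set" and G :: "'v \<Rightarrow> ('g, 'm) monoid_scheme" +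
  assumes finite_V: "finite V"
begin

abbreviation wf :: "('v \<times> 'g) list \<Rightarrow> bool" where
  "wf w \<equiv> w \<in> fp_words V G"

lemma wf_iff: "wf w \<longleftrightarrow> (\<forall>(v, g) \<in> set w. v \<in> V \<and> g \<in> carrier (G v))"
  by (induction w) auto

lemma wf_set_eq: "set a = set b \<Longrightarrow> wf a = wf b"
  by (simp add: wf_iff)

lemma teq_wf: "a \<simeq> b \<Longrightarrow> wf a = wf b"
  by (rule wf_set_eq[OF teq_set])

lemma wf_rev [simp]: "wf (rev w) = wf w"
  by (rule wf_set_eq) simp

lemma wf_fsyl: "wf w \<Longrightarrow> fsyl v w = Some g \<Longrightarrow> v \<in> V \<and> g \<in> carrier (G v)"
  using fsyl_in_set wf_iff by fastforce

lemma wf_remove_syl: "wf w \<Longrightarrow> wf (remove_syl v w)"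
  by (induction w rule: remove_syl.induct) (auto)

text \<open>
  No syllable is trivial, and none can be shuffled next to a later one of the same vertex.
\<close>
fun reduced :: "('v \<times> 'g) list \<Rightarrow> bool" where
  "reduced [] = True"
| "reduced ((v, g) # w) = (g \<noteq> \<one>\<^bsub>G v\<^esub> \<and> fsyl v w = None \<and> reduced w)"

lemma reduced_remove_syl:
  assumes "reduced w" "fsyl v w = Some g"
  shows "reduced (remove_syl v w) \<and> fsyl v (remove_syl v w) = None \<and> g \<noteq> \<one>\<^bsub>G v\<^esub>"
  using assms
proof (induction w)
  case (Cons p w)
  obtain u h where p: "p = (u, h)" by (cases p)
  show ?case
  proof (cases "u = v")
    case False
    with Cons.prems p have a: "adj u v" and f: "fsyl v w = Some g" and r: "reduced w"
      by (auto split: if_splits)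
    have "fsyl u w = fsyl u (remove_syl v w)"
      using teq_fsyl[OF teq_remove_syl[OF f], of u] a False adj_sym by auto
    then show ?thesis using Cons.IH[OF r f] Cons.prems p a False by auto
  qed (use Cons p in auto)
qed simp

lemma teq_reduced_imp: "a \<simeq> b \<Longrightarrow> reduced a \<Longrightarrow> reduced b"
proof (induction b arbitrary: a)
  case (Cons p b)
  obtain v g where p: "p = (v, g)" by (cases p)
  have f: "fsyl v a = Some g" using teq_fsyl[OF Cons.prems(1)] p by auto
  then have "(v, g) # remove_syl v a \<simeq> (v, g) # b"
    using Cons.prems(1) teq_remove_syl[OF f] teq_sym teq_trans p by blast
  then have d: "remove_syl v a \<simeq> b" by simp
  show ?case
    using reduced_remove_syl[OF Cons.prems(2) f] Cons.IH[OF d] teq_fsyl[OF d] p by auto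
qed simp

lemma teq_reduced: "a \<simeq> b \<Longrightarrow> reduced a = reduced b"
  using teq_reduced_imp teq_sym by blast

text \<open>
  The only obstruction is a vertex that can be shuffled to the end of the left factor and to the
  beginning of the right factor.
\<close>
lemma reduced_append:
  "reduced (a @ b) \<longleftrightarrow> reduced a \<and> reduced b \<and> (\<forall>v. lsyl v a = None \<or> fsyl v b = None)"
proof (induction a)
  case (Cons p a)
  obtain u h where p: "p = (u, h)" by (cases p)
  have l: "lsyl v ((u, h) # a) = None \<longleftrightarrow> lsyl v a = None \<and> (u = v \<longrightarrow> \<not> links v a)" for v
    by (auto simp: fsyl_append split: option.splits)
  have f: "fsyl u (a @ b) = None \<longleftrightarrow> fsyl u a = None \<and> (links u a \<longrightarrow> fsyl u b = None)"
    by (auto simp: fsyl_append split: option.splits)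
  show ?case
    unfolding p append_Cons reduced.simps f Cons.IH l by auto
qed simp

lemma reduced_nontrivial: "reduced w \<Longrightarrow> (v, g) \<in> set w \<Longrightarrow> g \<noteq> \<one>\<^bsub>G v\<^esub>"
  by (induction w) auto

lemma fsyl_None_map_fst:
  "map fst a = map fst b \<Longrightarrow> fsyl v a = None \<longleftrightarrow> fsyl v b = None"
proof (induction a arbitrary: b)
  case (Cons p a)
  then obtain q b' where "b = q # b'" "fst p = fst q" "map fst a = map fst b'" by (cases b) auto
  then show ?case using Cons.IH[of b'] by (cases p; cases q) auto
qed simp

text \<open>
  Apart from the non-triviality of the syllables, being reduced concerns only the vertices, so
  syllables may be replaced by other non-trivial elements of their vertex-groups.
\<close>
lemma reduced_map_fst:
  "map fst a = map fst b \<Longrightarrow> \<forall>(v, g) \<in> set b. g \<noteq> \<one>\<^bsub>G v\<^esub> \<Longrightarrow> reduced a \<Longrightarrow> reduced b"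
proof (induction a arbitrary: b)
  case (Cons p a)
  then obtain q b' where "b = q # b'" "fst p = fst q" "map fst a = map fst b'" by (cases b) auto
  then show ?case using Cons.IH[of b'] Cons.prems fsyl_None_map_fst[of a b']
    by (cases p; cases q) auto
qed simp

definition scons :: "'v \<Rightarrow> 'g \<Rightarrow> ('v \<times> 'g) list \<Rightarrow> ('v \<times> 'g) list" where
  "scons v g w = (if g = \<one>\<^bsub>G v\<^esub> then w else (v, g) # w)"

text \<open>
  Left multiplication of a reduced word by a syllable. Uniqueness of reduced words is obtained
  from an action: these multiplications satisfy the defining relations of the graph product up to
  equality of traces, and a reduced word sends the empty word to itself.
\<close>
definition lmul :: "'v \<times> 'g \<Rightarrow> ('v \<times> 'g) list \<Rightarrow> ('v \<times> 'g) list" where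
  "lmul p w = (case p of (v, g) \<Rightarrow>
     (case fsyl v w of None \<Rightarrow> scons v g w | Some h \<Rightarrow> scons v (g \<otimes>\<^bsub>G v\<^esub> h) (remove_syl v w)))"

lemma scons_teq: "a \<simeq> b \<Longrightarrow> scons v g a \<simeq> scons v g b"
  by (simp add: scons_def)

lemma lmul_teq: assumes "a \<simeq> b" shows "lmul p a \<simeq> lmul p b"
proof -
  obtain v g where p: "p = (v, g)" by (cases p)
  show ?thesis
  proof (cases "fsyl v a")
    case None
    then show ?thesis using assms teq_fsyl[OF assms, of v] p by (simp add: lmul_def scons_teq)
  next
    case (Some h)
    then have b: "fsyl v b = Some h" using teq_fsyl[OF assms] by simp
    have "(v, h) # remove_syl v a \<simeq> (v, h) # remove_syl v b"
      using teq_remove_syl[OF Some] teq_remove_syl[OF b] assms teq_sym teq_trans by blast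
    then show ?thesis using Some b p by (simp add: lmul_def scons_teq)
  qed
qed

lemma foldr_lmul_teq: "a \<simeq> b \<Longrightarrow> foldr lmul w a \<simeq> foldr lmul w b"
  by (induction w) (auto intro: lmul_teq)

lemma reduced_scons: "reduced w \<Longrightarrow> fsyl v w = None \<Longrightarrow> reduced (scons v g w)"
  by (simp add: scons_def)

lemma reduced_lmul: "reduced w \<Longrightarrow> reduced (lmul p w)"
  using reduced_remove_syl by (auto simp: lmul_def intro!: reduced_scons split: prod.splits option.splits)

lemma reduced_foldr_lmul: "reduced z \<Longrightarrow> reduced (foldr lmul w z)"
  by (induction w) (auto intro: reduced_lmul)

lemma wf_scons: "v \<in> V \<Longrightarrow> g \<in> carrier (G v) \<Longrightarrow> wf w \<Longrightarrow> wf (scons v g w)"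
  by (simp add: scons_def)

lemma wf_lmul: "v \<in> V \<Longrightarrow> g \<in> carrier (G v) \<Longrightarrow> wf w \<Longrightarrow> wf (lmul (v, g) w)"
  using wf_fsyl wf_remove_syl factor_closed
  by (auto simp: lmul_def intro!: wf_scons split: prod.splits option.splits)

lemma wf_foldr_lmul: "wf w \<Longrightarrow> wf z \<Longrightarrow> wf (foldr lmul w z)"
  by (induction w) (auto intro: wf_lmul)

lemma reduced_nf_id: "reduced w \<Longrightarrow> foldr lmul w [] = w"
  by (induction w) (auto simp: lmul_def scons_def)

text \<open>
  With a possibly trivial \<open>v\<close>-part \<open>k\<close> split off, multiplication by a \<open>v\<close>-syllable is just
  multiplication of \<open>k\<close> in the vertex-group, without case distinctions.
\<close>
lemma split_off_syllable:
  assumes "reduced w" "wf w" "v \<in> V"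
  obtains k w' where "k \<in> carrier (G v)" "w \<simeq> scons v k w'" "fsyl v w' = None" "reduced w'" "wf w'"
proof (cases "fsyl v w")
  case None
  then show ?thesis using that[of "\<one>\<^bsub>G v\<^esub>" w] assms factor_closed by (simp add: scons_def)
next
  case (Some h)
  then show ?thesis
    using that[of h "remove_syl v w"] assms reduced_remove_syl[OF assms(1) Some] teq_remove_syl[OF Some] wf_fsyl wf_remove_syl
    by (simp add: scons_def)
qed

lemma lmul_scons:
  assumes "v \<in> V" "g \<in> carrier (G v)" "k \<in> carrier (G v)" "fsyl v w = None"
  shows "lmul (v, g) (scons v k w) = scons v (g \<otimes>\<^bsub>G v\<^esub> k) w"
proof -
  interpret group "G v" using group_factor assms by simp
  show ?thesis using assms by (auto simp: lmul_def scons_def)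
qed

lemma lmul_one:
  assumes "reduced w" "wf w" "v \<in> V"
  shows "lmul (v, \<one>\<^bsub>G v\<^esub>) w \<simeq> w"
proof -
  interpret group "G v" using group_factor assms by simp
  obtain k w' where w: "k \<in> carrier (G v)" "w \<simeq> scons v k w'" "fsyl v w' = None"
    using split_off_syllable assms by metis
  have "lmul (v, \<one>\<^bsub>G v\<^esub>) w \<simeq> lmul (v, \<one>\<^bsub>G v\<^esub>) (scons v k w')" by (rule lmul_teq[OF w(2)])
  also have "\<dots> = scons v k w'" using lmul_scons[of v "\<one>\<^bsub>G v\<^esub>" k w'] assms w by simp
  also have "\<dots> \<simeq> w" using w(2) by (rule teq_sym)
  finally show ?thesis .
qed

lemma lmul_merge:
  assumes "reduced w" "wf w" "v \<in> V" "g \<in> carrier (G v)" "h \<in> carrier (G v)"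
  shows "lmul (v, g) (lmul (v, h) w) \<simeq> lmul (v, g \<otimes>\<^bsub>G v\<^esub> h) w"
proof -
  interpret group "G v" using group_factor assms by simp
  obtain k w' where w: "k \<in> carrier (G v)" "w \<simeq> scons v k w'" "fsyl v w' = None"
    using split_off_syllable assms by metis
  have "lmul (v, g) (lmul (v, h) w) \<simeq> lmul (v, g) (lmul (v, h) (scons v k w'))"
    by (intro lmul_teq w)
  also have "\<dots> = lmul (v, g \<otimes>\<^bsub>G v\<^esub> h) (scons v k w')"
    using assms w by (simp add: lmul_scons m_assoc)
  also have "\<dots> \<simeq> lmul (v, g \<otimes>\<^bsub>G v\<^esub> h) w" by (rule lmul_teq[OF teq_sym[OF w(2)]])
  finally show ?thesis .
qed

lemma fsyl_scons_other: "adj u v \<Longrightarrow> fsyl v (scons u l w) = fsyl v w"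
  by (auto simp: scons_def)

lemma scons_swap: "adj u v \<Longrightarrow> scons u l (scons v k w) \<simeq> scons v k (scons u l w)"
  by (auto simp: scons_def teq_swap)

lemma lmul_swap:
  assumes "reduced w" "wf w" "v \<in> V" "g \<in> carrier (G v)" "u \<in> V" "h \<in> carrier (G u)" "adj u v"
  shows "lmul (v, g) (lmul (u, h) w) \<simeq> lmul (u, h) (lmul (v, g) w)"
proof -
  interpret Gv: group "G v" using group_factor assms by simp
  interpret Gu: group "G u" using group_factor assms by simp
  have vu: "adj v u" using assms adj_sym by simp
  obtain k w1 where w1: "k \<in> carrier (G v)" "w \<simeq> scons v k w1" "fsyl v w1 = None" "reduced w1" "wf w1"
    using split_off_syllable assms by metis
  obtain l w2 where w2: "l \<in> carrier (G u)" "w1 \<simeq> scons u l w2" "fsyl u w2 = None"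
    using split_off_syllable[OF w1(4,5), of u] assms by metis
  have v2: "fsyl v w2 = None"
    using teq_fsyl[OF w2(2), of v] w1 fsyl_scons_other[OF assms(7)] by simp
  have w: "w \<simeq> scons v k (scons u l w2)"
    by (rule teq_trans[OF w1(2) scons_teq[OF w2(2)]])
  have w': "w \<simeq> scons u l (scons v k w2)"
    by (rule teq_trans[OF w scons_swap[OF vu]])
  have "lmul (v, g) (lmul (u, h) w) \<simeq> lmul (v, g) (lmul (u, h) (scons u l (scons v k w2)))"
    by (intro lmul_teq w')
  also have "\<dots> = lmul (v, g) (scons u (h \<otimes>\<^bsub>G u\<^esub> l) (scons v k w2))"
    using assms w2 fsyl_scons_other[OF vu] by (simp add: lmul_scons)
  also have "\<dots> \<simeq> lmul (v, g) (scons v k (scons u (h \<otimes>\<^bsub>G u\<^esub> l) w2))"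
    by (intro lmul_teq scons_swap assms)
  also have "\<dots> = scons v (g \<otimes>\<^bsub>G v\<^esub> k) (scons u (h \<otimes>\<^bsub>G u\<^esub> l) w2)"
    using assms w1 v2 fsyl_scons_other[OF assms(7)] by (simp add: lmul_scons)
  also have "\<dots> \<simeq> scons u (h \<otimes>\<^bsub>G u\<^esub> l) (scons v (g \<otimes>\<^bsub>G v\<^esub> k) w2)"
    by (rule scons_swap[OF vu])
  also have "\<dots> = lmul (u, h) (scons u l (scons v (g \<otimes>\<^bsub>G v\<^esub> k) w2))"
    using assms w2 fsyl_scons_other[OF vu] by (simp add: lmul_scons)
  also have "\<dots> \<simeq> lmul (u, h) (scons v (g \<otimes>\<^bsub>G v\<^esub> k) (scons u l w2))"
    by (intro lmul_teq scons_swap assms)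
  also have "\<dots> = lmul (u, h) (lmul (v, g) (scons v k (scons u l w2)))"
    using assms w1 v2 fsyl_scons_other[OF assms(7)] by (simp add: lmul_scons)
  also have "\<dots> \<simeq> lmul (u, h) (lmul (v, g) w)"
    by (intro lmul_teq teq_sym[OF w])
  finally show ?thesis .
qed

text \<open>
  Two words are equivalent when they act alike on all reduced words. This relation is visibly a
  congruence on both sides; it will turn out to be equality in the graph product.
\<close>
definition weq :: "('v \<times> 'g) list \<Rightarrow> ('v \<times> 'g) list \<Rightarrow> bool" (infix "\<approx>" 50) where
  "a \<approx> b \<longleftrightarrow> wf a \<and> wf b \<and>
     (\<forall>z. reduced z \<longrightarrow> wf z \<longrightarrow> foldr lmul a z \<simeq> foldr lmul b z)"

lemma weq_refl: "wf a \<Longrightarrow> a \<approx> a" by (simp add: weq_def)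
lemma weq_sym: "a \<approx> b \<Longrightarrow> b \<approx> a" by (auto simp: weq_def intro: teq_sym)
lemma weq_trans [trans]: "a \<approx> b \<Longrightarrow> b \<approx> c \<Longrightarrow> a \<approx> c"
  unfolding weq_def using teq_trans by blast

lemma weq_append: assumes "a \<approx> a'" "b \<approx> b'" shows "a @ b \<approx> a' @ b'"
proof -
  have "foldr lmul (a @ b) z \<simeq> foldr lmul (a' @ b') z" if z: "reduced z" "wf z" for z
  proof -
    have "foldr lmul (a @ b) z \<simeq> foldr lmul a (foldr lmul b' z)"
      using assms(2) z by (simp add: weq_def foldr_lmul_teq)
    also have "\<dots> \<simeq> foldr lmul a' (foldr lmul b' z)"
      using assms z by (simp add: weq_def reduced_foldr_lmul wf_foldr_lmul)
    finally show ?thesis by simp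
  qed
  then show ?thesis using assms by (simp add: weq_def)
qed

lemma weq_one: "v \<in> V \<Longrightarrow> [(v, \<one>\<^bsub>G v\<^esub>)] \<approx> []"
  by (simp add: weq_def lmul_one factor_closed)

lemma weq_merge:
  "v \<in> V \<Longrightarrow> g \<in> carrier (G v) \<Longrightarrow> h \<in> carrier (G v) \<Longrightarrow> [(v, g), (v, h)] \<approx> [(v, g \<otimes>\<^bsub>G v\<^esub> h)]"
  by (simp add: weq_def lmul_merge factor_closed)

lemma weq_swap:
  "v \<in> V \<Longrightarrow> g \<in> carrier (G v) \<Longrightarrow> u \<in> V \<Longrightarrow> h \<in> carrier (G u) \<Longrightarrow> adj u v \<Longrightarrow>
    [(v, g), (u, h)] \<approx> [(u, h), (v, g)]"
  by (simp add: weq_def lmul_swap factor_closed)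

lemma reduced_weq: "reduced a \<Longrightarrow> reduced b \<Longrightarrow> a \<approx> b \<Longrightarrow> a \<simeq> b"
  unfolding weq_def using reduced_nf_id by (metis reduced.simps(1) fp_words_simps(1))

end

section \<open>Short conjugators between traces\<close>

abbreviation list_pow :: "nat \<Rightarrow> 'a list \<Rightarrow> 'a list" where
  "list_pow n x \<equiv> concat (replicate n x)"

lemma prefix_list_pow_mono: "m \<le> n \<Longrightarrow> prefix (list_pow m x) (list_pow n x)"
  by (auto simp: le_iff_add replicate_add)

lemma length_list_pow: "length (list_pow n x) = n * length x"
  by (induction n) auto

text \<open>
  From \<open>x c = c y\<close> follows \<open>x\<^sup>n c = c y\<^sup>n\<close>, so \<open>c\<close> is a prefix of a power of \<open>x\<close>.
\<close>
lemma conj_prefix_list_pow: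
  assumes xc: "x @ c = c @ y" and "x \<noteq> []" and n: "length c \<le> n"
  shows "prefix c (list_pow n x)"
proof -
  have "list_pow n x @ c = c @ list_pow n y"
  proof (induction n)
    case 0
    show ?case by simp
  next
    case (Suc n)
    have "list_pow (Suc n) x @ c = x @ list_pow n x @ c" by simp
    also have "\<dots> = (x @ c) @ list_pow n y" unfolding Suc by simp
    also have "\<dots> = c @ list_pow (Suc n) y" unfolding xc by simp
    finally show ?case .
  qed
  then have "prefix c (list_pow n x @ c)" by (rule prefixI)
  moreover have "prefix (list_pow n x) (list_pow n x @ c)" by simp
  moreover have "length c \<le> length (list_pow n x)"
  proof -
    have "1 \<le> length x" using \<open>x \<noteq> []\<close> by (cases x) simp_all
    then have "n * 1 \<le> n * length x" by (rule mult_le_mono2)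
    then show ?thesis unfolding length_list_pow using n by linarith
  qed
  ultimately show ?thesis by (rule prefix_length_prefix)
qed

definition weight :: "('p \<Rightarrow> nat) \<Rightarrow> 'p list \<Rightarrow> nat" where
  "weight f w = sum_list (map f w)"

lemma weight_simps [simp]:
  "weight f [] = 0" "weight f (p # w) = f p + weight f w" "weight f (a @ b) = weight f a + weight f b"
  by (simp_all add: weight_def)

lemma weight_list_pow: "weight f (list_pow n x) = n * weight f x"
  by (induction n) auto

lemma weight_mset: "mset a = mset b \<Longrightarrow> weight f a = weight f b"
  unfolding weight_def sum_mset_sum_list[symmetric] mset_map by simp

lemma weight_prefix: "prefix a b \<Longrightarrow> weight f a \<le> weight f b"
  by (auto simp: prefix_def)

lemma weight_by_vertex:
  assumes "finite W" "fst ` set w \<subseteq> W"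
  shows "weight f w = (\<Sum>v\<in>W. weight f (proj v v w))"
  using assms(2)
proof (induction w)
  case (Cons p w)
  have "(\<Sum>v\<in>W. weight f (proj v v (p # w)))
      = (\<Sum>v\<in>W. (if fst p = v then f p else 0) + weight f (proj v v w))"
    by (rule sum.cong) auto
  also have "\<dots> = (\<Sum>v\<in>W. if fst p = v then f p else 0) + (\<Sum>v\<in>W. weight f (proj v v w))"
    by (rule sum.distrib)
  also have "(\<Sum>v\<in>W. if fst p = v then f p else 0) = f p"
    using Cons.prems assms(1) by (simp add: sum.delta')
  also have "(\<Sum>v\<in>W. weight f (proj v v w)) = weight f w"
    using Cons by simp
  finally show ?case by simp
qed simp

lemma occ_list_pow: "occ v (list_pow n x) = n * occ v x"
  by (induction n) auto

lemma occ_prefix: "prefix a b \<Longrightarrow> occ v a \<le> occ v b"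
  by (auto simp: prefix_def)

context commutation
begin

text \<open>
  A conjugator of minimal length involves only vertices of \<open>x\<close>, since restricting \<open>c\<close> to those gives
  another conjugator. On a pair of non-adjacent vertices it is then a prefix of a power of the
  restriction of \<open>x\<close>. Thus if \<open>c\<close> contains \<open>k + 1\<close> periods of \<open>x\<close> at a vertex \<open>u\<close>, it contains at least
  \<open>k\<close> periods at every vertex not adjacent to \<open>u\<close>. A set of vertices that is closed under non-adjacency
  and sees at least one period of \<open>x\<close> in \<open>c\<close> splits off a factor \<open>z\<close> of \<open>c\<close> which commutes with \<open>x\<close>, against
  minimality.
\<close>
lemma minimal_conjugator_count:
  fixes x y c :: "('v \<times> 'g) list"
  assumes xc: "x @ c \<simeq> c @ y" and min: "\<forall>d. x @ d \<simeq> d @ y \<longrightarrow> length c \<le> length d"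
  defines "W \<equiv> fst ` set x"
  shows "fst ` set c \<subseteq> W" and "v \<in> W \<Longrightarrow> occ v c \<le> Suc (card W) * occ v x"
    and "v \<in> W \<Longrightarrow> \<not> adj v t \<Longrightarrow> length c \<le> n \<Longrightarrow> prefix (proj v t c) (list_pow n (proj v t x))"
proof -
  have "mset x = mset y" using teq_mset[OF xc] by simp
  then have set_y: "set y = set x" by (metis set_mset_mset)
  define c0 where "c0 = filter (\<lambda>p. fst p \<in> W) c"
  have "filter (\<lambda>p. fst p \<in> W) x = x" "filter (\<lambda>p. fst p \<in> W) y = y"
    using set_y by (auto simp: W_def filter_id_conv)
  then have "x @ c0 \<simeq> c0 @ y" using teq_filter[OF xc, of W] by (simp add: c0_def)
  then have "length c \<le> length c0" using min by blast
  show cW: "fst ` set c \<subseteq> W"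
  proof (rule ccontr)
    assume "\<not> ?thesis"
    then obtain p where "p \<in> set c" "fst p \<notin> W" by blast
    then have "length c0 < length c" unfolding c0_def by (rule length_filter_less)
    then show False using \<open>length c \<le> length c0\<close> by simp
  qed

  show pre: "prefix (proj v t c) (list_pow n (proj v t x))"
    if "v \<in> W" "\<not> adj v t" "length c \<le> n" for v t n
  proof (rule conj_prefix_list_pow)
    show "proj v t x @ proj v t c = proj v t c @ proj v t y"
      using teqD[OF xc that(2)] by simp
    have "occ v (proj v t x) \<noteq> 0" using that(1) occ_proj[of v v t x] occ_eq_0_iff[of v x] by (auto simp: W_def)
    then show "proj v t x \<noteq> []" by auto
    show "length (proj v t c) \<le> n" using that(3) unfolding proj_def
      by (meson length_filter_le order_trans)
  qed

  have step: "k * occ t x \<le> occ t c"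
    if ut: "u \<in> W" "\<not> adj u t" and k: "Suc k * occ u x \<le> occ u c" for u t k
  proof -
    have p: "prefix (proj u t c) (list_pow (length c + k) (proj u t x))"
      using pre ut by simp
    have q: "prefix (list_pow k (proj u t x)) (list_pow (length c + k) (proj u t x))"
      by (rule prefix_list_pow_mono) simp
    from prefix_same_cases[OF p q] have "prefix (list_pow k (proj u t x)) (proj u t c)"
    proof
      assume "prefix (proj u t c) (list_pow k (proj u t x))"
      then have "occ u c \<le> k * occ u x"
        using occ_prefix[of "proj u t c" "list_pow k (proj u t x)" u] by (simp add: occ_list_pow occ_proj)
      moreover have "occ u x > 0" using ut(1) occ_eq_0_iff[of u x] by (auto simp: W_def)
      ultimately show ?thesis using k by simp
    qed
    then show ?thesis
      using occ_prefix[of "list_pow k (proj u t x)" "proj u t c" t] by (simp add: occ_list_pow occ_proj)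
  qed

  have strip: False
    if Z: "Z \<subseteq> W" "Z \<noteq> {}" and clo: "\<And>s t. s \<in> Z \<Longrightarrow> t \<in> W \<Longrightarrow> \<not> adj s t \<Longrightarrow> t \<in> Z"
      and big: "\<And>s. s \<in> Z \<Longrightarrow> occ s x \<le> occ s c" for Z
  proof -
    define z where "z = filter (\<lambda>p. fst p \<in> Z) x"
    have none: "proj s t z = []" if "s \<notin> Z" "t \<notin> Z" for s t
      using that by (auto simp: z_def proj_def filter_empty_conv)
    have full: "proj s t z = proj s t x" if "s \<in> Z" "\<not> adj s t" for s t
    proof -
      have "t \<in> Z \<or> t \<notin> W" using clo that by blast
      then show ?thesis using that unfolding z_def proj_def filter_filter
        by (intro filter_cong) (auto simp: W_def)
    qed
    have full': "proj s t z = proj s t x" if "s \<in> Z \<or> t \<in> Z" "\<not> adj s t" for s t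
    proof (cases "s \<in> Z")
      case False
      then show ?thesis using that full[of t s] adj_sym[of t s] unfolding proj_commute[of s t] by blast
    qed (use that full in blast)
    have "prefix (proj s t z) (proj s t c)" if st: "\<not> adj s t" for s t
    proof (cases "s \<in> Z \<or> t \<in> Z")
      case True
      then obtain s' t' where s': "s' \<in> Z" "\<not> adj s' t'" "proj s t = (proj s' t' :: ('v \<times> 'g) list \<Rightarrow> _)"
      proof (cases "s \<in> Z")
        case True
        from that[OF this st] show ?thesis by simp
      next
        case False
        then show ?thesis using that[of t s] True st adj_sym[of t s] by (auto simp: proj_commute[of s t])
      qed
      have p: "prefix (proj s' t' c) (list_pow (length c + 1) (proj s' t' x))"
        using s' Z(1) by (intro pre) auto
      have q: "prefix (proj s' t' x) (list_pow (length c + 1) (proj s' t' x))"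
        by simp
      have "length (proj s' t' x) \<le> length (proj s' t' c)"
      proof -
        have len: "length (proj s' t' w) = (if t' = s' then occ s' w else occ s' w + occ t' w)"
          for w :: "('v \<times> 'g) list"
          by (induction w) auto
        have "occ s' x \<le> occ s' c" using big s' by simp
        moreover have "occ t' x \<le> occ t' c"
        proof (cases "t' \<in> Z")
          case False
          then have "t' \<notin> W" using clo s' by blast
          then have "occ t' x = 0" unfolding occ_eq_0_iff W_def .
          then show ?thesis by simp
        qed (rule big)
        ultimately show ?thesis unfolding len by simp
      qed
      then show ?thesis unfolding s'(3) full[OF s'(1,2)] using p q prefix_length_prefix by blast
    qed (simp add: none)
    then obtain c' where c': "c \<simeq> z @ c'" using prefix_teq by blast
    have xz: "x @ z \<simeq> z @ x"
      unfolding teq_def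
    proof (intro allI impI)
      fix s t assume "\<not> adj s t"
      then show "proj s t (x @ z) = proj s t (z @ x)"
        using none[of s t] full'[of s t] by (cases "s \<in> Z \<or> t \<in> Z") auto
    qed
    have "z @ x @ c' \<simeq> x @ z @ c'" using teq_append[OF teq_sym[OF xz] teq_refl[of c']] by simp
    also have "\<dots> \<simeq> x @ c" by (simp add: teq_sym[OF c'])
    also have "\<dots> \<simeq> c @ y" by (rule xc)
    also have "\<dots> \<simeq> z @ c' @ y" using teq_append[OF c' teq_refl[of y]] by simp
    finally have "x @ c' \<simeq> c' @ y" by simp
    then have "length c \<le> length c'" using min by blast
    moreover have "length c = length z + length c'" using teq_length[OF c'] by simp
    ultimately have "z = []" by simp
    then show False using Z by (auto simp: z_def W_def filter_empty_conv)
  qed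

  show "occ v c \<le> Suc (card W) * occ v x" if v: "v \<in> W"
  proof (rule ccontr)
    assume neg: "\<not> ?thesis"
    \<comment> \<open>These sets decrease, start inside \<open>W\<close> and still contain \<open>v\<close> at \<open>k = card W + 1\<close>, so two consecutive ones agree.\<close>
    define Z where "Z k = {u \<in> W. k * occ u x \<le> occ u c}" for k
    have fin: "finite W" by (simp add: W_def)
    then have finZ: "finite (Z k)" for k by (simp add: Z_def)
    have mono: "Z (Suc k) \<subseteq> Z k" for k by (auto simp: Z_def)
    have vZ: "v \<in> Z k" if "k \<le> Suc (card W)" for k
    proof -
      have "k * occ v x \<le> Suc (card W) * occ v x" using that by (rule mult_le_mono1)
      then show ?thesis using neg v by (simp add: Z_def)
    qed
    \<comment> \<open>Otherwise every step would lose a vertex.\<close>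
    have "\<exists>k\<ge>1. k \<le> card W \<and> Z (Suc k) = Z k"
    proof (rule ccontr)
      assume no: "\<not> ?thesis"
      have "card (Z (Suc i)) + i \<le> card W" if "i \<le> card W" for i
        using that
      proof (induction i)
        case 0
        show ?case using card_mono[OF fin, of "Z 1"] by (auto simp: Z_def)
      next
        case (Suc i)
        then have "Z (Suc (Suc i)) \<subset> Z (Suc i)" using no mono[of "Suc i"] by auto
        then have "card (Z (Suc (Suc i))) < card (Z (Suc i))" by (rule psubset_card_mono[OF finZ])
        then show ?case using Suc by simp
      qed
      then have "card (Z (Suc (card W))) = 0" by fastforce
      then show False using vZ[of "Suc (card W)"] finZ by auto
    qed
    then obtain k where k: "1 \<le> k" "k \<le> card W" "Z (Suc k) = Z k" by blast
    \<comment> \<open>Closedness: \<open>k + 1\<close> periods at \<open>s\<close> force \<open>k\<close> at its non-neighbours, and \<open>Z (k + 1) = Z k\<close>.\<close>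
    show False
    proof (rule strip)
      show "Z k \<subseteq> W" by (auto simp: Z_def)
      show "Z k \<noteq> {}" using vZ[of k] k by auto
      show "t \<in> Z k" if "s \<in> Z k" "t \<in> W" "\<not> adj s t" for s t
        using that step[of s t k] k(3) by (auto simp: Z_def)
      show "occ s x \<le> occ s c" if "s \<in> Z k" for s
      proof -
        have "1 * occ s x \<le> k * occ s x" using k by (intro mult_le_mono1) simp
        moreover have "k * occ s x \<le> occ s c" using that by (simp add: Z_def)
        ultimately show ?thesis by linarith
      qed
    qed
  qed
qed

text \<open>
  The syllables of a minimal conjugator are those of \<open>x\<close> read periodically, so the bound on the
  number of syllables also bounds every additive weight.
\<close>
lemma short_trace_conjugator:
  fixes x y c :: "('v \<times> 'g) list"
  assumes "x @ c \<simeq> c @ y"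
  obtains d where "x @ d \<simeq> d @ y" "set d \<subseteq> set x"
    "weight f d \<le> Suc (card (fst ` set x)) * weight f x"
proof -
  define W where "W = fst ` set x"
  obtain d where d: "x @ d \<simeq> d @ y" and min: "\<forall>e. x @ e \<simeq> e @ y \<longrightarrow> length d \<le> length e"
    using ex_has_least_nat[of "\<lambda>d. x @ d \<simeq> d @ y" c length] assms by blast
  note m = minimal_conjugator_count[OF d min, folded W_def]
  have pre: "prefix (proj v v d) (list_pow (Suc (card W)) (proj v v x))" if v: "v \<in> W" for v
  proof -
    let ?n = "length d + Suc (card W)"
    have p: "prefix (proj v v d) (list_pow ?n (proj v v x))" by (rule m(3)[OF v]) simp_all
    have q: "prefix (list_pow (Suc (card W)) (proj v v x)) (list_pow ?n (proj v v x))" by (rule prefix_list_pow_mono) simp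
    have len: "length (proj v v w) = occ v w" for w :: "('v \<times> 'g) list" by (induction w) auto
    have "length (proj v v d) \<le> length (list_pow (Suc (card W)) (proj v v x))"
      using m(2)[OF v] unfolding length_list_pow len .
    then show ?thesis using p q prefix_length_prefix by blast
  qed
  have "weight f (proj v v d) \<le> Suc (card W) * weight f (proj v v x)" if "v \<in> W" for v
    using weight_prefix[OF pre[OF that], of f] unfolding weight_list_pow .
  then have "(\<Sum>v\<in>W. weight f (proj v v d)) \<le> Suc (card W) * (\<Sum>v\<in>W. weight f (proj v v x))"
    unfolding sum_distrib_left by (rule sum_mono)
  then have "weight f d \<le> Suc (card W) * weight f x"
    using weight_by_vertex[of W d f] weight_by_vertex[of W x f] m(1) by (simp add: W_def)
  moreover have "set d \<subseteq> set x"
  proof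
    fix p assume p: "p \<in> set d"
    then have "fst p \<in> W" using m(1) by auto
    from set_mono_prefix[OF pre[OF this]] have "set (proj (fst p) (fst p) d) \<subseteq> set x"
      by (auto simp: proj_def split: if_splits)
    then show "p \<in> set x" using p by (auto simp: proj_def split: if_splits)
  qed
  ultimately show ?thesis using that d by (simp add: W_def)
qed

end

section \<open>Words as elements of the graph product\<close>

text \<open>
  What the combinatorial part of the proof uses about the graph product: it is a quotient of the
  words in which the defining relations hold, and which identifies only equivalent words.
\<close>
locale syllable_evaluation = syllable_words adj V G + Q: group Q
  for adj :: "'v \<Rightarrow> 'v \<Rightarrow> bool" and V :: "'v set" and G :: "'v \<Rightarrow> ('g, 'm) monoid_scheme"
    and Q :: "('q, 'n) monoid_scheme" (structure) +
  fixes ev :: "('v \<times> 'g) list \<Rightarrow> 'q"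
  assumes ev_closed: "wf w \<Longrightarrow> ev w \<in> carrier Q"
    and ev_append: "wf a \<Longrightarrow> wf b \<Longrightarrow> ev (a @ b) = ev a \<otimes> ev b"
    and ev_surj: "q \<in> carrier Q \<Longrightarrow> \<exists>w. wf w \<and> ev w = q"
    and ev_one: "v \<in> V \<Longrightarrow> ev [(v, \<one>\<^bsub>G v\<^esub>)] = \<one>"
    and ev_merge: "v \<in> V \<Longrightarrow> g \<in> carrier (G v) \<Longrightarrow> h \<in> carrier (G v) \<Longrightarrow>
      ev [(v, g), (v, h)] = ev [(v, g \<otimes>\<^bsub>G v\<^esub> h)]"
    and ev_swap: "u \<in> V \<Longrightarrow> g \<in> carrier (G u) \<Longrightarrow> v \<in> V \<Longrightarrow> h \<in> carrier (G v) \<Longrightarrow> adj u v \<Longrightarrow>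
      ev [(u, g), (v, h)] = ev [(v, h), (u, g)]"
    and weq_if_ev_eq: "wf a \<Longrightarrow> wf b \<Longrightarrow> ev a = ev b \<Longrightarrow> a \<approx> b"

locale graph_product_words = pair_graph \<Gamma> + group_family "pverts \<Gamma>" G
  for \<Gamma> :: "'v pair_pre_digraph" and G :: "'v \<Rightarrow> ('g, 'm) monoid_scheme"
begin

sublocale syllable_words "\<lambda>u v. (u, v) \<in> parcs \<Gamma>" "pverts \<Gamma>" G
proof unfold_locales
  show "(u, v) \<in> parcs \<Gamma> \<Longrightarrow> (v, u) \<in> parcs \<Gamma>" for u v
    using pair_sym_arcs by (auto simp: symmetric_def dest: symD)
  show "(v, v) \<notin> parcs \<Gamma>" for v using pair_no_loops[of "(v, v)"] by auto
  show "finite (pverts \<Gamma>)" by (rule pair_finite_verts)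
qed

notation weq (infix "\<approx>" 50)
notation teq (infix "\<simeq>" 50)

abbreviation "F \<equiv> free_product (pverts \<Gamma>) G"
abbreviation "cls w \<equiv> fp_rel (pverts \<Gamma>) G `` {w}"
abbreviation "N \<equiv> normal_closure F (graph_product_relators \<Gamma> G)"

lemma fp_rel_weq: "(a, b) \<in> fp_rel (pverts \<Gamma>) G \<Longrightarrow> a \<approx> b"
proof (induction rule: fp_rel.induct)
  case (refl w)
  then show ?case by (rule weq_refl)
next
  case (sym v w)
  then show ?case by (simp add: weq_sym)
next
  case (trans u v w)
  then show ?case using weq_trans by blast
next
  case (delete_one x y u)
  then show ?case
    using weq_append[OF weq_refl[of x] weq_append[OF weq_one[of u] weq_refl[of y]]] by simp
next
  case (merge x y u g h)
  then show ?case
    using weq_append[OF weq_refl[of x] weq_append[OF weq_merge[of u g h] weq_refl[of y]]] by simp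
qed

lemma cls_eq_weq: "wf a \<Longrightarrow> cls a = cls b \<Longrightarrow> b \<approx> a"
  using fp_rel_weq fp_rel.refl by (metis Image_singleton_iff)

lemma cls_closed: "wf w \<Longrightarrow> cls w \<in> carrier F"
  by (auto simp: free_product_def quotient_def)

lemma cls_surj: "A \<in> carrier F \<Longrightarrow> \<exists>w. wf w \<and> A = cls w"
  by (auto simp: free_product_def quotient_def)

lemma cls_append: "wf a \<Longrightarrow> wf b \<Longrightarrow> cls (a @ b) = cls a \<otimes>\<^bsub>F\<^esub> cls b"
  by (simp add: free_product_mult_class)

lemma cls_Nil: "cls [] = \<one>\<^bsub>F\<^esub>" by (simp add: free_product_def)

lemma relators_closed: "graph_product_relators \<Gamma> G \<subseteq> carrier F"
proof -
  interpret F: group F by (rule group_free_product)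
  show ?thesis
    by (auto simp: graph_product_relators_def commutator_def
        intro!: F.m_closed F.inv_closed hom_in_carrier[OF fp_incl_hom] dest: in_arcsD1 in_arcsD2)
qed

lemma N_normal: "N \<lhd> F"
  by (rule group.normal_closure_normal[OF group_free_product relators_closed])

text \<open>
  The classes of the words equivalent to the empty word form a normal subgroup of the free product
  containing all relators, hence containing the normal closure.
\<close>
lemma N_weq_Nil: assumes "wf w" "cls w \<in> N" shows "w \<approx> []"
proof -
  interpret F: group F by (rule group_free_product)
  define K where "K = {A \<in> carrier F. \<exists>w. wf w \<and> A = cls w \<and> w \<approx> []}"
  have K_I: "cls w \<in> K" if "wf w" "w \<approx> []" for w
    unfolding K_def using that cls_closed by blast
  have inv_word: "\<exists>b. wf b \<and> inv\<^bsub>F\<^esub> (cls a) = cls b \<and> b @ a \<approx> [] \<and> a @ b \<approx> []" if a: "wf a" for a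
  proof -
    obtain b where b: "wf b" "inv\<^bsub>F\<^esub> (cls a) = cls b" using a cls_surj cls_closed F.inv_closed by metis
    have "cls (b @ a) = cls []" "cls (a @ b) = cls []"
      unfolding cls_append[OF b(1) a] cls_append[OF a b(1)] b(2)[symmetric] cls_Nil
      using a cls_closed by simp_all
    then have "b @ a \<approx> []" "a @ b \<approx> []"
      using cls_eq_weq[of "[]" "b @ a"] cls_eq_weq[of "[]" "a @ b"] by auto
    then show ?thesis using b by blast
  qed
  have "subgroup K F"
  proof (rule F.subgroupI)
    show "K \<subseteq> carrier F" by (auto simp: K_def)
    have "cls [] \<in> K" using K_I[of "[]"] weq_refl[of "[]"] by simp
    then show "K \<noteq> {}" by blast
  next
    fix A assume "A \<in> K"
    then obtain a where a: "wf a" "A = cls a" "a \<approx> []" by (auto simp: K_def)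
    obtain b where b: "wf b" "inv\<^bsub>F\<^esub> A = cls b" "b @ a \<approx> []" using inv_word a by blast
    have "b @ [] \<approx> b @ a" by (intro weq_append weq_refl weq_sym[OF a(3)] b)
    then have "b \<approx> []" using b(3) weq_trans by fastforce
    then show "inv\<^bsub>F\<^esub> A \<in> K" using b K_I by simp
  next
    fix A B assume "A \<in> K" "B \<in> K"
    then obtain a b where a: "wf a" "A = cls a" "a \<approx> []" and b: "wf b" "B = cls b" "b \<approx> []"
      by (auto simp: K_def)
    have "a @ b \<approx> []" using weq_append[OF a(3) b(3)] by simp
    moreover have "A \<otimes>\<^bsub>F\<^esub> B = cls (a @ b)" using a b cls_append by simp
    ultimately show "A \<otimes>\<^bsub>F\<^esub> B \<in> K"
      using a b K_I[of "a @ b"] by simp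
  qed
  moreover have "x \<otimes>\<^bsub>F\<^esub> h \<otimes>\<^bsub>F\<^esub> inv\<^bsub>F\<^esub> x \<in> K" if x: "x \<in> carrier F" and h: "h \<in> K" for x h
  proof -
    obtain a where a: "wf a" "h = cls a" "a \<approx> []" using h by (auto simp: K_def)
    obtain c where c: "wf c" "x = cls c" using x cls_surj by blast
    obtain d where d: "wf d" "inv\<^bsub>F\<^esub> x = cls d" "c @ d \<approx> []" using inv_word c by blast
    have eq: "x \<otimes>\<^bsub>F\<^esub> h \<otimes>\<^bsub>F\<^esub> inv\<^bsub>F\<^esub> x = cls (c @ a @ d)"
      using a c d cls_append cls_append[of "c @ a" d] by simp
    have "c @ a @ d \<approx> c @ [] @ d" by (intro weq_append weq_refl a c d)
    then have "c @ a @ d \<approx> []" using weq_trans d(3) by fastforce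
    then show ?thesis unfolding eq using a c d by (intro K_I) simp_all
  qed
  ultimately have "K \<lhd> F" by (simp add: F.normal_inv_iff)
  moreover have "graph_product_relators \<Gamma> G \<subseteq> K"
  proof
    fix R assume R: "R \<in> graph_product_relators \<Gamma> G"
    then obtain u v g h where uv: "(u, v) \<in> parcs \<Gamma>" "g \<in> carrier (G u)" "h \<in> carrier (G v)"
      and R': "R = commutator F (cls [(u, g)]) (cls [(v, h)])"
      by (auto simp: graph_product_relators_def fp_incl_def)
    have V: "u \<in> pverts \<Gamma>" "v \<in> pverts \<Gamma>" using uv by (auto dest: in_arcsD1 in_arcsD2)
    obtain a where a: "wf a" "inv\<^bsub>F\<^esub> (cls [(u, g)]) = cls a" "[(u, g)] @ a \<approx> []"
      using inv_word[of "[(u, g)]"] uv V by auto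
    obtain b where b: "wf b" "inv\<^bsub>F\<^esub> (cls [(v, h)]) = cls b" "[(v, h)] @ b \<approx> []"
      using inv_word[of "[(v, h)]"] uv V by auto
    have w: "wf [(u, g)]" "wf [(v, h)]" using uv V by auto
    let ?w = "(([(u, g)] @ [(v, h)]) @ a) @ b"
    have "R = cls ?w" unfolding R' commutator_def a(2) b(2)
      using w a(1) b(1) by (simp only: cls_append fp_words_simps(3) simp_thms)
    have "(v, u) \<in> parcs \<Gamma>" using uv adj_sym by blast
    then have "[(u, g), (v, h)] \<approx> [(v, h), (u, g)]" using weq_swap V uv by blast
    then have "[(u, g), (v, h)] @ (a @ b) \<approx> [(v, h), (u, g)] @ (a @ b)"
      by (intro weq_append weq_refl) (use a b in auto)
    then have "?w \<approx> [(v, h)] @ ([(u, g)] @ a) @ b" by simp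
    also have "\<dots> \<approx> [(v, h)] @ [] @ b" by (intro weq_append weq_refl a w b)
    also have "\<dots> = [(v, h)] @ b" by simp
    also have "\<dots> \<approx> []" by (rule b)
    finally have "?w \<approx> []" .
    moreover have "wf ?w" using a b w by simp
    ultimately show "R \<in> K"
      using \<open>R = cls ?w\<close> K_I by blast
  qed
  ultimately have "N \<subseteq> K" by (auto simp: normal_closure_def)
  then obtain a where "wf a" "cls w = cls a" "a \<approx> []" using assms(2) by (auto simp: K_def)
  then show ?thesis using cls_eq_weq weq_trans by metis
qed

definition ev :: "('v \<times> 'g) list \<Rightarrow> ('v \<times> 'g) list set set" where
  "ev w = N #>\<^bsub>F\<^esub> cls w"

lemma ev_coset_append: "wf a \<Longrightarrow> wf b \<Longrightarrow> ev (a @ b) = ev a \<otimes>\<^bsub>graph_product \<Gamma> G\<^esub> ev b"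
  using normal.rcos_sum[OF N_normal cls_closed cls_closed, of a b]
  by (simp add: graph_product_def FactGroup_def ev_def cls_append)

lemma ev_in_carrier: "wf a \<Longrightarrow> ev a \<in> carrier (graph_product \<Gamma> G)"
  using cls_closed by (auto simp: graph_product_def FactGroup_def ev_def RCOSETS_def)

lemma weq_if_same_coset: assumes "wf a" "wf b" "ev a = ev b" shows "a \<approx> b"
proof -
  interpret F: group F by (rule group_free_product)
  interpret N: normal N F by (rule N_normal)
  obtain c where c: "wf c" "inv\<^bsub>F\<^esub> (cls b) = cls c" using assms cls_surj cls_closed F.inv_closed by metis
  have "cls a \<in> N #>\<^bsub>F\<^esub> cls b"
    using F.rcos_self[OF cls_closed N.is_subgroup] assms by (metis ev_def)
  then obtain n where n: "n \<in> N" "cls a = n \<otimes>\<^bsub>F\<^esub> cls b" by (auto simp: r_coset_def)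
  have nF: "n \<in> carrier F" using n N.subset by blast
  have "cls (a @ c) = n"
    using n nF assms c cls_closed by (simp add: cls_append c(2)[symmetric] F.m_assoc)
  then have 1: "a @ c \<approx> []" using N_weq_Nil[of "a @ c"] n assms c by simp
  have "cls (c @ b) = cls []"
    using assms c cls_closed by (simp add: cls_append c(2)[symmetric] cls_Nil)
  then have 2: "c @ b \<approx> []" using cls_eq_weq[of "[]" "c @ b"] by simp
  have "a @ [] \<approx> a @ c @ b" by (intro weq_append weq_refl weq_sym[OF 2] assms)
  also have "\<dots> = (a @ c) @ b" by simp
  also have "\<dots> \<approx> [] @ b" by (intro weq_append weq_refl 1 assms)
  finally show ?thesis by simp
qed

sublocale syllable_evaluation "\<lambda>u v. (u, v) \<in> parcs \<Gamma>" "pverts \<Gamma>" G "graph_product \<Gamma> G" ev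
proof (rule syllable_evaluation.intro)
  show "syllable_words (\<lambda>u v. (u, v) \<in> parcs \<Gamma>) (pverts \<Gamma>) G" by unfold_locales
  interpret F: group F by (rule group_free_product)
  interpret N: normal N F by (rule N_normal)
  show group: "group (graph_product \<Gamma> G)"
    unfolding graph_product_def by (rule N.factorgroup_is_group)
  interpret Q: group "graph_product \<Gamma> G" by (rule group)
  show "syllable_evaluation_axioms (\<lambda>u v. (u, v) \<in> parcs \<Gamma>) (pverts \<Gamma>) G (graph_product \<Gamma> G) ev"
  proof
    show "ev w \<in> carrier (graph_product \<Gamma> G)" if "wf w" for w using that by (rule ev_in_carrier)
    show "ev (a @ b) = ev a \<otimes>\<^bsub>graph_product \<Gamma> G\<^esub> ev b" if "wf a" "wf b" for a b
      using that by (rule ev_coset_append)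
    show "\<exists>w. wf w \<and> ev w = q" if "q \<in> carrier (graph_product \<Gamma> G)" for q
      using that cls_surj by (fastforce simp: graph_product_def FactGroup_def ev_def RCOSETS_def)
    show "ev [(v, \<one>\<^bsub>G v\<^esub>)] = \<one>\<^bsub>graph_product \<Gamma> G\<^esub>" if "v \<in> pverts \<Gamma>" for v
    proof -
      have "cls [(v, \<one>\<^bsub>G v\<^esub>)] = cls []"
        using equiv_class_eq[OF equiv_fp_rel fp_rel.delete_one[of "[]" _ _ "[]" v]] that by simp
      then show ?thesis by (simp add: ev_def cls_Nil graph_product_def FactGroup_def F.coset_mult_one N.subset)
    qed
    show "ev [(v, g), (v, h)] = ev [(v, g \<otimes>\<^bsub>G v\<^esub> h)]"
      if "v \<in> pverts \<Gamma>" "g \<in> carrier (G v)" "h \<in> carrier (G v)" for v g h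
      using equiv_class_eq[OF equiv_fp_rel fp_rel.merge[of "[]" _ _ "[]" v g h]] that
      by (simp add: ev_def)
    show "ev [(u, g), (v, h)] = ev [(v, h), (u, g)]"
      if uv: "u \<in> pverts \<Gamma>" "g \<in> carrier (G u)" "v \<in> pverts \<Gamma>" "h \<in> carrier (G v)" "(u, v) \<in> parcs \<Gamma>"
      for u g v h
    proof -
      let ?a = "cls [(u, g)]" and ?b = "cls [(v, h)]"
      have c: "?a \<in> carrier F" "?b \<in> carrier F" using uv by (auto intro: cls_closed)
      have "commutator F ?a ?b \<in> graph_product_relators \<Gamma> G"
        using uv by (auto simp: graph_product_relators_def fp_incl_def)
      then have "commutator F ?a ?b \<in> N" by (auto simp: normal_closure_def)
      moreover have "?a \<otimes>\<^bsub>F\<^esub> ?b = commutator F ?a ?b \<otimes>\<^bsub>F\<^esub> (?b \<otimes>\<^bsub>F\<^esub> ?a)"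
        using c by (simp add: commutator_def F.m_assoc F.inv_solve_left')
      ultimately have "?a \<otimes>\<^bsub>F\<^esub> ?b \<in> N #>\<^bsub>F\<^esub> (?b \<otimes>\<^bsub>F\<^esub> ?a)"
        by (auto simp: r_coset_def)
      then have "N #>\<^bsub>F\<^esub> (?b \<otimes>\<^bsub>F\<^esub> ?a) = N #>\<^bsub>F\<^esub> (?a \<otimes>\<^bsub>F\<^esub> ?b)"
        using c by (intro F.repr_independence N.is_subgroup) auto
      then show ?thesis
        using uv cls_append[of "[(u, g)]" "[(v, h)]"] cls_append[of "[(v, h)]" "[(u, g)]"]
        by (simp add: ev_def)
    qed
    show "a \<approx> b" if "wf a" "wf b" "ev a = ev b" for a b using that by (rule weq_if_same_coset)
  qed
qed

end

section \<open>Cyclically reduced words and floating syllables\<close>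

context commutation
begin

text \<open>
  With at least two occurrences, the \<open>v\<close>-syllables available at the front and at the end are
  different, and they would merge in a cyclic permutation of the word.
\<close>
definition two_ended :: "'v \<Rightarrow> ('v \<times> 'g) list \<Rightarrow> bool" where
  "two_ended v w \<longleftrightarrow> fsyl v w \<noteq> None \<and> lsyl v w \<noteq> None \<and> 2 \<le> occ v w"

definition floats :: "'v \<Rightarrow> ('v \<times> 'g) list \<Rightarrow> bool" where
  "floats v w \<longleftrightarrow> occ v w = 1 \<and> (\<forall>u. occ u w > 0 \<longrightarrow> u = v \<or> adj u v)"

lemma teq_two_ended: "a \<simeq> b \<Longrightarrow> two_ended v a = two_ended v b"
  using teq_fsyl[of a b v] teq_lsyl[of a b v] teq_occ[of a b v] by (simp add: two_ended_def)

lemma fsyl_snoc: "fsyl v (w @ [(u, g)]) =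
    (case fsyl v w of Some h \<Rightarrow> Some h | None \<Rightarrow> if u = v \<and> links v w then Some g else None)"
  by (auto simp: fsyl_append split: option.splits)

lemma two_ended_split:
  assumes "two_ended v w" "fsyl v w = Some g" "lsyl v w = Some h"
  obtains m where "w \<simeq> (v, g) # m @ [(v, h)]"
proof -
  have w: "w \<simeq> (v, g) # remove_syl v w" using teq_remove_syl assms(2) .
  have o: "occ v (remove_syl v w) \<noteq> 0" using teq_occ[OF w, of v] assms(1) by (simp add: two_ended_def)
  have "fsyl v (rev (remove_syl v w) @ [(v, g)]) = Some h" using teq_lsyl[OF w, of v] assms(3) by simp
  then have "lsyl v (remove_syl v w) = Some h"
    using links_occ[of v "remove_syl v w"] o by (auto simp: fsyl_snoc split: option.splits if_splits)
  from lsyl_split[OF this] obtain m where "remove_syl v w \<simeq> m @ [(v, h)]" by blast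
  then have "w \<simeq> (v, g) # m @ [(v, h)]" using teq_trans[OF w] by simp
  then show ?thesis by (rule that)
qed

text \<open>
  A single syllable available at both ends commutes with everything else.
\<close>
lemma not_two_ended_split:
  assumes "\<not> two_ended v w" "fsyl v w \<noteq> None" "lsyl v w \<noteq> None"
  obtains g w' where "w \<simeq> (v, g) # w'" "links v w'"
proof -
  obtain g where g: "fsyl v w = Some g" using assms by blast
  have w: "w \<simeq> (v, g) # remove_syl v w" using teq_remove_syl g .
  have "occ v (remove_syl v w) = 0" using teq_occ[OF w, of v] assms by (simp add: two_ended_def)
  then have "lsyl v (remove_syl v w) = None" by (intro fsyl_None_if_absent) simp
  moreover have "fsyl v (rev (remove_syl v w) @ [(v, g)]) \<noteq> None" using teq_lsyl[OF w, of v] assms(3) by simp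
  ultimately have "links v (remove_syl v w)" by (auto simp: fsyl_snoc split: if_splits)
  then show ?thesis using that w by blast
qed

lemma floats_occ_cong: "(\<And>u. occ u a = occ u b) \<Longrightarrow> floats v a = floats v b"
  by (simp add: floats_def)

lemma floatsI: assumes "links v w" shows "floats v ((v, g) # w)"
proof -
  have "u = v \<or> adj u v" if "occ u ((v, g) # w) > 0" for u
  proof (cases "u = v")
    case False
    then have "occ u w \<noteq> 0" using that by simp
    then show ?thesis using assms by (auto simp: links_def occ_eq_0_iff)
  qed simp
  then show ?thesis using assms links_occ by (simp add: floats_def)
qed

lemma floats_split:
  assumes "floats v w" obtains g w' where "w \<simeq> (v, g) # w'" "links v w'"
proof -
  have "\<exists>g w'. w \<simeq> (v, g) # w' \<and> links v w'"
    using assms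
  proof (induction w)
    case (Cons p w)
    obtain u h where p: "p = (u, h)" by (cases p)
    have o: "occ v (p # w) = 1" and a: "\<And>t. occ t (p # w) > 0 \<Longrightarrow> t = v \<or> adj t v"
      using Cons.prems by (auto simp: floats_def)
    show ?case
    proof (cases "u = v")
      case True
      then have "occ v w = 0" using o p by simp
      have "links v w" unfolding links_def
      proof
        fix q assume q: "q \<in> set w"
        then have "occ (fst q) w \<noteq> 0" by (auto simp: occ_eq_0_iff)
        moreover from this have "occ (fst q) (p # w) > 0" by simp
        ultimately show "adj (fst q) v" using a[of "fst q"] \<open>occ v w = 0\<close> by metis
      qed
      then show ?thesis using True p teq_refl by blast
    next
      case False
      then have uv: "adj u v" using a[of u] p by auto
      have "floats v w" unfolding floats_def using o a False p by (auto split: if_splits)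
      then obtain g w' where w: "w \<simeq> (v, g) # w'" "links v w'" using Cons.IH by blast
      have "(u, h) # w \<simeq> (u, h) # (v, g) # w'" using w by simp
      also have "\<dots> \<simeq> (v, g) # (u, h) # w'" using uv by (rule teq_swap)
      finally show ?thesis using w uv p by (intro exI[of _ g] exI[of _ "(u, h) # w'"]) simp
    qed
  qed (simp add: floats_def)
  then show ?thesis using that by blast
qed

end

context syllable_words
begin

definition cyc_reduced :: "('v \<times> 'g) list \<Rightarrow> bool" where
  "cyc_reduced w \<longleftrightarrow> reduced w \<and> (\<forall>v. \<not> two_ended v w)"

lemma teq_cyc_reduced: "a \<simeq> b \<Longrightarrow> cyc_reduced a = cyc_reduced b"
  using teq_two_ended[of a b] teq_reduced[of a b] by (simp add: cyc_reduced_def)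

lemma occ_map_fst:
  fixes a b :: "('v \<times> 'c) list"
  shows "map fst a = map fst b \<Longrightarrow> occ v a = occ v b"
proof -
  have "occ v w = length (filter (\<lambda>u. u = v) (map fst w))" for w :: "('v \<times> 'c) list"
    by (induction w) auto
  from this[of a] this[of b] show "map fst a = map fst b \<Longrightarrow> occ v a = occ v b" by (simp only:)
qed

lemma cyc_reduced_map_fst:
  assumes "map fst a = map fst b" "\<forall>(v, g) \<in> set b. g \<noteq> \<one>\<^bsub>G v\<^esub>" "cyc_reduced a" shows "cyc_reduced b"
proof -
  have "map fst (rev a) = map fst (rev b)" using assms(1) unfolding rev_map[symmetric] by simp
  then have "two_ended v a = two_ended v b" for v
    using fsyl_None_map_fst[of "rev a" "rev b" v] fsyl_None_map_fst[OF assms(1), of v]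
      occ_map_fst[OF assms(1), of v] by (simp add: two_ended_def)
  then show ?thesis using assms reduced_map_fst by (simp add: cyc_reduced_def)
qed

text \<open>
  A vertex that reaches both ends of \<open>(v, g) x\<close> is adjacent to \<open>v\<close>, or is \<open>v\<close> itself; in either case
  it shows up as a defect of \<open>x (v, g)\<close>.
\<close>
lemma cyc_reduced_rotate:
  assumes "cyc_reduced (x @ [(v, g)])" shows "cyc_reduced ((v, g) # x)"
proof -
  have "lsyl v x = None \<or> fsyl v [(v, g)] = None"
    using assms unfolding cyc_reduced_def reduced_append by (elim conjE) (erule spec)
  then have r: "reduced x" "g \<noteq> \<one>\<^bsub>G v\<^esub>" "lsyl v x = None"
    using assms by (auto simp: cyc_reduced_def reduced_append)
  have nb: "\<not> two_ended u (x @ [(v, g)])" for u using assms by (simp add: cyc_reduced_def)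
  have "fsyl v x = None"
  proof (rule ccontr)
    assume "fsyl v x \<noteq> None"
    then obtain h where h: "fsyl v x = Some h" by blast
    then have "two_ended v (x @ [(v, g)])" using fsyl_occ[OF h] by (simp add: two_ended_def fsyl_append)
    then show False using nb by blast
  qed
  moreover have "\<not> two_ended u ((v, g) # x)" for u
  proof
    assume b: "two_ended u ((v, g) # x)"
    then have l: "fsyl u (rev x @ [(v, g)]) \<noteq> None" by (simp add: two_ended_def)
    show False
    proof (cases "u = v")
      case True
      then have "links v x" using l r by (auto simp: fsyl_snoc split: if_splits)
      then show False using b True links_occ[of v x] by (simp add: two_ended_def)
    next
      case False
      then have "lsyl u x \<noteq> None" using l by (auto simp: fsyl_snoc split: option.splits)
      moreover have "adj v u" "fsyl u x \<noteq> None" using b False by (auto simp: two_ended_def split: if_splits)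
      ultimately have "two_ended u (x @ [(v, g)])" using b False by (auto simp: two_ended_def fsyl_append)
      then show False using nb by blast
    qed
  qed
  ultimately show ?thesis using r by (simp add: cyc_reduced_def)
qed

text \<open>
  Conjugation of every syllable inside its vertex-group, by one element per vertex.
\<close>
definition twist :: "('v \<Rightarrow> 'g) \<Rightarrow> ('v \<times> 'g) list \<Rightarrow> ('v \<times> 'g) list" where
  "twist k = map (\<lambda>(v, g). (v, inv\<^bsub>G v\<^esub> k v \<otimes>\<^bsub>G v\<^esub> g \<otimes>\<^bsub>G v\<^esub> k v))"

lemma twist_simps [simp]:
  "twist k [] = []"
  "twist k ((v, g) # w) = (v, inv\<^bsub>G v\<^esub> k v \<otimes>\<^bsub>G v\<^esub> g \<otimes>\<^bsub>G v\<^esub> k v) # twist k w"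
  "twist k (a @ b) = twist k a @ twist k b"
  by (simp_all add: twist_def)

lemma twist_teq: "a \<simeq> b \<Longrightarrow> twist k a \<simeq> twist k b"
  unfolding twist_def by (rule teq_map)

lemma twist_occ: "occ v (twist k w) = occ v w"
  by (induction w) auto

lemma wf_twist: "\<forall>v\<in>V. k v \<in> carrier (G v) \<Longrightarrow> wf w \<Longrightarrow> wf (twist k w)"
  by (induction w) (auto simp: factor_closed)

lemma twist_twist:
  assumes "\<forall>v\<in>V. k v \<in> carrier (G v)" "\<forall>v\<in>V. l v \<in> carrier (G v)"
  shows "wf w \<Longrightarrow> twist l (twist k w) = twist (\<lambda>v. k v \<otimes>\<^bsub>G v\<^esub> l v) w"
proof (induction w)
  case (Cons p w)
  obtain v g where p: "p = (v, g)" by (cases p)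
  interpret group "G v" using group_factor Cons.prems p by simp
  have "k v \<in> carrier (G v)" "l v \<in> carrier (G v)" "g \<in> carrier (G v)" using Cons.prems p assms by auto
  then show ?case using Cons p by (simp add: inv_mult_group m_assoc)
qed simp

lemma twist_trivial: "(\<And>v g. (v, g) \<in> set w \<Longrightarrow> k v = \<one>\<^bsub>G v\<^esub>) \<Longrightarrow> wf w \<Longrightarrow> twist k w = w"
proof (induction w)
  case (Cons p w)
  obtain v g where p: "p = (v, g)" by (cases p)
  interpret group "G v" using group_factor Cons.prems p by simp
  have "k v = \<one>\<^bsub>G v\<^esub>" using Cons.prems(1)[of v g] p by simp
  moreover have "twist k w = w" using Cons by auto
  ultimately show ?case using Cons.prems(2) p by simp
qed simp

text \<open>
  Conjugacy in the trace monoid after conjugating floating syllables inside their vertex-groups.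
  The conjugator \<open>c\<close> multiplies as a trace, without any reduction.
\<close>
definition twisted_conj :: "('v \<times> 'g) list \<Rightarrow> ('v \<times> 'g) list \<Rightarrow> bool" where
  "twisted_conj x y \<longleftrightarrow> (\<exists>k c. (\<forall>v\<in>V. k v \<in> carrier (G v)) \<and>
     (\<forall>v\<in>V. k v \<noteq> \<one>\<^bsub>G v\<^esub> \<longrightarrow> floats v x) \<and> twist k x @ c \<simeq> c @ y)"

lemma twisted_conjI_teq: assumes "wf x" "x @ c \<simeq> c @ y" shows "twisted_conj x y"
  unfolding twisted_conj_def
  using assms factor_closed twist_trivial[of x "\<lambda>v. \<one>\<^bsub>G v\<^esub>"]
  by (intro exI[of _ "\<lambda>v. \<one>\<^bsub>G v\<^esub>"] exI[of _ c]) auto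

lemma twisted_conj_float:
  assumes "links v x" "v \<in> V" "h \<in> carrier (G v)" "wf ((v, g) # x)"
  shows "twisted_conj ((v, g) # x) ((v, inv\<^bsub>G v\<^esub> h \<otimes>\<^bsub>G v\<^esub> g \<otimes>\<^bsub>G v\<^esub> h) # x)"
proof -
  let ?k = "\<lambda>u. if u = v then h else \<one>\<^bsub>G u\<^esub>"
  have "(v, a) \<notin> set x" for a using assms(1) by (auto simp: links_def)
  then have "twist ?k x = x" using assms by (intro twist_trivial) auto
  then have "twist ?k ((v, g) # x) @ [] \<simeq> [] @ ((v, inv\<^bsub>G v\<^esub> h \<otimes>\<^bsub>G v\<^esub> g \<otimes>\<^bsub>G v\<^esub> h) # x)" by simp
  moreover have "\<forall>u\<in>V. ?k u \<in> carrier (G u)" using assms factor_closed by simp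
  moreover have "\<forall>u\<in>V. ?k u \<noteq> \<one>\<^bsub>G u\<^esub> \<longrightarrow> floats u ((v, g) # x)" using floatsI[OF assms(1)] by simp
  ultimately show ?thesis unfolding twisted_conj_def by (intro exI[of _ ?k] exI[of _ "[]"] conjI)
qed

lemma twisted_conj_occ: assumes "twisted_conj x y" shows "occ v x = occ v y"
proof -
  obtain k c where "twist k x @ c \<simeq> c @ y" using assms by (auto simp: twisted_conj_def)
  from teq_occ[OF this, of v] show ?thesis by (simp add: twist_occ)
qed

lemma twisted_conj_length: assumes "twisted_conj x y" shows "length x = length y"
proof -
  obtain k c where "twist k x @ c \<simeq> c @ y" using assms by (auto simp: twisted_conj_def)
  from teq_length[OF this] show ?thesis by (simp add: twist_def)
qed

text \<open>
  Twists act on traces by automorphisms, and twisted conjugate words have the same floating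
  vertices, so the second twist can be carried through the first conjugation.
\<close>
lemma twisted_conj_trans:
  assumes "twisted_conj x y" "twisted_conj y z" "wf x" shows "twisted_conj x z"
proof -
  obtain k c where k: "\<forall>v\<in>V. k v \<in> carrier (G v)" "\<forall>v\<in>V. k v \<noteq> \<one>\<^bsub>G v\<^esub> \<longrightarrow> floats v x"
    and c: "twist k x @ c \<simeq> c @ y" using assms(1) by (auto simp: twisted_conj_def)
  obtain l d where l: "\<forall>v\<in>V. l v \<in> carrier (G v)" "\<forall>v\<in>V. l v \<noteq> \<one>\<^bsub>G v\<^esub> \<longrightarrow> floats v y"
    and d: "twist l y @ d \<simeq> d @ z" using assms(2) by (auto simp: twisted_conj_def)
  let ?m = "\<lambda>v. k v \<otimes>\<^bsub>G v\<^esub> l v"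
  have "twist ?m x @ twist l c @ d = twist l (twist k x @ c) @ d" using twist_twist[OF k(1) l(1) assms(3)] by simp
  also have "\<dots> \<simeq> twist l (c @ y) @ d" by (rule teq_append[OF twist_teq[OF c] teq_refl])
  also have "\<dots> \<simeq> (twist l c @ d) @ z" using d by simp
  finally have "twist ?m x @ (twist l c @ d) \<simeq> (twist l c @ d) @ z" .
  moreover have "\<forall>v\<in>V. ?m v \<in> carrier (G v)" using k l factor_closed by simp
  moreover have "\<forall>v\<in>V. ?m v \<noteq> \<one>\<^bsub>G v\<^esub> \<longrightarrow> floats v x"
  proof (intro ballI impI)
    fix v assume v: "v \<in> V" "?m v \<noteq> \<one>\<^bsub>G v\<^esub>"
    interpret group "G v" using group_factor v by simp
    have "k v \<noteq> \<one>\<^bsub>G v\<^esub> \<or> l v \<noteq> \<one>\<^bsub>G v\<^esub>" using v(2) by auto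
    moreover have "floats v y = floats v x" by (rule floats_occ_cong) (simp add: twisted_conj_occ[OF assms(1)])
    ultimately show "floats v x" using k(2) l(2) v(1) by blast
  qed
  ultimately show ?thesis unfolding twisted_conj_def by (intro exI[of _ ?m] exI[of _ "twist l c @ d"] conjI)
qed

end

context syllable_evaluation
begin

lemma ev_Nil [simp]: "ev [] = \<one>"
proof -
  have c: "ev [] \<in> carrier Q" by (rule ev_closed) simp
  have "ev [] \<otimes> ev [] = ev []" using ev_append[of "[]" "[]"] by simp
  then show ?thesis using c by simp
qed

lemma ev_Cons: "wf (p # w) \<Longrightarrow> ev (p # w) = ev [p] \<otimes> ev w"
  using ev_append[of "[p]" w] by simp

lemma ev_syl_closed: "v \<in> V \<Longrightarrow> g \<in> carrier (G v) \<Longrightarrow> ev [(v, g)] \<in> carrier Q"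
  by (rule ev_closed) simp

lemma ev_mult:
  "v \<in> V \<Longrightarrow> g \<in> carrier (G v) \<Longrightarrow> h \<in> carrier (G v) \<Longrightarrow>
    ev [(v, g)] \<otimes> ev [(v, h)] = ev [(v, g \<otimes>\<^bsub>G v\<^esub> h)]"
  using ev_merge[of v g h] ev_append[of "[(v, g)]" "[(v, h)]"] by simp

lemma ev_inv_syl:
  assumes "v \<in> V" "g \<in> carrier (G v)" shows "ev [(v, inv\<^bsub>G v\<^esub> g)] = inv (ev [(v, g)])"
proof -
  interpret Gv: group "G v" using group_factor assms by simp
  have "ev [(v, inv\<^bsub>G v\<^esub> g)] \<otimes> ev [(v, g)] = \<one>" using assms by (simp add: ev_mult ev_one)
  then show ?thesis using assms by (intro Q.inv_equality[symmetric]) (simp_all add: ev_syl_closed)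
qed

lemma ev_remove_syl:
  "wf w \<Longrightarrow> fsyl v w = Some g \<Longrightarrow> ev w = ev ((v, g) # remove_syl v w)"
proof (induction w)
  case (Cons p w)
  obtain u h where p: "p = (u, h)" by (cases p)
  show ?case
  proof (cases "u = v")
    case False
    with Cons.prems p have a: "adj u v" and f: "fsyl v w = Some g" and w: "wf w"
      by (auto split: if_splits)
    have V: "u \<in> V" "h \<in> carrier (G u)" "v \<in> V" "g \<in> carrier (G v)" "wf (remove_syl v w)"
      using Cons.prems(1) p wf_fsyl[OF w f] wf_remove_syl[OF w] by auto
    have "ev (p # w) = ev [(u, h)] \<otimes> ev ((v, g) # remove_syl v w)"
      using ev_Cons[of p w] Cons.IH[OF w f] Cons.prems p by simp
    also have "\<dots> = ev ([(u, h), (v, g)] @ remove_syl v w)"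
      using ev_append[of "[(u, h)]" "(v, g) # remove_syl v w"] V by simp
    also have "\<dots> = ev [(v, g), (u, h)] \<otimes> ev (remove_syl v w)"
      using ev_append[of "[(u, h), (v, g)]" "remove_syl v w"] ev_swap[OF V(1-4) a] V by simp
    also have "\<dots> = ev ((v, g) # (u, h) # remove_syl v w)"
      using ev_append[of "[(v, g), (u, h)]" "remove_syl v w"] V by simp
    finally show ?thesis using False p by simp
  qed (use Cons p in auto)
qed simp

lemma ev_teq: "wf a \<Longrightarrow> a \<simeq> b \<Longrightarrow> ev a = ev b"
proof (induction b arbitrary: a)
  case (Cons p b)
  obtain v g where p: "p = (v, g)" by (cases p)
  have f: "fsyl v a = Some g" using teq_fsyl[OF Cons.prems(2)] p by auto
  have "(v, g) # remove_syl v a \<simeq> (v, g) # b"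
    using teq_trans[OF teq_sym[OF teq_remove_syl[OF f]] Cons.prems(2)] p by simp
  then have d: "remove_syl v a \<simeq> b" by simp
  have w: "wf ((v, g) # remove_syl v a)" using wf_fsyl[OF Cons.prems(1) f] wf_remove_syl[OF Cons.prems(1)] by simp
  have w': "wf (p # b)" using teq_wf[OF Cons.prems(2)] Cons.prems(1) by simp
  have "ev a = ev [(v, g)] \<otimes> ev (remove_syl v a)" using ev_remove_syl[OF Cons.prems(1) f] ev_Cons[OF w] by simp
  also have "ev (remove_syl v a) = ev b" using Cons.IH[OF _ d] w by simp
  finally show ?case using ev_Cons[OF w'] p by simp
qed simp

text \<open>
  The normal form theorem for graph products.
\<close>
lemma reduced_unique:
  "wf a \<Longrightarrow> wf b \<Longrightarrow> reduced a \<Longrightarrow> reduced b \<Longrightarrow> ev a = ev b \<Longrightarrow> a \<simeq> b"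
  by (rule reduced_weq) (auto intro: weq_if_ev_eq)

lemma ev_links:
  assumes "links v x" "wf x" "v \<in> V" "g \<in> carrier (G v)"
  shows "ev x \<otimes> ev [(v, g)] = ev [(v, g)] \<otimes> ev x"
proof -
  have "x @ [(v, g)] \<simeq> [(v, g)] @ x"
    by (rule teq_append_commute) (use assms(1) in \<open>auto simp: links_def\<close>)
  from ev_teq[OF _ this] show ?thesis
    using assms ev_append[of x "[(v, g)]"] ev_append[of "[(v, g)]" x] by simp
qed

lemma ev_scons: "wf ((v, g) # w) \<Longrightarrow> ev (scons v g w) = ev [(v, g)] \<otimes> ev w"
  using ev_Cons[of "(v, g)" w] ev_one[of v] ev_closed[of w] by (auto simp: scons_def)

lemma ev_shorten:
  assumes "wf w" "\<not> reduced w"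
  shows "\<exists>w'. wf w' \<and> ev w' = ev w \<and> length w' < length w"
  using assms
proof (induction w)
  case (Cons p w)
  obtain v g where p: "p = (v, g)" by (cases p)
  have V: "v \<in> V" "g \<in> carrier (G v)" "wf w" using Cons.prems p by auto
  consider "g = \<one>\<^bsub>G v\<^esub>" | h where "fsyl v w = Some h" | "\<not> reduced w"
    using Cons.prems p by auto
  then show ?case
  proof cases
    case 1
    then show ?thesis using V p ev_Cons[of p w] ev_one[of v] ev_closed[of w] by (intro exI[of _ w]) simp
  next
    case 2
    have w: "wf (remove_syl v w)" "h \<in> carrier (G v)" using wf_remove_syl[OF V(3)] wf_fsyl[OF V(3) 2] by auto
    have "ev (p # w) = ev [(v, g)] \<otimes> (ev [(v, h)] \<otimes> ev (remove_syl v w))"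
      using ev_Cons[of p w] ev_Cons[of "(v, h)" "remove_syl v w"] ev_remove_syl[OF V(3) 2] V w p by simp
    also have "\<dots> = ev [(v, g \<otimes>\<^bsub>G v\<^esub> h)] \<otimes> ev (remove_syl v w)"
      using V w by (simp add: ev_mult[symmetric] ev_syl_closed ev_closed Q.m_assoc)
    also have "\<dots> = ev ((v, g \<otimes>\<^bsub>G v\<^esub> h) # remove_syl v w)"
      using ev_Cons[of "(v, g \<otimes>\<^bsub>G v\<^esub> h)" "remove_syl v w"] V w factor_closed by simp
    finally have "ev ((v, g \<otimes>\<^bsub>G v\<^esub> h) # remove_syl v w) = ev (p # w)" by simp
    moreover have "length ((v, g \<otimes>\<^bsub>G v\<^esub> h) # remove_syl v w) < length (p # w)"
      using teq_length[OF teq_remove_syl[OF 2]] by simp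
    ultimately show ?thesis using V w factor_closed by (intro exI[of _ "(v, g \<otimes>\<^bsub>G v\<^esub> h) # remove_syl v w"]) simp
  next
    case 3
    then obtain w' where w': "wf w'" "ev w' = ev w" "length w' < length w" using Cons.IH V by blast
    then show ?thesis using V p ev_Cons[of p w] ev_Cons[of p w'] by (intro exI[of _ "p # w'"]) simp
  qed
qed simp

lemma reduced_shortest:
  assumes "wf r" "wf w" "reduced r" "ev r = ev w" shows "length r \<le> length w"
  using assms(2,4)
proof (induction "length w" arbitrary: w rule: less_induct)
  case less
  show ?case
  proof (cases "reduced w")
    case True
    then show ?thesis using teq_length[OF reduced_unique[of r w]] assms less.prems by simp
  next
    case False
    then obtain w' where "wf w'" "ev w' = ev w" "length w' < length w" using ev_shorten less.prems by blast
    then show ?thesis using less.hyps[of w'] less.prems by simp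
  qed
qed

lemma reduced_if_shortest:
  assumes "wf r" "wf w" "reduced r" "ev r = ev w" "length w \<le> length r" shows "reduced w"
proof (rule ccontr)
  assume "\<not> reduced w"
  then obtain w' where "wf w'" "ev w' = ev w" "length w' < length w" using ev_shorten assms by blast
  then show False using reduced_shortest[of r w'] assms by simp
qed

text \<open>
  The vertices at which \<open>x @ c\<close> fails to be reduced, for reduced \<open>x\<close> and \<open>c\<close>.
\<close>
definition overlap :: "('v \<times> 'g) list \<Rightarrow> ('v \<times> 'g) list \<Rightarrow> 'v set" where
  "overlap x c = {v. lsyl v x \<noteq> None \<and> fsyl v c \<noteq> None}"

lemma overlap_subset: "wf c \<Longrightarrow> overlap x c \<subseteq> V"
  using wf_fsyl by (auto simp: overlap_def)

text \<open>
  Let \<open>v\<close> be an overlap, \<open>(v, g)\<close> the last syllable of \<open>x\<close> and \<open>(v, h)\<close> the first of \<open>c\<close>. If \<open>(v, g)\<close>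
  floats, then \<open>(v, h)\<close> can be taken off \<open>c\<close> at the cost of conjugating \<open>g\<close> by \<open>h\<close>. Otherwise \<open>(v, g)\<close>
  is rotated to the front of \<open>x\<close> and multiplied into \<open>c\<close>, which gets shorter if \<open>g h = 1\<close> and keeps
  its vertices if not; in the latter case \<open>v\<close> is no longer an overlap, because the rotated word does
  not end in \<open>v\<close>, and no new overlap arises. So the pair of the length of \<open>c\<close> and the number of
  overlaps decreases lexicographically.
\<close>
lemma absorb_overlap:
  assumes "wf x" "cyc_reduced x" "wf c" "reduced c" "wf y" "ev x \<otimes> ev c = ev c \<otimes> ev y"
  shows "\<exists>x1 c1. wf x1 \<and> wf c1 \<and> twisted_conj x x1 \<and> reduced (x1 @ c1) \<and> ev x1 \<otimes> ev c1 = ev c1 \<otimes> ev y"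
  using assms
proof (induction "length c * Suc (card V) + card (overlap x c)" arbitrary: x c rule: less_induct)
  case less
  note x = \<open>wf x\<close> \<open>cyc_reduced x\<close> and c = \<open>wf c\<close> \<open>reduced c\<close> and xc = \<open>ev x \<otimes> ev c = ev c \<otimes> ev y\<close>
  show ?case
  proof (cases "overlap x c = {}")
    case True
    then have "reduced (x @ c)" using x c by (auto simp: reduced_append cyc_reduced_def overlap_def)
    moreover have "twisted_conj x x" using x by (intro twisted_conjI_teq[of x "[]"]) auto
    ultimately show ?thesis using x c xc by blast
  next
    case False
    then obtain v g h where lx: "lsyl v x = Some g" and fc: "fsyl v c = Some h" by (auto simp: overlap_def)
    obtain c' where cc': "c \<simeq> (v, h) # c'" using fsyl_split[OF fc] by blast
    obtain x' where xx': "x \<simeq> x' @ [(v, g)]" using lsyl_split[OF lx] by blast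
    have wf: "wf ((v, h) # c')" "wf (x' @ [(v, g)])"
      using teq_wf[OF cc'] teq_wf[OF xx'] x c by auto
    then have V: "v \<in> V" "h \<in> carrier (G v)" "wf c'" "g \<in> carrier (G v)" "wf x'" by auto
    interpret Gv: group "G v" using group_factor V by simp
    have rc: "reduced ((v, h) # c')" using teq_reduced[OF cc'] c by simp
    have ev_c: "ev c = ev [(v, h)] \<otimes> ev c'" using ev_teq[OF c(1) cc'] ev_Cons[OF wf(1)] by simp
    have len_c: "length c = Suc (length c')" using teq_length[OF cc'] by simp
    have shorter: ?thesis
      if "wf x2" "cyc_reduced x2" "twisted_conj x x2" "wf c2" "reduced c2" "ev x2 \<otimes> ev c2 = ev c2 \<otimes> ev y"
        "length c2 < length c \<or> length c2 = length c \<and> overlap x2 c2 \<subset> overlap x c" for x2 c2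
    proof -
      have "length c2 * Suc (card V) + card (overlap x2 c2) < length c * Suc (card V) + card (overlap x c)"
        using that(7)
      proof
        assume "length c2 < length c"
        then have "Suc (length c2) * Suc (card V) \<le> length c * Suc (card V)" by (intro mult_le_mono1) simp
        moreover have "card (overlap x2 c2) \<le> card V" by (rule card_mono[OF finite_V overlap_subset[OF that(4)]])
        ultimately show ?thesis by simp
      next
        assume *: "length c2 = length c \<and> overlap x2 c2 \<subset> overlap x c"
        then have "card (overlap x2 c2) < card (overlap x c)"
          using finite_subset[OF overlap_subset[OF c(1)] finite_V] psubset_card_mono by blast
        then show ?thesis using * by simp
      qed
      from less.hyps[OF this that(1,2,4,5) \<open>wf y\<close> that(6)] obtain x1 c1
        where "wf x1" "wf c1" "twisted_conj x2 x1" "reduced (x1 @ c1)" "ev x1 \<otimes> ev c1 = ev c1 \<otimes> ev y" by blast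
      then show ?thesis using twisted_conj_trans[OF that(3)] x by blast
    qed
    note cl = ev_syl_closed[OF V(1,2)] ev_syl_closed[OF V(1,4)] ev_closed[OF V(3)] ev_closed[OF V(5)]
      ev_closed[OF \<open>wf y\<close>] ev_closed[OF c(1)] ev_closed[OF x(1)]
    \<comment> \<open>If \<open>v\<close> is not available at the front of \<open>x\<close>, the syllable is rotated; otherwise it floats.\<close>
    show ?thesis
    proof (cases "fsyl v x")
      case None
      define x2 where "x2 = (v, g) # x'"
      define c2 where "c2 = scons v (g \<otimes>\<^bsub>G v\<^esub> h) c'"
      have gh: "g \<otimes>\<^bsub>G v\<^esub> h \<in> carrier (G v)" using V by simp
      have ev_c2: "ev c2 = ev [(v, g)] \<otimes> ev c"
        using ev_scons[of v "g \<otimes>\<^bsub>G v\<^esub> h" c'] V gh cl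
        by (simp add: c2_def ev_c ev_mult[symmetric] Q.m_assoc)
      have ev_x: "ev x = ev x' \<otimes> ev [(v, g)]"
        using ev_teq[OF x(1) xx'] ev_append[of x' "[(v, g)]"] V by simp
      have ev_x2: "ev x2 = ev [(v, g)] \<otimes> ev x'"
        unfolding x2_def using V by (intro ev_Cons) simp
      have lc: "cyc_reduced (x' @ [(v, g)])" using teq_cyc_reduced[OF xx'] x by simp
      show ?thesis
      proof (rule shorter)
        show "wf x2" using V by (simp add: x2_def)
        show "cyc_reduced x2" unfolding x2_def by (rule cyc_reduced_rotate[OF lc])
        have "x' @ [(v, g)] @ x' \<simeq> x' @ x2" by (simp add: x2_def)
        moreover have "x @ x' \<simeq> (x' @ [(v, g)]) @ x'" by (rule teq_append[OF xx' teq_refl])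
        ultimately have "x @ x' \<simeq> x' @ x2" using teq_trans by fastforce
        then show "twisted_conj x x2" by (rule twisted_conjI_teq[OF x(1)])
        show "wf c2" unfolding c2_def using V gh by (intro wf_scons)
        show "reduced c2" unfolding c2_def using rc by (intro reduced_scons) auto
        have "ev x2 \<otimes> ev c2 = ev [(v, g)] \<otimes> (ev x \<otimes> ev c)"
          unfolding ev_x2 ev_c2 ev_x using cl by (simp add: Q.m_assoc)
        also have "\<dots> = ev c2 \<otimes> ev y" unfolding xc ev_c2 using cl by (simp add: Q.m_assoc)
        finally show "ev x2 \<otimes> ev c2 = ev c2 \<otimes> ev y" .
        show "length c2 < length c \<or> length c2 = length c \<and> overlap x2 c2 \<subset> overlap x c"
        proof (cases "g \<otimes>\<^bsub>G v\<^esub> h = \<one>\<^bsub>G v\<^esub>")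
          case True
          then show ?thesis using len_c by (simp add: c2_def scons_def)
        next
          case False
          then have c2: "c2 = (v, g \<otimes>\<^bsub>G v\<^esub> h) # c'" by (simp add: c2_def scons_def)
          have "v \<in> overlap x c" using lx fc by (simp add: overlap_def)
          moreover have "u \<noteq> v \<and> u \<in> overlap x c" if u: "u \<in> overlap x2 c2" for u
          proof -
            have l: "fsyl u (rev x' @ [(v, g)]) \<noteq> None" and f: "fsyl u ((v, g \<otimes>\<^bsub>G v\<^esub> h) # c') \<noteq> None"
              using u by (simp_all add: overlap_def x2_def c2)
            have "lsyl v x' = None \<or> fsyl v [(v, g)] = None"
              using lc unfolding cyc_reduced_def reduced_append by (elim conjE) (erule spec)
            then have "lsyl v x' = None" by simp
            moreover have "\<not> links v x'"
            proof
              assume "links v x'"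
              then have "fsyl v (x' @ [(v, g)]) = Some g" by (simp add: fsyl_append links_fsyl)
              then show False using None teq_fsyl[OF xx', of v] by simp
            qed
            ultimately have uv: "u \<noteq> v" using l by (auto simp: fsyl_snoc)
            then have a: "adj v u" and fu: "fsyl u c' \<noteq> None" using f by (auto split: if_splits)
            have "lsyl u x' \<noteq> None" using l uv by (auto simp: fsyl_snoc split: option.splits)
            then have "lsyl u (x' @ [(v, g)]) \<noteq> None" using a by simp
            then have "lsyl u x \<noteq> None" using teq_lsyl[OF xx', of u] by simp
            moreover have "fsyl u c \<noteq> None" using teq_fsyl[OF cc', of u] a fu uv by simp
            ultimately show ?thesis using uv by (simp add: overlap_def)
          qed
          ultimately show ?thesis using len_c c2 by auto
        qed
      qed
    next
      case (Some g0)
      have "\<not> two_ended v x" using x by (simp add: cyc_reduced_def)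
      from not_two_ended_split[OF this] Some lx obtain g' x' where x': "x \<simeq> (v, g') # x'" "links v x'" by auto
      have w': "wf ((v, g') # x')" using teq_wf[OF x'(1)] x by simp
      then have g': "g' \<in> carrier (G v)" "wf x'" by auto
      define g1 where "g1 = inv\<^bsub>G v\<^esub> h \<otimes>\<^bsub>G v\<^esub> g' \<otimes>\<^bsub>G v\<^esub> h"
      have g1: "g1 \<in> carrier (G v)" using g' V by (simp add: g1_def)
      have hg1: "h \<otimes>\<^bsub>G v\<^esub> g1 = g' \<otimes>\<^bsub>G v\<^esub> h" using g' V by (simp add: g1_def Gv.m_assoc[symmetric])
      define x2 where "x2 = (v, g1) # x'"
      have w2: "wf x2" using g1 g' V by (simp add: x2_def)
      have lx': "cyc_reduced ((v, g') # x')" using teq_cyc_reduced[OF x'(1)] x by simp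
      note cl' = ev_syl_closed[OF V(1) g'(1)] ev_syl_closed[OF V(1) g1] ev_closed[OF g'(2)]
      have ev_x: "ev x = ev [(v, g')] \<otimes> ev x'" using ev_teq[OF x(1) x'(1)] ev_Cons[OF w'] by simp
      have ev_x2: "ev x2 = ev [(v, g1)] \<otimes> ev x'" unfolding x2_def by (rule ev_Cons) (use w2 in \<open>simp add: x2_def\<close>)
      show ?thesis
      proof (rule shorter)
        show "wf x2" by (rule w2)
        have "g' \<noteq> \<one>\<^bsub>G v\<^esub>" using lx' by (simp add: cyc_reduced_def)
        moreover have "g' = h \<otimes>\<^bsub>G v\<^esub> g1 \<otimes>\<^bsub>G v\<^esub> inv\<^bsub>G v\<^esub> h"
          unfolding hg1 using g' V by (simp add: Gv.m_assoc)
        ultimately have "g1 \<noteq> \<one>\<^bsub>G v\<^esub>" using V by auto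
        moreover have "\<forall>(u, g) \<in> set x'. g \<noteq> \<one>\<^bsub>G u\<^esub>"
          using lx' reduced_nontrivial[of x'] by (auto simp: cyc_reduced_def)
        ultimately show "cyc_reduced x2" unfolding x2_def
          by (intro cyc_reduced_map_fst[OF _ _ lx']) auto
        have "twisted_conj ((v, g') # x') x2" unfolding x2_def g1_def
          by (rule twisted_conj_float[OF x'(2) V(1,2) w'])
        moreover have "twisted_conj x ((v, g') # x')" using x x'(1) by (intro twisted_conjI_teq[of x "[]"]) auto
        ultimately show "twisted_conj x x2" using twisted_conj_trans x by blast
        show "wf c'" by (rule V)
        show "reduced c'" using rc by simp
        have "ev [(v, h)] \<otimes> (ev x2 \<otimes> ev c') = (ev [(v, h)] \<otimes> ev [(v, g1)]) \<otimes> (ev x' \<otimes> ev c')"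
          unfolding ev_x2 using cl cl' by (simp add: Q.m_assoc)
        also have "ev [(v, h)] \<otimes> ev [(v, g1)] = ev [(v, g')] \<otimes> ev [(v, h)]"
          using V g1 g' hg1 by (simp add: ev_mult)
        also have "ev [(v, g')] \<otimes> ev [(v, h)] \<otimes> (ev x' \<otimes> ev c')
            = ev [(v, g')] \<otimes> (ev [(v, h)] \<otimes> ev x') \<otimes> ev c'"
          using cl cl' by (simp add: Q.m_assoc)
        also have "\<dots> = ev x \<otimes> ev c"
          unfolding ev_links[OF x'(2) g'(2) V(1,2), symmetric] ev_x ev_c using cl cl' by (simp add: Q.m_assoc)
        also have "\<dots> = ev [(v, h)] \<otimes> (ev c' \<otimes> ev y)"
          unfolding xc unfolding ev_c using cl by (simp add: Q.m_assoc)
        finally show "ev x2 \<otimes> ev c' = ev c' \<otimes> ev y"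
          using cl cl' ev_closed[OF w2] by (simp add: Q.m_closed)
        show "length c' < length c \<or> length c' = length c \<and> overlap x2 c' \<subset> overlap x c" using len_c by simp
      qed
    qed
  qed
qed

end

lemma (in group) inv_mult_cancel:
  assumes "x \<in> carrier G" "y \<in> carrier G"
  shows "x \<otimes> (inv x \<otimes> y) = y" "inv x \<otimes> (x \<otimes> y) = y"
  using assms by (simp_all add: m_assoc[symmetric])

context syllable_evaluation
begin

text \<open>
  Since \<open>x1 @ c1\<close> is reduced, it is not longer than \<open>c1 @ y\<close>, which represents the same element.
\<close>
lemma cyc_reduced_conjugate_length:
  assumes x: "wf x" "cyc_reduced x" and y: "wf y" and q: "q \<in> carrier Q" "ev x \<otimes> q = q \<otimes> ev y"
  obtains x1 c1 where "wf x1" "wf c1" "twisted_conj x x1" "reduced (x1 @ c1)"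
    "ev x1 \<otimes> ev c1 = ev c1 \<otimes> ev y" "length x \<le> length y"
proof -
  have "\<exists>c. wf c \<and> reduced c \<and> ev c = q"
  proof -
    have "\<exists>c. (wf c \<and> ev c = q) \<and> (\<forall>d. wf d \<and> ev d = q \<longrightarrow> length c \<le> length d)"
      using ev_surj[OF q(1)] ex_has_least_nat[of "\<lambda>c. wf c \<and> ev c = q" _ length] by blast
    then obtain c where c: "wf c" "ev c = q" "\<And>d. wf d \<Longrightarrow> ev d = q \<Longrightarrow> length c \<le> length d" by blast
    have "reduced c"
    proof (rule ccontr)
      assume "\<not> reduced c"
      from ev_shorten[OF c(1) this] c(2,3) show False by fastforce
    qed
    then show ?thesis using c by blast
  qed
  then obtain c where c: "wf c" "reduced c" "ev c = q" by blast
  have "ev x \<otimes> ev c = ev c \<otimes> ev y" using q c by simp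
  from absorb_overlap[OF x c(1,2) y this] obtain x1 c1 where 1: "wf x1" "wf c1" "twisted_conj x x1" "reduced (x1 @ c1)"
    "ev x1 \<otimes> ev c1 = ev c1 \<otimes> ev y" by blast
  have "length (x1 @ c1) \<le> length (c1 @ y)"
    using 1 y by (intro reduced_shortest) (simp_all add: ev_append)
  then have "length x \<le> length y" using twisted_conj_length[OF 1(3)] by simp
  then show ?thesis using that 1 by blast
qed

text \<open>
  By symmetry \<open>x\<close> and \<open>y\<close> have the same length. Then \<open>c1 @ y\<close> is as short as the reduced word
  \<open>x1 @ c1\<close>, hence reduced too, and the normal form theorem turns the conjugacy into an equation
  of traces.
\<close>
lemma cyc_reduced_conjugate_twisted_conj:
  assumes x: "wf x" "cyc_reduced x" and y: "wf y" "cyc_reduced y" and q: "q \<in> carrier Q" "ev x \<otimes> q = q \<otimes> ev y"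
  shows "twisted_conj x y"
proof -
  have "ev y \<otimes> inv q = inv q \<otimes> ev x"
  proof -
    have "ev y \<otimes> inv q = inv q \<otimes> (q \<otimes> ev y) \<otimes> inv q"
      using q y ev_closed by (simp add: Q.m_assoc[symmetric])
    also have "\<dots> = inv q \<otimes> ev x"
      unfolding q(2)[symmetric] using q(1) x ev_closed by (simp add: Q.m_assoc)
    finally show ?thesis .
  qed
  then have yx: "length y \<le> length x"
    using cyc_reduced_conjugate_length[OF y x(1) Q.inv_closed[OF q(1)]] by blast
  obtain x1 c1 where 1: "wf x1" "wf c1" "twisted_conj x x1" "reduced (x1 @ c1)"
    "ev x1 \<otimes> ev c1 = ev c1 \<otimes> ev y" "length x \<le> length y"
    using cyc_reduced_conjugate_length[OF x y(1) q] by blast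
  have e: "ev (x1 @ c1) = ev (c1 @ y)" using 1 y by (simp add: ev_append)
  have "reduced (c1 @ y)"
    by (rule reduced_if_shortest[OF _ _ 1(4) e]) (use 1 y yx twisted_conj_length[OF 1(3)] in simp_all)
  then have "x1 @ c1 \<simeq> c1 @ y" using 1 y e by (intro reduced_unique) simp_all
  then have "twisted_conj x1 y" by (rule twisted_conjI_teq[OF 1(1)])
  then show ?thesis using twisted_conj_trans[OF 1(3)] x by blast
qed

end

section \<open>Short conjugators in the graph product\<close>

text \<open>
  The weight of a syllable stands for the word length in its vertex-group; the last assumption is
  the linear bound on conjugators in all vertex-groups.
\<close>
locale weighted_evaluation = syllable_evaluation adj V G Q ev
  for adj :: "'v \<Rightarrow> 'v \<Rightarrow> bool" and V :: "'v set" and G :: "'v \<Rightarrow> ('g, 'm) monoid_scheme"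
    and Q :: "('q, 'n) monoid_scheme" (structure) and ev :: "('v \<times> 'g) list \<Rightarrow> 'q" +
  fixes f :: "'v \<times> 'g \<Rightarrow> nat" and K :: nat
  assumes f_mult: "v \<in> V \<Longrightarrow> g \<in> carrier (G v) \<Longrightarrow> h \<in> carrier (G v) \<Longrightarrow>
      f (v, g \<otimes>\<^bsub>G v\<^esub> h) \<le> f (v, g) + f (v, h)"
    and f_inv: "v \<in> V \<Longrightarrow> g \<in> carrier (G v) \<Longrightarrow> f (v, inv\<^bsub>G v\<^esub> g) = f (v, g)"
    and f_conj: "v \<in> V \<Longrightarrow> g \<in> carrier (G v) \<Longrightarrow> k \<in> carrier (G v) \<Longrightarrow>
      \<exists>l\<in>carrier (G v). inv\<^bsub>G v\<^esub> l \<otimes>\<^bsub>G v\<^esub> g \<otimes>\<^bsub>G v\<^esub> l = inv\<^bsub>G v\<^esub> k \<otimes>\<^bsub>G v\<^esub> g \<otimes>\<^bsub>G v\<^esub> k \<and>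
        f (v, l) \<le> K * (f (v, g) + f (v, inv\<^bsub>G v\<^esub> k \<otimes>\<^bsub>G v\<^esub> g \<otimes>\<^bsub>G v\<^esub> k))"
begin

abbreviation wt :: "('v \<times> 'g) list \<Rightarrow> nat" where "wt \<equiv> weight f"

lemma wt_teq: "a \<simeq> b \<Longrightarrow> wt a = wt b"
  by (rule weight_mset[OF teq_mset])

lemma reduced_form:
  assumes "wf w" shows "\<exists>r. wf r \<and> reduced r \<and> ev r = ev w \<and> wt r \<le> wt w"
  using assms
proof (induction w)
  case Nil
  show ?case by (intro exI[of _ "[]"]) simp
next
  case (Cons p w)
  obtain v g where p: "p = (v, g)" by (cases p)
  have V: "v \<in> V" "g \<in> carrier (G v)" "wf w" using Cons.prems p by auto
  obtain r where r: "wf r" "reduced r" "ev r = ev w" "wt r \<le> wt w" using Cons.IH V by blast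
  have ev_list_pow: "ev (p # w) = ev [(v, g)] \<otimes> ev r" using ev_Cons[of p w] Cons.prems p r by simp
  show ?case
  proof (cases "fsyl v r")
    case None
    have "wt (scons v g r) \<le> wt (p # w)" using r p by (simp add: scons_def)
    then show ?thesis using ev_scons[of v g r] V r reduced_scons[OF r(2) None] ev_list_pow
      by (intro exI[of _ "scons v g r"]) (simp add: wf_scons)
  next
    case (Some h)
    let ?d = "remove_syl v r"
    have d: "wf ?d" "h \<in> carrier (G v)" "reduced ?d" "fsyl v ?d = None"
      using wf_remove_syl[OF r(1)] wf_fsyl[OF r(1) Some] reduced_remove_syl[OF r(2) Some] by auto
    have gh: "g \<otimes>\<^bsub>G v\<^esub> h \<in> carrier (G v)" using V d factor_closed by blast
    have "wt r = f (v, h) + wt ?d" using wt_teq[OF teq_remove_syl[OF Some]] by simp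
    then have "wt (scons v (g \<otimes>\<^bsub>G v\<^esub> h) ?d) \<le> wt (p # w)"
      using f_mult[OF V(1,2) d(2)] r(4) p by (simp add: scons_def)
    moreover have "ev (scons v (g \<otimes>\<^bsub>G v\<^esub> h) ?d) = ev (p # w)"
    proof -
      have "ev (scons v (g \<otimes>\<^bsub>G v\<^esub> h) ?d) = ev [(v, g)] \<otimes> (ev [(v, h)] \<otimes> ev ?d)"
        using ev_scons[of v "g \<otimes>\<^bsub>G v\<^esub> h" ?d] V d gh
        by (simp add: ev_mult[symmetric] ev_syl_closed ev_closed Q.m_assoc)
      also have "ev [(v, h)] \<otimes> ev ?d = ev r"
        using ev_remove_syl[OF r(1) Some] ev_Cons[of "(v, h)" ?d] V d by simp
      finally show ?thesis using ev_list_pow by simp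
    qed
    ultimately show ?thesis using V d gh
      by (intro exI[of _ "scons v (g \<otimes>\<^bsub>G v\<^esub> h) ?d"]) (simp add: wf_scons reduced_scons)
  qed
qed

lemma ev_conj_first_syllable:
  assumes "wf ((v, g) # m @ [(v, h)])"
  shows "ev ((v, g) # m @ [(v, h)]) \<otimes> ev [(v, g)] = ev [(v, g)] \<otimes> (ev m \<otimes> ev [(v, h \<otimes>\<^bsub>G v\<^esub> g)])"
proof -
  have V: "v \<in> V" "g \<in> carrier (G v)" "h \<in> carrier (G v)" "wf m" using assms by auto
  have "ev ((v, g) # m @ [(v, h)]) = ev [(v, g)] \<otimes> (ev m \<otimes> ev [(v, h)])"
    using ev_Cons[OF assms] ev_append[of m "[(v, h)]"] V by simp
  then show ?thesis using V
    by (simp add: ev_mult[symmetric] ev_syl_closed ev_closed Q.m_assoc)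
qed

lemma fsyl_snoc_other: "u \<noteq> v \<Longrightarrow> fsyl u (m @ [(v, h)]) = fsyl u m"
  by (auto simp: fsyl_snoc split: option.splits)

text \<open>
  A two-ended vertex \<open>v\<close> is repaired by conjugating with its first syllable, which merges with
  the last one. If the two never cancel, the other two-ended vertices were two-ended with
  the same syllables before, so at most one conjugation per vertex is needed, each by a syllable of a
  word of weight at most that of \<open>a\<close>.
\<close>
lemma merge_reduction:
  assumes "wf a" "reduced a"
    and "\<forall>v g h. two_ended v a \<longrightarrow> fsyl v a = Some g \<longrightarrow> lsyl v a = Some h \<longrightarrow> h \<otimes>\<^bsub>G v\<^esub> g \<noteq> \<one>\<^bsub>G v\<^esub>"
  shows "\<exists>h x. wf h \<and> wf x \<and> cyc_reduced x \<and> ev a \<otimes> ev h = ev h \<otimes> ev x \<and> wt x \<le> wt a \<and>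
    wt h \<le> card {v. two_ended v a} * wt a"
  using assms
proof (induction "card {v. two_ended v a}" arbitrary: a rule: less_induct)
  case less
  have sub: "{v. two_ended v w} \<subseteq> V" if "wf w" for w using wf_fsyl[OF that] by (auto simp: two_ended_def)
  show ?case
  proof (cases "\<exists>v. two_ended v a")
    case False
    then have "cyc_reduced a" using less.prems by (simp add: cyc_reduced_def)
    moreover have "ev a \<otimes> ev [] = ev [] \<otimes> ev a" using less.prems ev_closed[of a] by simp
    moreover have "wf []" "wt [] \<le> card {v. two_ended v a} * wt a" by simp_all
    ultimately show ?thesis using less.prems(1) by blast
  next
    case True
    then obtain v g h where b: "two_ended v a" "fsyl v a = Some g" "lsyl v a = Some h" by (auto simp: two_ended_def)
    have hg: "h \<otimes>\<^bsub>G v\<^esub> g \<noteq> \<one>\<^bsub>G v\<^esub>" using less.prems b by blast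
    obtain m where m: "a \<simeq> (v, g) # m @ [(v, h)]" using two_ended_split[OF b] .
    have w: "wf ((v, g) # m @ [(v, h)])" using teq_wf[OF m] less.prems by simp
    then have V: "v \<in> V" "g \<in> carrier (G v)" "h \<in> carrier (G v)" "wf m" by auto
    have r: "reduced ((v, g) # m @ [(v, h)])" using teq_reduced[OF m] less.prems by simp
    define a' where "a' = m @ [(v, h \<otimes>\<^bsub>G v\<^esub> g)]"
    have wa': "wf a'" using V factor_closed by (simp add: a'_def)
    have ra': "reduced a'"
    proof (rule reduced_map_fst)
      show "map fst (m @ [(v, h)]) = map fst a'" by (simp add: a'_def)
      show "reduced (m @ [(v, h)])" using r by simp
      show "\<forall>(u, k) \<in> set a'. k \<noteq> \<one>\<^bsub>G u\<^esub>"
        using hg reduced_nontrivial[of "m @ [(v, h)]"] r by (auto simp: a'_def)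
    qed
    have *: "u \<noteq> v \<and> two_ended u a \<and> fsyl u a = fsyl u a' \<and> lsyl u a = lsyl u a'" if u: "two_ended u a'" for u
    proof -
      have uv: "u \<noteq> v"
      proof
        assume "u = v"
        then have "fsyl v a' \<noteq> None" using u by (simp add: two_ended_def)
        moreover have "fsyl v (m @ [(v, h)]) = None" using r by simp
        ultimately show False using fsyl_None_map_fst[of "m @ [(v, h)]" a' v] by (simp add: a'_def)
      qed
      have "lsyl u a' \<noteq> None" using u by (simp add: two_ended_def)
      then have vu: "adj v u" using uv by (auto simp: a'_def split: if_splits)
      have 1: "fsyl u a = fsyl u a'"
        using teq_fsyl[OF m, of u] uv vu by (simp add: a'_def fsyl_snoc_other)
      have 2: "lsyl u a = lsyl u a'"
        using teq_lsyl[OF m, of u] uv vu by (simp add: a'_def fsyl_snoc_other)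
      have "occ u a = occ u a'" using teq_occ[OF m, of u] uv by (simp add: a'_def)
      then show ?thesis using 1 2 uv u by (simp add: two_ended_def)
    qed
    have less': "card {u. two_ended u a'} < card {u. two_ended u a}"
    proof (rule psubset_card_mono)
      show "finite {u. two_ended u a}" using sub[OF less.prems(1)] finite_V by (rule finite_subset)
      show "{u. two_ended u a'} \<subset> {u. two_ended u a}" using * b(1) by blast
    qed
    have ne: "\<forall>u k l. two_ended u a' \<longrightarrow> fsyl u a' = Some k \<longrightarrow> lsyl u a' = Some l \<longrightarrow> l \<otimes>\<^bsub>G u\<^esub> k \<noteq> \<one>\<^bsub>G u\<^esub>"
      using * less.prems(3) by metis
    from less.hyps[OF less' wa' ra' ne] obtain h' x where
      h': "wf h'" "wf x" "cyc_reduced x" "ev a' \<otimes> ev h' = ev h' \<otimes> ev x" "wt x \<le> wt a'"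
      "wt h' \<le> card {u. two_ended u a'} * wt a'" by blast
    have wta: "wt a = f (v, g) + wt m + f (v, h)" using wt_teq[OF m] by simp
    have wta': "wt a' \<le> wt a" using wta f_mult[OF V(1,3,2)] by (simp add: a'_def)
    have "ev a \<otimes> ev ((v, g) # h') = ev a \<otimes> ev [(v, g)] \<otimes> ev h'"
      using ev_Cons[of "(v, g)" h'] V h' less.prems by (simp add: ev_closed Q.m_assoc)
    also have "ev a \<otimes> ev [(v, g)] = ev [(v, g)] \<otimes> ev a'"
      using ev_teq[OF less.prems(1) m] ev_conj_first_syllable[OF w] ev_append[of m "[(v, h \<otimes>\<^bsub>G v\<^esub> g)]"] V factor_closed
      by (simp add: a'_def)
    also have "ev [(v, g)] \<otimes> ev a' \<otimes> ev h' = ev [(v, g)] \<otimes> (ev h' \<otimes> ev x)"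
      unfolding h'(4)[symmetric] using V wa' h' by (simp add: ev_closed Q.m_assoc)
    also have "\<dots> = ev ((v, g) # h') \<otimes> ev x"
      using ev_Cons[of "(v, g)" h'] V h' by (simp add: ev_closed Q.m_assoc)
    finally have "ev a \<otimes> ev ((v, g) # h') = ev ((v, g) # h') \<otimes> ev x" .
    moreover have "wt ((v, g) # h') \<le> card {u. two_ended u a} * wt a"
    proof -
      have "wt ((v, g) # h') \<le> wt a + card {u. two_ended u a'} * wt a"
        using h'(6) mult_le_mono2[OF wta', of "card {u. two_ended u a'}"] wta unfolding weight_simps by linarith
      also have "\<dots> = Suc (card {u. two_ended u a'}) * wt a" by simp
      also have "\<dots> \<le> card {u. two_ended u a} * wt a" using less' by (intro mult_le_mono1) simp
      finally show ?thesis .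
    qed
    moreover have "wf ((v, g) # h')" "wt x \<le> wt a" using h' V wta' by auto
    ultimately show ?thesis using h'(2,3) by blast
  qed
qed

text \<open>
  A first and a last syllable that cancel are removed first: this lowers the weight by
  the weight of both, which pays for the conjugating syllable. Only afterwards are the remaining
  two-ended vertices merged, where the weight need not drop but their number does.
\<close>
lemma cyclic_reduction:
  assumes "wf a" "reduced a"
  shows "\<exists>h x. wf h \<and> wf x \<and> cyc_reduced x \<and> ev a \<otimes> ev h = ev h \<otimes> ev x \<and> wt x \<le> wt a \<and>
    wt h \<le> Suc (card V) * wt a"
  using assms
proof (induction "length a" arbitrary: a rule: less_induct)
  case less
  show ?case
  proof (cases "\<forall>v g h. two_ended v a \<longrightarrow> fsyl v a = Some g \<longrightarrow> lsyl v a = Some h \<longrightarrow> h \<otimes>\<^bsub>G v\<^esub> g \<noteq> \<one>\<^bsub>G v\<^esub>")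
    case True
    have "{v. two_ended v a} \<subseteq> V" using wf_fsyl[OF less.prems(1)] by (auto simp: two_ended_def)
    then have "card {v. two_ended v a} \<le> Suc (card V)" using card_mono[OF finite_V] le_SucI by blast
    then have "card {v. two_ended v a} * wt a \<le> Suc (card V) * wt a" by (rule mult_le_mono1)
    then show ?thesis using merge_reduction[OF less.prems True] order_trans by meson
  next
    case False
    then obtain v g h where b: "two_ended v a" "fsyl v a = Some g" "lsyl v a = Some h"
      and hg: "h \<otimes>\<^bsub>G v\<^esub> g = \<one>\<^bsub>G v\<^esub>" by blast
    obtain m where m: "a \<simeq> (v, g) # m @ [(v, h)]" using two_ended_split[OF b] .
    have w: "wf ((v, g) # m @ [(v, h)])" using teq_wf[OF m] less.prems by simp
    then have V: "v \<in> V" "g \<in> carrier (G v)" "h \<in> carrier (G v)" "wf m" by auto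
    have r: "reduced m" using teq_reduced[OF m] less.prems by (simp add: reduced_append)
    have "length m < length a" using teq_length[OF m] by simp
    from less.hyps[OF this V(4) r] obtain h' x where
      h': "wf h'" "wf x" "cyc_reduced x" "ev m \<otimes> ev h' = ev h' \<otimes> ev x" "wt x \<le> wt m"
      "wt h' \<le> Suc (card V) * wt m" by blast
    have wta: "wt a = f (v, g) + wt m + f (v, h)" using wt_teq[OF m] by simp
    have "ev a \<otimes> ev ((v, g) # h') = ev a \<otimes> ev [(v, g)] \<otimes> ev h'"
      using ev_Cons[of "(v, g)" h'] V h' less.prems by (simp add: ev_closed Q.m_assoc)
    also have "ev a \<otimes> ev [(v, g)] = ev [(v, g)] \<otimes> ev m"
      using ev_teq[OF less.prems(1) m] ev_conj_first_syllable[OF w] V hg by (simp add: ev_one ev_closed)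
    also have "ev [(v, g)] \<otimes> ev m \<otimes> ev h' = ev [(v, g)] \<otimes> (ev h' \<otimes> ev x)"
      unfolding h'(4)[symmetric] using V h' by (simp add: ev_closed Q.m_assoc)
    also have "\<dots> = ev ((v, g) # h') \<otimes> ev x"
      using ev_Cons[of "(v, g)" h'] V h' by (simp add: ev_closed Q.m_assoc)
    finally have "ev a \<otimes> ev ((v, g) # h') = ev ((v, g) # h') \<otimes> ev x" .
    moreover have "wt ((v, g) # h') \<le> Suc (card V) * wt a"
      using h'(6) unfolding wta by (simp add: algebra_simps)
    moreover have "wf ((v, g) # h')" "wt x \<le> wt a" using h' V wta by auto
    ultimately show ?thesis using h'(2,3) by blast
  qed
qed

lemma ev_twist_single:
  assumes "wf x" "floats v x" "v \<in> V" "l \<in> carrier (G v)"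
  shows "ev x \<otimes> ev [(v, l)] = ev [(v, l)] \<otimes> ev (twist (\<lambda>u. if u = v then l else \<one>\<^bsub>G u\<^esub>) x)"
proof -
  let ?k = "\<lambda>u. if u = v then l else \<one>\<^bsub>G u\<^esub>"
  interpret Gv: group "G v" using group_factor assms by simp
  obtain g x' where x: "x \<simeq> (v, g) # x'" "links v x'" using floats_split[OF assms(2)] .
  have w: "wf ((v, g) # x')" using teq_wf[OF x(1)] assms by simp
  then have V: "g \<in> carrier (G v)" "wf x'" by auto
  have "(v, a) \<notin> set x'" for a using x(2) by (auto simp: links_def)
  then have twist': "twist ?k x' = x'" using V by (intro twist_trivial) auto
  define g1 where "g1 = inv\<^bsub>G v\<^esub> l \<otimes>\<^bsub>G v\<^esub> g \<otimes>\<^bsub>G v\<^esub> l"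
  have g1: "g1 \<in> carrier (G v)" using V assms by (simp add: g1_def)
  have lg1: "l \<otimes>\<^bsub>G v\<^esub> g1 = g \<otimes>\<^bsub>G v\<^esub> l" using V assms by (simp add: g1_def Gv.m_assoc[symmetric])
  have k: "\<forall>u\<in>V. ?k u \<in> carrier (G u)" using assms factor_closed by simp
  have "twist ?k x \<simeq> (v, g1) # x'" using twist_teq[OF x(1), of ?k] twist' by (simp add: g1_def)
  then have e: "ev (twist ?k x) = ev [(v, g1)] \<otimes> ev x'"
    using ev_teq[OF wf_twist[OF k assms(1)]] ev_Cons[of "(v, g1)" x'] V g1 assms by simp
  note cl = ev_syl_closed[OF assms(3)] ev_closed[OF V(2)]
  have "ev x \<otimes> ev [(v, l)] = ev [(v, g)] \<otimes> (ev x' \<otimes> ev [(v, l)])"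
    using ev_teq[OF assms(1) x(1)] ev_Cons[OF w] cl V assms by (simp add: Q.m_assoc)
  also have "\<dots> = ev [(v, g)] \<otimes> ev [(v, l)] \<otimes> ev x'"
    unfolding ev_links[OF x(2) V(2) assms(3,4)] using cl V assms by (simp add: Q.m_assoc)
  also have "ev [(v, g)] \<otimes> ev [(v, l)] = ev [(v, l)] \<otimes> ev [(v, g1)]"
    using V g1 assms lg1 by (simp add: ev_mult)
  finally show ?thesis unfolding e using cl V g1 assms by (simp add: Q.m_assoc)
qed

text \<open>
  Floating vertices are pairwise adjacent and can be twisted one after the other.
\<close>
lemma ev_twist:
  assumes "wf x" "\<forall>v\<in>V. l v \<in> carrier (G v)" "finite A" "A \<subseteq> {v \<in> V. floats v x}"
  shows "\<exists>c. wf c \<and> wt c = (\<Sum>v\<in>A. f (v, l v)) \<and>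
    ev x \<otimes> ev c = ev c \<otimes> ev (twist (\<lambda>v. if v \<in> A then l v else \<one>\<^bsub>G v\<^esub>) x)"
  using assms(3,4)
proof (induction A)
  case empty
  have "twist (\<lambda>v. if v \<in> {} then l v else \<one>\<^bsub>G v\<^esub>) x = x" by (rule twist_trivial) (use assms in auto)
  then show ?case using assms by (intro exI[of _ "[]"]) (simp add: ev_closed)
next
  case (insert v A)
  let ?k = "\<lambda>A v. if v \<in> A then l v else \<one>\<^bsub>G v\<^esub>"
  obtain c where c: "wf c" "wt c = (\<Sum>v\<in>A. f (v, l v))" "ev x \<otimes> ev c = ev c \<otimes> ev (twist (?k A) x)"
    using insert by blast
  have k: "\<forall>u\<in>V. ?k A u \<in> carrier (G u)" using assms factor_closed by simp
  let ?s = "\<lambda>u. if u = v then l v else \<one>\<^bsub>G u\<^esub>"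
  have V: "v \<in> V" "l v \<in> carrier (G v)" "floats v x" using insert.prems assms by auto
  have s: "\<forall>u\<in>V. ?s u \<in> carrier (G u)" using V factor_closed by simp
  have wx: "wf (twist (?k A) x)" using wf_twist[OF k assms(1)] .
  have "floats v (twist (?k A) x) = floats v x" by (rule floats_occ_cong) (rule twist_occ)
  then have fl: "floats v (twist (?k A) x)" using V by simp
  have "twist ?s (twist (?k A) x) = twist (\<lambda>u. ?k A u \<otimes>\<^bsub>G u\<^esub> ?s u) x" by (rule twist_twist[OF k s assms(1)])
  also have "\<dots> = twist (?k (insert v A)) x"
  proof -
    have "?k A u \<otimes>\<^bsub>G u\<^esub> ?s u = ?k (insert v A) u" if "u \<in> V" for u
    proof -
      interpret group "G u" using group_factor that by simp
      have lu: "l u \<in> carrier (G u)" using assms(2) that by blast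
      show ?thesis
      proof (cases "u = v")
        case True
        then have "?k A u = \<one>\<^bsub>G u\<^esub>" "?s u = l u" "?k (insert v A) u = l u" using insert.hyps by simp_all
        then show ?thesis using lu by (simp only: l_one)
      next
        case False
        then show ?thesis using lu by (cases "u \<in> A") simp_all
      qed
    qed
    then show ?thesis using assms(1) unfolding twist_def by (auto simp: wf_iff)
  qed
  finally have twist: "twist ?s (twist (?k A) x) = twist (?k (insert v A)) x" .
  have wx': "wf (twist (?k (insert v A)) x)" unfolding twist[symmetric] by (rule wf_twist[OF s wx])
  note cl = ev_closed[OF c(1)] ev_closed[OF assms(1)] ev_closed[OF wx] ev_closed[OF wx'] ev_syl_closed[OF V(1,2)]
  have app: "ev (c @ [(v, l v)]) = ev c \<otimes> ev [(v, l v)]" using c V by (intro ev_append) auto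
  have "ev x \<otimes> ev (c @ [(v, l v)]) = (ev x \<otimes> ev c) \<otimes> ev [(v, l v)]"
    unfolding app using cl by (simp add: Q.m_assoc)
  also have "\<dots> = ev c \<otimes> (ev (twist (?k A) x) \<otimes> ev [(v, l v)])"
    unfolding c(3) using cl by (simp add: Q.m_assoc)
  also have "ev (twist (?k A) x) \<otimes> ev [(v, l v)] = ev [(v, l v)] \<otimes> ev (twist (?k (insert v A)) x)"
    using ev_twist_single[OF wx fl V(1,2)] unfolding twist .
  also have "ev c \<otimes> (ev [(v, l v)] \<otimes> ev (twist (?k (insert v A)) x))
      = ev (c @ [(v, l v)]) \<otimes> ev (twist (?k (insert v A)) x)"
    unfolding app using cl by (simp add: Q.m_assoc)
  finally show ?case using c V insert.hyps by (intro exI[of _ "c @ [(v, l v)]"]) simp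
qed

lemma in_set_weight: "p \<in> set w \<Longrightarrow> f p \<le> wt w"
  by (induction w) auto

text \<open>
  The twist may be replaced by one with short conjugators, because it acts on a floating vertex
  through a single syllable. The weight of the twisted word equals the weight of \<open>y\<close>, as conjugate
  traces have the same syllables.
\<close>
lemma short_twisted_conj:
  assumes "wf x" "wf y" "twisted_conj x y"
  shows "\<exists>c. wf c \<and> ev x \<otimes> ev c = ev c \<otimes> ev y \<and> wt c \<le> K * (wt x + wt y) + Suc (card V) * wt y"
proof -
  obtain k d where k: "\<forall>v\<in>V. k v \<in> carrier (G v)" "\<forall>v\<in>V. k v \<noteq> \<one>\<^bsub>G v\<^esub> \<longrightarrow> floats v x"
    and d: "twist k x @ d \<simeq> d @ y" using assms(3) by (auto simp: twisted_conj_def)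
  define A where "A = {v \<in> V. floats v x}"
  have finA: "finite A" using finite_V by (simp add: A_def)
  let ?x = "twist k x"
  have "\<exists>l\<in>carrier (G v). (\<forall>g. (v, g) \<in> set x \<longrightarrow>
        inv\<^bsub>G v\<^esub> l \<otimes>\<^bsub>G v\<^esub> g \<otimes>\<^bsub>G v\<^esub> l = inv\<^bsub>G v\<^esub> k v \<otimes>\<^bsub>G v\<^esub> g \<otimes>\<^bsub>G v\<^esub> k v) \<and>
      (v \<in> A \<longrightarrow> f (v, l) \<le> K * (wt (proj v v x) + wt (proj v v ?x)))"
    if v: "v \<in> V" for v
  proof (cases "v \<in> A")
    case False
    then show ?thesis using k v by auto
  next
    case True
    then have fl: "floats v x" by (simp add: A_def)
    obtain g x' where x: "x \<simeq> (v, g) # x'" "links v x'" using floats_split[OF fl] .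
    have gx: "(v, g) \<in> set x" using teq_set[OF x(1)] by simp
    have only: "h = g" if "(v, h) \<in> set x" for h
      using that teq_set[OF x(1)] x(2) by (auto simp: links_def)
    have g: "g \<in> carrier (G v)" using gx assms(1) by (auto simp: wf_iff)
    let ?g' = "inv\<^bsub>G v\<^esub> k v \<otimes>\<^bsub>G v\<^esub> g \<otimes>\<^bsub>G v\<^esub> k v"
    obtain l where l: "l \<in> carrier (G v)" "inv\<^bsub>G v\<^esub> l \<otimes>\<^bsub>G v\<^esub> g \<otimes>\<^bsub>G v\<^esub> l = ?g'"
      "f (v, l) \<le> K * (f (v, g) + f (v, ?g'))"
      using f_conj[OF v g] k v by blast
    have "(v, ?g') \<in> set ?x" using gx by (force simp: twist_def)
    then have "f (v, ?g') \<le> wt (proj v v ?x)" by (intro in_set_weight) (simp add: proj_def)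
    moreover have "f (v, g) \<le> wt (proj v v x)" using gx by (intro in_set_weight) (simp add: proj_def)
    ultimately have "K * (f (v, g) + f (v, ?g')) \<le> K * (wt (proj v v x) + wt (proj v v ?x))"
      by (intro mult_le_mono2 add_mono)
    then have "f (v, l) \<le> K * (wt (proj v v x) + wt (proj v v ?x))" using l(3) by linarith
    then show ?thesis using l(1,2) only by blast
  qed
  then obtain l where l: "\<forall>v\<in>V. l v \<in> carrier (G v)"
    and eq: "\<forall>v\<in>V. \<forall>g. (v, g) \<in> set x \<longrightarrow>
        inv\<^bsub>G v\<^esub> l v \<otimes>\<^bsub>G v\<^esub> g \<otimes>\<^bsub>G v\<^esub> l v = inv\<^bsub>G v\<^esub> k v \<otimes>\<^bsub>G v\<^esub> g \<otimes>\<^bsub>G v\<^esub> k v"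
    and bound: "\<forall>v\<in>V. v \<in> A \<longrightarrow> f (v, l v) \<le> K * (wt (proj v v x) + wt (proj v v ?x))"
    by metis
  have "twist (\<lambda>v. if v \<in> A then l v else \<one>\<^bsub>G v\<^esub>) x = ?x"
    unfolding twist_def
  proof (rule map_cong[OF HOL.refl])
    fix p assume px: "p \<in> set x"
    obtain v g where p: "p = (v, g)" by (cases p)
    with px have vg: "(v, g) \<in> set x" by simp
    then have v: "v \<in> V" using assms(1) by (auto simp: wf_iff)
    show "(case p of (v, g) \<Rightarrow> (v, inv\<^bsub>G v\<^esub> (if v \<in> A then l v else \<one>\<^bsub>G v\<^esub>) \<otimes>\<^bsub>G v\<^esub> g
          \<otimes>\<^bsub>G v\<^esub> (if v \<in> A then l v else \<one>\<^bsub>G v\<^esub>)))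
        = (case p of (v, g) \<Rightarrow> (v, inv\<^bsub>G v\<^esub> k v \<otimes>\<^bsub>G v\<^esub> g \<otimes>\<^bsub>G v\<^esub> k v))"
    proof (cases "v \<in> A")
      case False
      then have "k v = \<one>\<^bsub>G v\<^esub>" using k(2) v by (auto simp: A_def)
      then show ?thesis using False p by simp
    qed (use eq v vg p in simp)
  qed
  then obtain c where c: "wf c" "wt c = (\<Sum>v\<in>A. f (v, l v))" "ev x \<otimes> ev c = ev c \<otimes> ev ?x"
    using ev_twist[OF assms(1) l finA] by (auto simp: A_def)
  have wx: "wf ?x" by (rule wf_twist[OF k(1) assms(1)])
  have fstV: "fst ` set w \<subseteq> V" if "wf w" for w using that by (auto simp: wf_iff)
  have "wt c \<le> (\<Sum>v\<in>A. K * (wt (proj v v x) + wt (proj v v ?x)))"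
    unfolding c(2) by (rule sum_mono) (use bound in \<open>auto simp: A_def\<close>)
  also have "\<dots> \<le> (\<Sum>v\<in>V. K * (wt (proj v v x) + wt (proj v v ?x)))"
    by (rule sum_mono2[OF finite_V]) (auto simp: A_def)
  also have "\<dots> = K * (wt x + wt ?x)"
    unfolding weight_by_vertex[OF finite_V fstV[OF assms(1)], of f] weight_by_vertex[OF finite_V fstV[OF wx], of f]
    by (simp only: sum_distrib_left[symmetric] sum.distrib)
  also have "wt ?x = wt y" using wt_teq[OF d] by simp
  finally have wc: "wt c \<le> K * (wt x + wt y)" .
  obtain e where e: "?x @ e \<simeq> e @ y" "set e \<subseteq> set ?x" "wt e \<le> Suc (card (fst ` set ?x)) * wt ?x"
    using short_trace_conjugator[OF d, of f] .
  have we: "wf e" using e(2) wx by (auto simp: wf_iff)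
  have "card (fst ` set ?x) \<le> card V" by (rule card_mono[OF finite_V fstV[OF wx]])
  then have "Suc (card (fst ` set ?x)) * wt ?x \<le> Suc (card V) * wt ?x" by (intro mult_le_mono1) simp
  then have we': "wt e \<le> Suc (card V) * wt y" using order_trans[OF e(3)] unfolding \<open>wt ?x = wt y\<close> by blast
  have xe: "ev ?x \<otimes> ev e = ev e \<otimes> ev y"
    using ev_teq[OF _ e(1)] wx we assms(2) by (simp add: ev_append)
  have "ev x \<otimes> ev (c @ e) = ev x \<otimes> ev c \<otimes> ev e"
    using c(1) we assms(1) by (simp add: ev_append ev_closed Q.m_assoc)
  also have "\<dots> = ev c \<otimes> (ev ?x \<otimes> ev e)"
    unfolding c(3) using c wx we by (simp add: ev_closed Q.m_assoc)
  also have "\<dots> = ev (c @ e) \<otimes> ev y"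
    unfolding xe using c we assms by (simp add: ev_append ev_closed Q.m_assoc)
  finally show ?thesis using c we wc we' by (intro exI[of _ "c @ e"]) simp
qed

lemma inverse_word:
  "wf w \<Longrightarrow> \<exists>w'. wf w' \<and> ev w' = inv (ev w) \<and> wt w' = wt w"
proof (induction w)
  case (Cons p w)
  obtain v g where p: "p = (v, g)" by (cases p)
  have V: "v \<in> V" "g \<in> carrier (G v)" "wf w" using Cons.prems p by auto
  interpret Gv: group "G v" using group_factor V by simp
  obtain w' where w': "wf w'" "ev w' = inv (ev w)" "wt w' = wt w" using Cons V by blast
  note i = ev_inv_syl[OF V(1,2)]
  have "ev (w' @ [(v, inv\<^bsub>G v\<^esub> g)]) = inv (ev (p # w))"
    using ev_append[of w' "[(v, inv\<^bsub>G v\<^esub> g)]"] ev_Cons[of p w] w' V p i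
    by (simp add: Q.inv_mult_group ev_closed)
  then show ?case using w' V p by (intro exI[of _ "w' @ [(v, inv\<^bsub>G v\<^esub> g)]"]) (simp add: f_inv)
qed (intro exI[of _ "[]"], simp)

theorem short_conjugator:
  assumes "wf a" "wf b" "q \<in> carrier Q" "ev a \<otimes> q = q \<otimes> ev b"
  shows "\<exists>c. wf c \<and> ev a \<otimes> ev c = ev c \<otimes> ev b \<and> wt c \<le> (2 * Suc (card V) + K) * (wt a + wt b)"
proof -
  have red: "\<exists>h x. wf h \<and> wf x \<and> cyc_reduced x \<and> ev a \<otimes> ev h = ev h \<otimes> ev x \<and> wt x \<le> wt a \<and>
    wt h \<le> Suc (card V) * wt a" if a: "wf a" for a
  proof -
    obtain r where r: "wf r" "reduced r" "ev r = ev a" "wt r \<le> wt a" using reduced_form[OF a] by blast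
    obtain h x where h: "wf h" "wf x" "cyc_reduced x" "ev r \<otimes> ev h = ev h \<otimes> ev x" "wt x \<le> wt r"
      "wt h \<le> Suc (card V) * wt r" using cyclic_reduction[OF r(1,2)] by blast
    have "wt x \<le> wt a" by (rule order_trans[OF h(5) r(4)])
    moreover have "wt h \<le> Suc (card V) * wt a" by (rule order_trans[OF h(6) mult_le_mono2[OF r(4)]])
    ultimately show ?thesis using h(1-4) r(3) by auto
  qed
  obtain h x where h: "wf h" "wf x" "cyc_reduced x" "ev a \<otimes> ev h = ev h \<otimes> ev x" "wt x \<le> wt a"
    "wt h \<le> Suc (card V) * wt a" using red[OF assms(1)] by blast
  obtain h' y where h': "wf h'" "wf y" "cyc_reduced y" "ev b \<otimes> ev h' = ev h' \<otimes> ev y" "wt y \<le> wt b"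
    "wt h' \<le> Suc (card V) * wt b" using red[OF assms(2)] by blast
  obtain i where i: "wf i" "ev i = inv (ev h')" "wt i = wt h'" using inverse_word[OF h'(1)] by blast
  note cl = assms(3) ev_closed[OF assms(1)] ev_closed[OF assms(2)] ev_closed[OF h(1)] ev_closed[OF h(2)]
    ev_closed[OF h'(1)] ev_closed[OF h'(2)]
  have yi: "ev y \<otimes> ev i = ev i \<otimes> ev b"
  proof -
    have "ev i \<otimes> (ev b \<otimes> ev h') \<otimes> ev i = ev y \<otimes> ev i"
      unfolding h'(4) i(2) using cl by (simp add: Q.m_assoc[symmetric])
    moreover have "ev i \<otimes> (ev b \<otimes> ev h') \<otimes> ev i = ev i \<otimes> ev b"
      unfolding i(2) using cl by (simp add: Q.m_assoc)
    ultimately show ?thesis by simp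
  qed
  have xq: "ev x = inv (ev h) \<otimes> ev a \<otimes> ev h" using h(4) cl by (simp add: Q.m_assoc Q.inv_mult_cancel)
  have "ev x \<otimes> (inv (ev h) \<otimes> q \<otimes> ev h') = inv (ev h) \<otimes> (ev a \<otimes> q) \<otimes> ev h'"
    unfolding xq using cl by (simp add: Q.m_assoc Q.inv_mult_cancel)
  also have "\<dots> = inv (ev h) \<otimes> q \<otimes> (ev b \<otimes> ev h')"
    unfolding assms(4) using cl by (simp add: Q.m_assoc)
  also have "\<dots> = (inv (ev h) \<otimes> q \<otimes> ev h') \<otimes> ev y"
    unfolding h'(4) using cl by (simp add: Q.m_assoc)
  finally have "twisted_conj x y"
    using cyc_reduced_conjugate_twisted_conj[OF h(2,3) h'(2,3)] cl by (meson Q.inv_closed Q.m_closed)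
  then obtain c where c: "wf c" "ev x \<otimes> ev c = ev c \<otimes> ev y"
    "wt c \<le> K * (wt x + wt y) + Suc (card V) * wt y" using short_twisted_conj h h' by blast
  have "ev a \<otimes> ev (h @ c @ i) = (ev a \<otimes> ev h) \<otimes> ev c \<otimes> ev i"
    using h(1,2) c(1) i(1) cl by (simp add: ev_append ev_closed Q.m_assoc)
  also have "\<dots> = ev h \<otimes> (ev x \<otimes> ev c) \<otimes> ev i"
    unfolding h(4) using h(1,2) c(1) i(1) cl by (simp add: ev_closed Q.m_assoc)
  also have "\<dots> = ev h \<otimes> ev c \<otimes> (ev y \<otimes> ev i)"
    unfolding c(2) using h(1,2) c(1) i(1) cl by (simp add: ev_closed Q.m_assoc)
  also have "\<dots> = ev (h @ c @ i) \<otimes> ev b"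
    unfolding yi using h(1,2) c(1) i(1) cl by (simp add: ev_append ev_closed Q.m_assoc)
  finally have "ev a \<otimes> ev (h @ c @ i) = ev (h @ c @ i) \<otimes> ev b" .
  moreover have "wt (h @ c @ i) \<le> (2 * Suc (card V) + K) * (wt a + wt b)"
  proof -
    have "K * (wt x + wt y) \<le> K * (wt a + wt b)" using h(5) h'(5) by (intro mult_le_mono2 add_mono)
    moreover have "Suc (card V) * wt y \<le> Suc (card V) * wt b" using h'(5) by (rule mult_le_mono2)
    ultimately have "wt (h @ c @ i) \<le>
        Suc (card V) * wt a + K * (wt a + wt b) + Suc (card V) * wt b + Suc (card V) * wt b"
      using c(3) h(6) h'(6) i(3) unfolding weight_simps by linarith
    also have "\<dots> \<le> (2 * Suc (card V) + K) * (wt a + wt b)" by (simp add: algebra_simps)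
    finally show ?thesis .
  qed
  ultimately show ?thesis using h c i by (intro exI[of _ "h @ c @ i"]) simp
qed

end

section \<open>Word length and the conjugacy length function\<close>

context group
begin

abbreviation letters :: "'a set \<Rightarrow> 'a set" where
  "letters S \<equiv> S \<union> m_inv G ` S"

abbreviation eval_word :: "'a list \<Rightarrow> 'a" where
  "eval_word w \<equiv> foldr (\<otimes>) w \<one>"

lemma letters_closed: "S \<subseteq> carrier G \<Longrightarrow> letters S \<subseteq> carrier G"
  by auto

lemma eval_word_closed: "set w \<subseteq> carrier G \<Longrightarrow> eval_word w \<in> carrier G"
  by (induction w) auto

lemma eval_word_append:
  "set v \<subseteq> carrier G \<Longrightarrow> set w \<subseteq> carrier G \<Longrightarrow> eval_word (v @ w) = eval_word v \<otimes> eval_word w"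
  by (induction v) (auto simp: eval_word_closed m_assoc simp del: foldr_append)

lemma eval_word_inv:
  "set w \<subseteq> carrier G \<Longrightarrow> eval_word (rev (map (m_inv G) w)) = inv (eval_word w)"
proof (induction w)
  case (Cons x w)
  have "set (rev (map (m_inv G) w)) \<subseteq> carrier G" using Cons.prems by auto
  then have "eval_word (rev (map (m_inv G) (x # w))) = eval_word (rev (map (m_inv G) w)) \<otimes> inv x"
    using eval_word_append[of "rev (map (m_inv G) w)" "[inv x]"] Cons.prems by simp
  then show ?case using Cons by (simp add: inv_mult_group eval_word_closed)
qed simp

lemma generate_word:
  assumes "S \<subseteq> carrier G" "g \<in> generate G S"
  shows "\<exists>w. set w \<subseteq> letters S \<and> eval_word w = g"
  using assms(2)
proof induction
  case one
  show ?case by (intro exI[of _ "[]"]) simp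
next
  case (incl h)
  then show ?case using assms(1) by (intro exI[of _ "[h]"]) auto
next
  case (inv h)
  then show ?case using assms(1) by (intro exI[of _ "[inv h]"]) auto
next
  case (eng h1 h2)
  then obtain v w where "set v \<subseteq> letters S" "eval_word v = h1" "set w \<subseteq> letters S" "eval_word w = h2"
    by blast
  then show ?case using letters_closed[OF assms(1)] eval_word_append[of v w]
    by (intro exI[of _ "v @ w"]) (auto simp del: foldr_append)
qed

context
  fixes S assumes S: "finite_generating_set G S"
begin

lemma generating_set_closed: "S \<subseteq> carrier G" using S by (simp add: finite_generating_set_def)

lemma word_length_attained:
  assumes "g \<in> carrier G"
  obtains w where "length w = word_length G S g" "set w \<subseteq> letters S" "eval_word w = g"
proof -
  have "g \<in> generate G S" using S assms by (simp add: finite_generating_set_def)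
  then have "\<exists>n w. length w = n \<and> set w \<subseteq> letters S \<and> eval_word w = g"
    using generate_word[OF generating_set_closed] by blast
  from LeastI_ex[OF this] show ?thesis using that unfolding word_length_def by blast
qed

lemma word_length_le: "set w \<subseteq> letters S \<Longrightarrow> word_length G S (eval_word w) \<le> length w"
  unfolding word_length_def by (rule Least_le) blast

lemma word_length_one: "word_length G S \<one> = 0"
  using word_length_le[of "[]"] by simp

lemma word_length_0_D: "g \<in> carrier G \<Longrightarrow> word_length G S g = 0 \<Longrightarrow> g = \<one>"
  using word_length_attained[of g] by (metis foldr.simps(1) id_apply length_0_conv)

lemma word_length_mult:
  assumes "g \<in> carrier G" "h \<in> carrier G"
  shows "word_length G S (g \<otimes> h) \<le> word_length G S g + word_length G S h"
proof -
  obtain v where v: "length v = word_length G S g" "set v \<subseteq> letters S" "eval_word v = g"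
    using word_length_attained[OF assms(1)] .
  obtain w where w: "length w = word_length G S h" "set w \<subseteq> letters S" "eval_word w = h"
    using word_length_attained[OF assms(2)] .
  have c: "set v \<subseteq> carrier G" "set w \<subseteq> carrier G" using v w letters_closed[OF generating_set_closed] by auto
  have "set (v @ w) \<subseteq> letters S" using v w by simp
  from word_length_le[OF this] show ?thesis
    unfolding eval_word_append[OF c] v(3) w(3) length_append v(1) w(1) .
qed

lemma word_length_inv_le:
  assumes "g \<in> carrier G" shows "word_length G S (inv g) \<le> word_length G S g"
proof -
  obtain v where v: "length v = word_length G S g" "set v \<subseteq> letters S" "eval_word v = g"
    using word_length_attained[OF assms] .
  have c: "set v \<subseteq> carrier G" using v letters_closed[OF generating_set_closed] by auto
  have "inv x \<in> letters S" if "x \<in> letters S" for x using that generating_set_closed by auto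
  then have "set (rev (map (m_inv G) v)) \<subseteq> letters S"
    unfolding set_rev set_map using v(2) by (intro image_subsetI) blast
  from word_length_le[OF this] show ?thesis unfolding eval_word_inv[OF c] v(3) using v(1) by simp
qed

lemma word_length_inv:
  assumes "g \<in> carrier G" shows "word_length G S (inv g) = word_length G S g"
  using word_length_inv_le[OF assms] word_length_inv_le[of "inv g"] assms by simp

lemma finite_ball: "finite {g \<in> carrier G. word_length G S g \<le> n}"
proof (rule finite_subset)
  show "{g \<in> carrier G. word_length G S g \<le> n} \<subseteq> eval_word ` {w. set w \<subseteq> letters S \<and> length w \<le> n}"
  proof
    fix g assume g: "g \<in> {g \<in> carrier G. word_length G S g \<le> n}"
    then obtain w where "length w = word_length G S g" "set w \<subseteq> letters S" "eval_word w = g"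
      using word_length_attained by blast
    then show "g \<in> eval_word ` {w. set w \<subseteq> letters S \<and> length w \<le> n}" using g by auto
  qed
  show "finite (eval_word ` {w. set w \<subseteq> letters S \<and> length w \<le> n})"
    using S by (intro finite_imageI finite_lists_length_le) (simp add: finite_generating_set_def)
qed

lemma conj_length_le: "c \<in> conjugators G a b \<Longrightarrow> conj_length G S a b \<le> word_length G S c"
  unfolding conj_length_def by (rule Least_le) blast

lemma conj_length_attained:
  assumes "conjugators G a b \<noteq> {}"
  obtains c where "c \<in> conjugators G a b" "word_length G S c = conj_length G S a b"
proof -
  have "\<exists>k. \<exists>c\<in>conjugators G a b. word_length G S c = k" using assms by blast
  from LeastI_ex[OF this] show ?thesis using that unfolding conj_length_def by blast
qed

lemma one_conjugator: "\<one> \<in> conjugators G \<one> \<one>"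
  by (simp add: conjugators_def)

text \<open>
  The bound makes the set defining \<^const>\<open>CLF\<close> finite, and the trivial pair makes it non-empty, so
  that \<^const>\<open>Max\<close> picks one of its elements.
\<close>
lemma linear_CLF_I:
  assumes "\<And>a b. a \<in> carrier G \<Longrightarrow> b \<in> carrier G \<Longrightarrow> conjugators G a b \<noteq> {} \<Longrightarrow>
    \<exists>c\<in>conjugators G a b. word_length G S c \<le> M * (word_length G S a + word_length G S b)"
  shows "linear_CLF G S"
  unfolding linear_CLF_def
proof (intro exI allI impI)
  fix n :: nat
  let ?L = "{conj_length G S a b | a b. a \<in> carrier G \<and> b \<in> carrier G \<and> conjugators G a b \<noteq> {} \<and>
     word_length G S a + word_length G S b \<le> n}"
  have bound: "l \<le> M * n" if l: "l \<in> ?L" for l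
  proof -
    obtain a b where ab: "l = conj_length G S a b" "a \<in> carrier G" "b \<in> carrier G"
      "conjugators G a b \<noteq> {}" "word_length G S a + word_length G S b \<le> n" using l by blast
    obtain c where c: "c \<in> conjugators G a b"
      "word_length G S c \<le> M * (word_length G S a + word_length G S b)"
      using assms[OF ab(2-4)] by blast
    have "M * (word_length G S a + word_length G S b) \<le> M * n" using ab(5) by (rule mult_le_mono2)
    then show ?thesis using conj_length_le[OF c(1)] c(2) ab(1) by linarith
  qed
  then have "finite ?L" by (meson finite_nat_set_iff_bounded_le)
  moreover have "conj_length G S \<one> \<one> \<in> ?L" using one_conjugator word_length_one by fastforce
  then have "?L \<noteq> {}" by blast
  ultimately have "CLF G S n \<in> ?L" unfolding CLF_def by (rule Max_in)
  then have "CLF G S n \<le> M * n" by (rule bound)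
  then have "real (CLF G S n) \<le> real (M * n)" by (rule of_nat_mono)
  then show "real (CLF G S n) \<le> real M * real n" by simp
qed

text \<open>
  Finiteness of balls is needed here for \<^const>\<open>Max\<close> to be an upper bound. The pair of trivial elements
  is treated apart, since linearity says nothing about \<open>n = 0\<close>.
\<close>
lemma linear_CLF_D:
  assumes "linear_CLF G S"
  shows "\<exists>M. \<forall>a\<in>carrier G. \<forall>b\<in>carrier G. conjugators G a b \<noteq> {} \<longrightarrow>
    (\<exists>c\<in>conjugators G a b. word_length G S c \<le> M * (word_length G S a + word_length G S b))"
proof -
  obtain K :: real where K: "\<And>n. n \<ge> 1 \<Longrightarrow> real (CLF G S n) \<le> K * real n"
    using assms by (auto simp: linear_CLF_def)
  define M where "M = nat \<lceil>K\<rceil>"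
  have KM: "K \<le> real M" unfolding M_def by linarith
  have "\<exists>c\<in>conjugators G a b. word_length G S c \<le> M * (word_length G S a + word_length G S b)"
    if ab: "a \<in> carrier G" "b \<in> carrier G" "conjugators G a b \<noteq> {}" for a b
  proof (cases "word_length G S a + word_length G S b = 0")
    case True
    then have "a = \<one>" "b = \<one>" using word_length_0_D ab by auto
    then show ?thesis using one_conjugator word_length_one by (intro bexI[of _ \<one>]) auto
  next
    case False
    let ?n = "word_length G S a + word_length G S b"
    let ?L = "{conj_length G S a b | a b. a \<in> carrier G \<and> b \<in> carrier G \<and> conjugators G a b \<noteq> {} \<and>
     word_length G S a + word_length G S b \<le> ?n}"
    let ?B = "{g \<in> carrier G. word_length G S g \<le> ?n}"
    have "?L \<subseteq> (\<lambda>(a, b). conj_length G S a b) ` (?B \<times> ?B)" by fastforce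
    then have "finite ?L" using finite_ball[of ?n] by (meson finite_SigmaI finite_imageI finite_subset)
    moreover have "conj_length G S a b \<in> ?L" using ab by blast
    ultimately have "conj_length G S a b \<le> CLF G S ?n" unfolding CLF_def by (rule Max_ge)
    then have "real (conj_length G S a b) \<le> K * real ?n" using K[of ?n] False by linarith
    also have "\<dots> \<le> real M * real ?n" using KM by (rule mult_right_mono) simp
    also have "\<dots> = real (M * ?n)" by simp
    finally have "conj_length G S a b \<le> M * ?n" by (simp only: of_nat_le_iff)
    moreover obtain c where "c \<in> conjugators G a b" "word_length G S c = conj_length G S a b"
      using conj_length_attained[OF ab(3)] .
    ultimately show ?thesis by metis
  qed
  then show ?thesis by blast
qed

end
end

section \<open>Weights and word length in the graph product\<close>

context syllable_evaluation
begin

lemma finite_generating_set_ev: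
  assumes S: "\<And>v. v \<in> V \<Longrightarrow> finite_generating_set (G v) (S v)"
  shows "finite_generating_set Q (\<Union>v\<in>V. (\<lambda>s. ev [(v, s)]) ` S v)" (is "finite_generating_set Q ?T")
proof -
  have SG: "S v \<subseteq> carrier (G v)" "finite (S v)" "generate (G v) (S v) = carrier (G v)" if "v \<in> V" for v
    using S[OF that] by (auto simp: finite_generating_set_def)
  have T: "?T \<subseteq> carrier Q" using SG(1) by (auto intro!: ev_syl_closed)
  have syl: "ev [(v, g)] \<in> generate Q ?T" if v: "v \<in> V" and g: "g \<in> generate (G v) (S v)" for v g
    using g
  proof induction
    case one
    show ?case using ev_one[OF v] generate.one[of Q ?T] by simp
  next
    case (incl h)
    then show ?case using v by (intro generate.incl) blast
  next
    case (inv h)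
    then have "ev [(v, inv\<^bsub>G v\<^esub> h)] = inv (ev [(v, h)])" using SG(1)[OF v] v by (intro ev_inv_syl) auto
    then show ?case using inv v generate.inv[of "ev [(v, h)]" ?T Q] by auto
  next
    case (eng h1 h2)
    then have "h1 \<in> carrier (G v)" "h2 \<in> carrier (G v)" using SG(3)[OF v] by auto
    then show ?case using generate.eng[OF eng.IH] ev_mult[OF v] by simp
  qed
  have "ev w \<in> generate Q ?T" if "wf w" for w
    using that
  proof (induction w)
    case Nil
    show ?case using generate.one[of Q ?T] by simp
  next
    case (Cons p w)
    obtain v g where p: "p = (v, g)" by (cases p)
    then show ?case using Cons SG(3)[of v] syl[of v g] ev_Cons[of p w] generate.eng[of _ Q ?T "ev w"] by auto
  qed
  then have "carrier Q \<subseteq> generate Q ?T" using ev_surj by blast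
  then have "generate Q ?T = carrier Q" using Q.generate_incl[OF T] by blast
  then show ?thesis using T SG(2) finite_V by (auto simp: finite_generating_set_def)
qed

lemma word_length_le_weight:
  assumes S: "\<And>v. v \<in> V \<Longrightarrow> finite_generating_set (G v) (S v)"
    and T: "finite_generating_set Q T"
  shows "\<exists>M. \<forall>w. wf w \<longrightarrow> word_length Q T (ev w) \<le> M * weight (\<lambda>(v, g). word_length (G v) (S v) g) w"
proof -
  let ?f = "\<lambda>(v, g). word_length (G v) (S v) g"
  \<comment> \<open>A sum serves as a common bound without assuming that there are any vertices or generators.\<close>
  define M where "M = (\<Sum>v\<in>V. \<Sum>s\<in>S v. word_length Q T (ev [(v, s)]))"
  have syl: "word_length Q T (ev [(v, g)]) \<le> M * word_length (G v) (S v) g"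
    if v: "v \<in> V" and g: "g \<in> carrier (G v)" for v g
  proof -
    interpret Gv: group "G v" using group_factor v by simp
    have Sv: "S v \<subseteq> carrier (G v)" "finite (S v)" using S[OF v] by (auto simp: finite_generating_set_def)
    have letter: "word_length Q T (ev [(v, x)]) \<le> M" if x: "x \<in> Gv.letters (S v)" for x
    proof -
      have gen: "word_length Q T (ev [(v, s)]) \<le> M" if s: "s \<in> S v" for s
      proof -
        have "word_length Q T (ev [(v, s)]) \<le> (\<Sum>s\<in>S v. word_length Q T (ev [(v, s)]))"
          using s Sv(2) by (intro member_le_sum) auto
        also have "\<dots> \<le> M" unfolding M_def using v finite_V by (intro member_le_sum) auto
        finally show ?thesis .
      qed
      show ?thesis
      proof (cases "x \<in> S v")
        case False
        then obtain s where s: "s \<in> S v" "x = inv\<^bsub>G v\<^esub> s" using x by blast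
        then have "s \<in> carrier (G v)" using Sv by blast
        then have "word_length Q T (ev [(v, x)]) = word_length Q T (ev [(v, s)])"
          using s v by (simp add: ev_inv_syl Q.word_length_inv[OF T] ev_syl_closed)
        then show ?thesis using gen s by simp
      qed (rule gen)
    qed
    have word: "word_length Q T (ev [(v, Gv.eval_word xs)]) \<le> M * length xs" if "set xs \<subseteq> Gv.letters (S v)" for xs
      using that
    proof (induction xs)
      case Nil
      show ?case using v by (simp add: ev_one Q.word_length_one[OF T])
    next
      case (Cons x xs)
      have c: "x \<in> carrier (G v)" "Gv.eval_word xs \<in> carrier (G v)"
        using Cons.prems Gv.letters_closed[OF Sv(1)] by (auto intro!: Gv.eval_word_closed)
      have "word_length Q T (ev [(v, Gv.eval_word (x # xs))]) =
          word_length Q T (ev [(v, x)] \<otimes> ev [(v, Gv.eval_word xs)])" using v c by (simp add: ev_mult)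
      also have "\<dots> \<le> word_length Q T (ev [(v, x)]) + word_length Q T (ev [(v, Gv.eval_word xs)])"
        using v c by (intro Q.word_length_mult[OF T] ev_syl_closed)
      also have "\<dots> \<le> M + M * length xs" using letter[of x] Cons by (intro add_mono) auto
      finally show ?case by simp
    qed
    obtain xs where "length xs = word_length (G v) (S v) g" "set xs \<subseteq> Gv.letters (S v)" "Gv.eval_word xs = g"
      using Gv.word_length_attained[OF S[OF v] g] .
    then show ?thesis using word[of xs] by simp
  qed
  have "word_length Q T (ev w) \<le> M * weight ?f w" if "wf w" for w
    using that
  proof (induction w)
    case Nil
    show ?case by (simp add: Q.word_length_one[OF T])
  next
    case (Cons p w)
    obtain v g where p: "p = (v, g)" by (cases p)
    have c: "v \<in> V" "g \<in> carrier (G v)" "wf w" using Cons.prems p by auto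
    have "word_length Q T (ev (p # w)) \<le> word_length Q T (ev [(v, g)]) + word_length Q T (ev w)"
      using ev_Cons[OF Cons.prems] p Q.word_length_mult[OF T ev_syl_closed[OF c(1,2)] ev_closed[OF c(3)]] by simp
    also have "\<dots> \<le> M * word_length (G v) (S v) g + M * weight ?f w"
      using syl c Cons.IH by (intro add_mono) auto
    finally show ?case using p by (simp add: algebra_simps)
  qed
  then show ?thesis by blast
qed

end

context weighted_evaluation
begin

lemma weight_le_word_length:
  assumes T: "finite_generating_set Q T"
  shows "\<exists>M. \<forall>q\<in>carrier Q. \<exists>w. wf w \<and> ev w = q \<and> wt w \<le> M * word_length Q T q"
proof -
  have Tc: "T \<subseteq> carrier Q" "finite T" using T by (auto simp: finite_generating_set_def)
  have "\<forall>t\<in>T. \<exists>w. wf w \<and> ev w = t" using Tc ev_surj by blast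
  then obtain \<omega> where om: "\<And>t. t \<in> T \<Longrightarrow> wf (\<omega> t) \<and> ev (\<omega> t) = t" by metis
  define M where "M = (\<Sum>t\<in>T. wt (\<omega> t))"
  have gen: "wt (\<omega> t) \<le> M" if "t \<in> T" for t
    unfolding M_def using that Tc(2) by (intro member_le_sum) auto
  have letter: "\<exists>w. wf w \<and> ev w = x \<and> wt w \<le> M" if x: "x \<in> Q.letters T" for x
  proof (cases "x \<in> T")
    case True
    then show ?thesis using om gen by blast
  next
    case False
    then obtain t where t: "t \<in> T" "x = inv t" using x by blast
    then obtain w where "wf w" "ev w = inv t" "wt w = wt (\<omega> t)" using inverse_word[of "\<omega> t"] om by auto
    then show ?thesis using t gen by auto
  qed
  have word: "\<exists>w. wf w \<and> ev w = Q.eval_word xs \<and> wt w \<le> M * length xs" if "set xs \<subseteq> Q.letters T" for xs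
    using that
  proof (induction xs)
    case Nil
    show ?case by (intro exI[of _ "[]"]) simp
  next
    case (Cons x xs)
    then obtain w where w: "wf w" "ev w = Q.eval_word xs" "wt w \<le> M * length xs" by auto
    obtain u where u: "wf u" "ev u = x" "wt u \<le> M" using letter Cons.prems by auto
    show ?case using w u by (intro exI[of _ "u @ w"]) (simp add: ev_append)
  qed
  have "\<exists>w. wf w \<and> ev w = q \<and> wt w \<le> M * word_length Q T q" if q: "q \<in> carrier Q" for q
  proof -
    obtain xs where xs: "length xs = word_length Q T q" "set xs \<subseteq> Q.letters T" "Q.eval_word xs = q"
      using Q.word_length_attained[OF T q] .
    then show ?thesis using word[OF xs(2)] by simp
  qed
  then show ?thesis by blast
qed

end

section \<open>Linear conjugacy length functions of graph products\<close>

theorem mainTheorem6: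
  fixes \<Gamma> :: "'v pair_pre_digraph"
    and G :: "'v \<Rightarrow> ('g, 'm) monoid_scheme"
    and S :: "'v \<Rightarrow> 'g set"
  assumes "pair_graph \<Gamma>"
    and "\<And>u. u \<in> pverts \<Gamma> \<Longrightarrow> group (G u)"
    and "\<And>u. u \<in> pverts \<Gamma> \<Longrightarrow> carrier (G u) \<noteq> {\<one>\<^bsub>G u\<^esub>}"
    and "\<And>u. u \<in> pverts \<Gamma> \<Longrightarrow> finite_generating_set (G u) (S u)"
    and "\<And>u. u \<in> pverts \<Gamma> \<Longrightarrow> linear_CLF (G u) (S u)"
  shows "(\<exists>T. finite_generating_set (graph_product \<Gamma> G) T) \<and>
    (\<forall>T. finite_generating_set (graph_product \<Gamma> G) T \<longrightarrow> linear_CLF (graph_product \<Gamma> G) T)"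
proof -
  let ?V = "pverts \<Gamma>" and ?Q = "graph_product \<Gamma> G"
  interpret graph_product_words \<Gamma> G
    using assms(1,2) by (intro graph_product_words.intro group_family.intro)
  define f where "f = (\<lambda>(v, g). word_length (G v) (S v) g)"
  have "\<forall>v\<in>?V. \<exists>M. \<forall>a\<in>carrier (G v). \<forall>b\<in>carrier (G v). conjugators (G v) a b \<noteq> {} \<longrightarrow>
    (\<exists>c\<in>conjugators (G v) a b. word_length (G v) (S v) c
      \<le> M * (word_length (G v) (S v) a + word_length (G v) (S v) b))"
    using group.linear_CLF_D[OF assms(2,4,5)] by blast
  then obtain M where M: "\<And>v a b. v \<in> ?V \<Longrightarrow> a \<in> carrier (G v) \<Longrightarrow> b \<in> carrier (G v) \<Longrightarrow>
      conjugators (G v) a b \<noteq> {} \<Longrightarrow> \<exists>c\<in>conjugators (G v) a b. word_length (G v) (S v) c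
      \<le> M v * (word_length (G v) (S v) a + word_length (G v) (S v) b)"
    by metis
  define K where "K = (\<Sum>v\<in>?V. M v)"
  interpret weighted_evaluation "\<lambda>u v. (u, v) \<in> parcs \<Gamma>" ?V G ?Q ev f K
  proof
    fix v g h assume v: "v \<in> ?V" and g: "g \<in> carrier (G v)" and h: "h \<in> carrier (G v)"
    then show "f (v, g \<otimes>\<^bsub>G v\<^esub> h) \<le> f (v, g) + f (v, h)"
      by (simp add: f_def group.word_length_mult[OF assms(2,4)])
  next
    fix v g assume "v \<in> ?V" "g \<in> carrier (G v)"
    then show "f (v, inv\<^bsub>G v\<^esub> g) = f (v, g)"
      by (simp add: f_def group.word_length_inv[OF assms(2,4)])
  next
    fix v g k assume v: "v \<in> ?V" and g: "g \<in> carrier (G v)" and k: "k \<in> carrier (G v)"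
    interpret Gv: group "G v" using assms(2) v .
    let ?h = "inv\<^bsub>G v\<^esub> k \<otimes>\<^bsub>G v\<^esub> g \<otimes>\<^bsub>G v\<^esub> k"
    have h: "?h \<in> carrier (G v)" using g k by simp
    have "k \<otimes>\<^bsub>G v\<^esub> ?h \<otimes>\<^bsub>G v\<^esub> inv\<^bsub>G v\<^esub> k = g" using g k by (simp add: Gv.m_assoc Gv.inv_mult_cancel)
    then have "k \<in> conjugators (G v) ?h g" using k by (simp add: conjugators_def)
    then obtain l where l: "l \<in> conjugators (G v) ?h g"
      "word_length (G v) (S v) l \<le> M v * (word_length (G v) (S v) ?h + word_length (G v) (S v) g)"
      using M[OF v h g] by blast
    have lc: "l \<in> carrier (G v)" and lg: "l \<otimes>\<^bsub>G v\<^esub> ?h \<otimes>\<^bsub>G v\<^esub> inv\<^bsub>G v\<^esub> l = g"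
      using l(1) by (auto simp: conjugators_def)
    have "inv\<^bsub>G v\<^esub> l \<otimes>\<^bsub>G v\<^esub> (l \<otimes>\<^bsub>G v\<^esub> ?h \<otimes>\<^bsub>G v\<^esub> inv\<^bsub>G v\<^esub> l) \<otimes>\<^bsub>G v\<^esub> l = ?h"
      using lc g k by (simp add: Gv.m_assoc Gv.inv_mult_cancel)
    then have inv_l: "inv\<^bsub>G v\<^esub> l \<otimes>\<^bsub>G v\<^esub> g \<otimes>\<^bsub>G v\<^esub> l = ?h" unfolding lg .
    have "M v \<le> K" unfolding K_def using v finite_V by (intro member_le_sum) auto
    then have "M v * (f (v, g) + f (v, ?h)) \<le> K * (f (v, g) + f (v, ?h))" by (rule mult_le_mono1)
    moreover have "f (v, l) \<le> M v * (f (v, g) + f (v, ?h))" using l(2) by (simp add: f_def add.commute)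
    ultimately have "f (v, l) \<le> K * (f (v, g) + f (v, ?h))" by linarith
    with inv_l show "\<exists>l\<in>carrier (G v). inv\<^bsub>G v\<^esub> l \<otimes>\<^bsub>G v\<^esub> g \<otimes>\<^bsub>G v\<^esub> l = ?h \<and>
        f (v, l) \<le> K * (f (v, g) + f (v, ?h))" using lc by blast
  qed
  have "linear_CLF ?Q T" if T: "finite_generating_set ?Q T" for T
  proof -
    obtain M1 where M1: "\<And>w. wf w \<Longrightarrow> word_length ?Q T (ev w) \<le> M1 * wt w"
      using word_length_le_weight[OF assms(4) T] unfolding f_def by blast
    obtain M2 where M2: "\<And>q. q \<in> carrier ?Q \<Longrightarrow> \<exists>w. wf w \<and> ev w = q \<and> wt w \<le> M2 * word_length ?Q T q"
      using weight_le_word_length[OF T] by blast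
    let ?C = "2 * Suc (card ?V) + K"
    show ?thesis
    proof (rule Q.linear_CLF_I[OF T, where M = "M1 * (?C * M2)"])
      fix a b assume a: "a \<in> carrier ?Q" and b: "b \<in> carrier ?Q" and "conjugators ?Q a b \<noteq> {}"
      then obtain q where q: "q \<in> carrier ?Q" "q \<otimes>\<^bsub>?Q\<^esub> a \<otimes>\<^bsub>?Q\<^esub> inv\<^bsub>?Q\<^esub> q = b" by (auto simp: conjugators_def)
      obtain \<alpha> where al: "wf \<alpha>" "ev \<alpha> = a" "wt \<alpha> \<le> M2 * word_length ?Q T a" using M2[OF a] by blast
      obtain \<beta> where be: "wf \<beta>" "ev \<beta> = b" "wt \<beta> \<le> M2 * word_length ?Q T b" using M2[OF b] by blast
      \<comment> \<open>The conjugator carries \<open>a\<close> to \<open>b\<close>, so in the equation the word of \<open>b\<close> stands on the left.\<close>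
      have "ev \<beta> \<otimes>\<^bsub>?Q\<^esub> q = q \<otimes>\<^bsub>?Q\<^esub> ev \<alpha>"
        unfolding al(2) be(2) q(2)[symmetric] using q(1) a by (simp add: Q.m_assoc)
      then obtain c where c: "wf c" "b \<otimes>\<^bsub>?Q\<^esub> ev c = ev c \<otimes>\<^bsub>?Q\<^esub> a" "wt c \<le> ?C * (wt \<beta> + wt \<alpha>)"
        using short_conjugator[OF be(1) al(1) q(1)] unfolding al(2) be(2) by blast
      have cc: "ev c \<in> carrier ?Q" using c(1) by (rule ev_closed)
      have "ev c \<otimes>\<^bsub>?Q\<^esub> a \<otimes>\<^bsub>?Q\<^esub> inv\<^bsub>?Q\<^esub> ev c = b"
        unfolding c(2)[symmetric] using cc b by (simp add: Q.m_assoc)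
      then have "ev c \<in> conjugators ?Q a b" using cc by (simp add: conjugators_def)
      moreover have "word_length ?Q T (ev c) \<le> M1 * (?C * M2) * (word_length ?Q T a + word_length ?Q T b)"
      proof -
        have "wt \<beta> + wt \<alpha> \<le> M2 * (word_length ?Q T a + word_length ?Q T b)"
          using al(3) be(3) by (simp add: algebra_simps)
        then have "?C * (wt \<beta> + wt \<alpha>) \<le> ?C * (M2 * (word_length ?Q T a + word_length ?Q T b))"
          by (rule mult_le_mono2)
        from order_trans[OF c(3) this]
        have "M1 * wt c \<le> M1 * (?C * (M2 * (word_length ?Q T a + word_length ?Q T b)))"
          by (rule mult_le_mono2)
        then show ?thesis using M1[OF c(1)] by (simp only: mult.assoc)
      qed
      ultimately show "\<exists>c\<in>conjugators ?Q a b. word_length ?Q T c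
          \<le> M1 * (?C * M2) * (word_length ?Q T a + word_length ?Q T b)" by blast
    qed
  qed
  moreover have "\<exists>T. finite_generating_set ?Q T" using finite_generating_set_ev[of S] assms(4) by blast
  ultimately show ?thesis by blast
qed

end
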